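(* Let $n>1$ and $m>1$ be integers. The set $$\{P\in U_{n,m} : g_P \text{ is a Morse function}\}$$ is open and dense in $U_{n,m}$.
   Context: $V_{n,m}$ is the (finite-dimensional) real vector space of homogeneous polynomials in $n$ real variables of degree $2m$, with its usual topology. $U_{n,m}\subset V_{n,m}$ is the subset of those $P$ for which $D_P=\{v\in\mathbb{R}^n : P(v)\le 1\}$ is a strictly convex body (compact, with nonempty interior). $W(n)_{>0}$ is the manifold of $n$-tuples $(v_1,\dots,v_n)$ of Euclidean unit vectors in $\mathbb{R}^n$ with $\det(v_1,\dots,v_n)>0$. For $P\in U_{n,m}$ the function $g_P:W(n)_{>0}\to\mathbb{R}$ is $$g_P(v_1,\dots,v_n)=\frac{\det(v_1,\dots,v_n)}{\prod_{i=1}^n P(v_i)^{1/(2m)}}.$$ It is a Morse function if all its critical points are nondegenerate. *)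

theory Defs
  imports "HOL-Analysis.Analysis"
begin

section \<open>Homogeneous polynomials\<close>

text \<open>A homogeneous polynomial of degree \<open>d\<close> in the variables indexed by \<open>'n\<close> is
  represented by its coefficient family, indexed by exponent vectors and supported on those of
  total degree \<open>d\<close>. As this support is finite, the product topology on coefficient families
  restricts to the usual topology of the finite-dimensional real vector space.\<close>

definition hom_polys :: "nat \<Rightarrow> (('n::finite \<Rightarrow> nat) \<Rightarrow> real) set" where
  "hom_polys d = {P. \<forall>\<alpha>. (\<Sum>i\<in>UNIV. \<alpha> i) \<noteq> d \<longrightarrow> P \<alpha> = 0}"

definition hom_eval :: "nat \<Rightarrow> (('n::finite \<Rightarrow> nat) \<Rightarrow> real) \<Rightarrow> real^'n \<Rightarrow> real" where
  "hom_eval d P x = (\<Sum>\<alpha> | (\<Sum>i\<in>UNIV. \<alpha> i) = d. P \<alpha> * (\<Prod>i\<in>UNIV. (x $ i) ^ \<alpha> i))"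

definition strictly_convex_body :: "'a::euclidean_space set \<Rightarrow> bool" where
  "strictly_convex_body D \<longleftrightarrow> compact D \<and> convex D \<and> interior D \<noteq> {} \<and>
     (\<forall>x\<in>D. \<forall>y\<in>D. x \<noteq> y \<longrightarrow> open_segment x y \<subseteq> interior D)"

definition U_set :: "nat \<Rightarrow> (('n::finite \<Rightarrow> nat) \<Rightarrow> real) set" where
  "U_set m = {P \<in> hom_polys (2 * m). strictly_convex_body {v. hom_eval (2 * m) P v \<le> 1}}"


section \<open>Morse functions on submanifolds of a Euclidean space\<close>

primrec C_k_on :: "nat \<Rightarrow> 'a::real_normed_vector set \<Rightarrow> ('a \<Rightarrow> 'b::real_normed_vector) \<Rightarrow> bool" where
  "C_k_on 0 U f \<longleftrightarrow> continuous_on U f"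
| "C_k_on (Suc k) U f \<longleftrightarrow>
     (\<forall>x\<in>U. f differentiable (at x)) \<and> (\<forall>v. C_k_on k U (\<lambda>x. frechet_derivative f (at x) v))"

text \<open>Only meant for open sets \<open>U\<close>.\<close>

definition smooth_on :: "'a::real_normed_vector set \<Rightarrow> ('a \<Rightarrow> 'b::real_normed_vector) \<Rightarrow> bool" where
  "smooth_on U f \<longleftrightarrow> (\<forall>k. C_k_on k U f)"

text \<open>A local parametrization (inverse of a chart) of \<open>M\<close> is a diffeomorphism from an open subset
  of a vector space onto a relatively open subset of \<open>M\<close>. To allow any dimension without a type
  for it, the vector space is a linear subspace \<open>S\<close> of the ambient space and the open subset is
  \<open>U \<inter> S\<close>; as usual for subsets of Euclidean spaces, \<open>\<phi>\<close> and its inverse \<open>\<rho>\<close> are smooth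
  if they extend to smooth maps on open sets.\<close>

definition local_parametrization ::
    "'a::euclidean_space set \<Rightarrow> 'a set \<Rightarrow> 'a set \<Rightarrow> ('a \<Rightarrow> 'a) \<Rightarrow> bool" where
  "local_parametrization M S U \<phi> \<longleftrightarrow>
     subspace S \<and> open U \<and> smooth_on U \<phi> \<and>
     (\<exists>V \<rho>. open V \<and> smooth_on V \<rho> \<and> \<phi> ` (U \<inter> S) = M \<inter> V \<and> (\<forall>u\<in>U \<inter> S. \<rho> (\<phi> u) = u))"

definition critical_point :: "'a::euclidean_space set \<Rightarrow> ('a \<Rightarrow> real) \<Rightarrow> 'a \<Rightarrow> bool" where
  "critical_point M f p \<longleftrightarrow> p \<in> M \<and>
     (\<forall>S U \<phi> u. local_parametrization M S U \<phi> \<and> u \<in> U \<inter> S \<and> \<phi> u = p \<longrightarrow>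
        (f \<circ> \<phi> has_derivative (\<lambda>_. 0)) (at u within S))"

definition second_partial ::
    "('a::real_vector \<Rightarrow> real) \<Rightarrow> 'a \<Rightarrow> 'a \<Rightarrow> 'a \<Rightarrow> real" where
  "second_partial h u X Y = deriv (\<lambda>s. deriv (\<lambda>t. h (u + s *\<^sub>R X + t *\<^sub>R Y)) 0) 0"

text \<open>At a critical point, neither notion depends on the parametrization; the quantifiers are
  chosen so that no condition holds vacuously in the definition of a Morse function.\<close>

definition nondegenerate_at :: "'a::euclidean_space set \<Rightarrow> ('a \<Rightarrow> real) \<Rightarrow> 'a \<Rightarrow> bool" where
  "nondegenerate_at M f p \<longleftrightarrow>
     (\<exists>S U \<phi> u. local_parametrization M S U \<phi> \<and> u \<in> U \<inter> S \<and> \<phi> u = p \<and>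
        (\<forall>X\<in>S. (\<forall>Y\<in>S. second_partial (f \<circ> \<phi>) u X Y = 0) \<longrightarrow> X = 0))"

definition morse_on :: "'a::euclidean_space set \<Rightarrow> ('a \<Rightarrow> real) \<Rightarrow> bool" where
  "morse_on M f \<longleftrightarrow> (\<forall>p. critical_point M f p \<longrightarrow> nondegenerate_at M f p)"


section \<open>The function of the theorem\<close>

text \<open>An \<open>n\<close>-tuple of vectors is a matrix whose rows \<open>v $ i\<close> are the vectors. Tuples and
  coordinates use the same index type, so the sign of the determinant does not depend on an
  ordering of the indices.\<close>

definition W_pos :: "(real^'n^'n) set" where
  "W_pos = {v. (\<forall>i. norm (v $ i) = 1) \<and> det v > 0}"

definition g_fun :: "nat \<Rightarrow> (('n::finite \<Rightarrow> nat) \<Rightarrow> real) \<Rightarrow> real^'n^'n \<Rightarrow> real" where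
  "g_fun m P v = det v / (\<Prod>i\<in>UNIV. hom_eval (2 * m) P (v $ i) powr (1 / (2 * real m)))"

end

(* By Euler's identity, and since g_P is homogeneous of degree 0 in each v_i, a frame v is critical
   for g_P iff dP(v_i)(v_j) = 0 for all i /= j. After rescaling to P(v_i) = 1 this says that the
   matrix M_P(w) with entries dP(w_i)(w_j) equals 2m times the identity: n^2 equations in n^2
   unknowns, linear in P, and the critical point is nondegenerate iff dM_P(w) is injective.
   Such w have bounded rows and cannot degenerate to det w = 0, so openness is a compactness argument.
   For density, near a given frame the equation M_{P + sum a_kl Q_kl}(w) = 2m can be solved for the
   parameters a = a(w), with Q_kl built from the dual basis, and Sard's theorem for a(w) yields
   arbitrarily small regular parameters; finitely many such perturbations suffice.
   U_{n,m} need not be open, so P is first moved to P + epsilon |x|^{2m}, which has a neighbourhood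
   inside U_{n,m}. *)

theory Submission
  imports Defs
begin

section \<open>Homogeneous polynomials and their derivatives\<close>

text \<open>The Hessian of g_P is obtained without second derivatives of \<open>det\<close> or of a
  chart. When Z_i is expanded in the basis of the rows of w, its component along w_i cancels from
  dg, because g has degree 0 in each row. This leaves dg as the sum over i /= j of M_P(w)_ij times a
  continuous weight. At a critical point the first factors vanish, so a further derivative hits only
  them, and the Hessian is dM_P paired with these weights. Hence parametrizations matter only
  through first derivatives. The lengths of the rows are a redundancy: unit rows suit W(n)_{>0},
  while P(w_i) = 1 gives a square system, to which Sard's theorem applies. A condition invariant
  under row scalings, \<open>frame_nondegenerate\<close>, translates between the two. The family
  Q_kl is adapted to a single frame. Regularity is therefore localised to small balls of frames,
  which are treated in turn, each perturbation being small enough to preserve what was gained on the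
  earlier balls.\<close>

lemma finite_exponents: "finite {\<alpha> :: 'n::finite \<Rightarrow> nat. (\<Sum>i\<in>UNIV. \<alpha> i) = d}"
proof (rule finite_subset)
  show "{\<alpha> :: 'n \<Rightarrow> nat. (\<Sum>i\<in>UNIV. \<alpha> i) = d} \<subseteq> (UNIV :: 'n set) \<rightarrow>\<^sub>E {..d}"
    by (auto intro!: member_le_sum)
  show "finite ((UNIV :: 'n set) \<rightarrow>\<^sub>E {..d})"
    by (intro finite_PiE) auto
qed

text \<open>Coefficients of the partial derivative in the variable \<open>k\<close>: the monomial
  with exponents \<beta> arises from the one with \<open>\<beta> k\<close> raised by one.
  Derivatives of forms are thus again evaluated by \<open>hom_eval\<close>, one degree
  lower.\<close>

definition dcoef :: "'n \<Rightarrow> (('n \<Rightarrow> nat) \<Rightarrow> real) \<Rightarrow> ('n \<Rightarrow> nat) \<Rightarrow> real" where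
  "dcoef k P \<beta> = real (Suc (\<beta> k)) * P (\<beta>(k := Suc (\<beta> k)))"

lemma sum_fun_upd_Suc:
  "(\<Sum>i\<in>UNIV. (\<beta>(k := Suc (\<beta> k))) i) = Suc (\<Sum>i\<in>UNIV. \<beta> (i :: 'n::finite))"
proof -
  have "(\<Sum>i\<in>UNIV. (\<beta>(k := Suc (\<beta> k))) i) = (\<Sum>i\<in>UNIV. \<beta> i + (if i = k then 1 else 0))"
    by (intro sum.cong) auto
  then show ?thesis by (simp add: sum.distrib)
qed

text \<open>Shared by differentiation and by multiplication with \<open>x $ k\<close>: in both,
  exponents without \<open>x $ k\<close> contribute nothing, and each of the others is one step
  above a unique exponent of degree \<open>d\<close>.\<close>

lemma sum_reindex_exponents:
  fixes F :: "('n::finite \<Rightarrow> nat) \<Rightarrow> real"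
  assumes "\<And>\<alpha>. \<alpha> k = 0 \<Longrightarrow> F \<alpha> = 0"
  shows "(\<Sum>\<alpha> | (\<Sum>i\<in>UNIV. \<alpha> i) = Suc d. F \<alpha>) =
         (\<Sum>\<beta> | (\<Sum>i\<in>UNIV. \<beta> i) = d. F (\<beta>(k := Suc (\<beta> k))))"
proof -
  have "(\<Sum>\<alpha> | (\<Sum>i\<in>UNIV. \<alpha> i) = Suc d. F \<alpha>) =
        (\<Sum>\<alpha> | (\<Sum>i\<in>UNIV. \<alpha> i) = Suc d \<and> \<alpha> k \<noteq> 0. F \<alpha>)"
    by (rule sum.mono_neutral_right) (auto simp: finite_exponents assms)
  also have "\<dots> = (\<Sum>\<beta> | (\<Sum>i\<in>UNIV. \<beta> i) = d. F (\<beta>(k := Suc (\<beta> k))))"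
  proof (rule sum.reindex_bij_witness[where i = "\<lambda>\<beta>. \<beta>(k := Suc (\<beta> k))" and j = "\<lambda>\<alpha>. \<alpha>(k := \<alpha> k - 1)"])
    fix a :: "'n \<Rightarrow> nat" assume a: "a \<in> {\<alpha>. (\<Sum>i\<in>UNIV. \<alpha> i) = Suc d \<and> \<alpha> k \<noteq> 0}"
    show eq: "(a(k := a k - 1))(k := Suc ((a(k := a k - 1)) k)) = a"
      using a by auto
    show "a(k := a k - 1) \<in> {\<beta>. (\<Sum>i\<in>UNIV. \<beta> i) = d}"
      using sum_fun_upd_Suc[of "a(k := a k - 1)" k] a unfolding eq by simp
    show "F ((a(k := a k - 1))(k := Suc ((a(k := a k - 1)) k))) = F a"
      by (simp only: eq)
  next
    fix b :: "'n \<Rightarrow> nat" assume b: "b \<in> {\<beta>. (\<Sum>i\<in>UNIV. \<beta> i) = d}"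
    show "(b(k := Suc (b k)))(k := (b(k := Suc (b k))) k - 1) = b" by simp
    show "b(k := Suc (b k)) \<in> {\<alpha>. (\<Sum>i\<in>UNIV. \<alpha> i) = Suc d \<and> \<alpha> k \<noteq> 0}"
      using b sum_fun_upd_Suc[of b k] by auto
  qed
  finally show ?thesis .
qed

lemma hom_eval_has_derivative:
  fixes x :: "real^'n::finite"
  shows "(hom_eval (Suc d) P has_derivative (\<lambda>h. \<Sum>k\<in>UNIV. hom_eval d (dcoef k P) x * h $ k)) (at x)"
proof -
  let ?A = "{\<alpha> :: 'n \<Rightarrow> nat. (\<Sum>i\<in>UNIV. \<alpha> i) = Suc d}"
  have "((\<lambda>x. \<Sum>\<alpha>\<in>?A. P \<alpha> * (\<Prod>i\<in>UNIV. (x $ i) ^ \<alpha> i)) has_derivative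
     (\<lambda>h. \<Sum>\<alpha>\<in>?A. P \<alpha> * (\<Sum>k\<in>UNIV. (of_nat (\<alpha> k) * h $ k * (x $ k) ^ (\<alpha> k - 1)) *
        (\<Prod>j\<in>UNIV - {k}. (x $ j) ^ \<alpha> j)))) (at x)"
    by (intro has_derivative_sum has_derivative_mult_right has_derivative_prod has_derivative_power
         bounded_linear.has_derivative[OF bounded_linear_vec_nth] has_derivative_ident)
  moreover have "(\<Sum>\<alpha>\<in>?A. P \<alpha> * (\<Sum>k\<in>UNIV. (of_nat (\<alpha> k) * h $ k * (x $ k) ^ (\<alpha> k - 1)) *
        (\<Prod>j\<in>UNIV - {k}. (x $ j) ^ \<alpha> j)))
      = (\<Sum>k\<in>UNIV. hom_eval d (dcoef k P) x * h $ k)" for h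
  proof -
    have "(\<Sum>\<alpha>\<in>?A. P \<alpha> * (\<Sum>k\<in>UNIV. (of_nat (\<alpha> k) * h $ k * (x $ k) ^ (\<alpha> k - 1)) *
        (\<Prod>j\<in>UNIV - {k}. (x $ j) ^ \<alpha> j)))
      = (\<Sum>k\<in>UNIV. \<Sum>\<alpha>\<in>?A. P \<alpha> * ((of_nat (\<alpha> k) * h $ k * (x $ k) ^ (\<alpha> k - 1)) *
        (\<Prod>j\<in>UNIV - {k}. (x $ j) ^ \<alpha> j)))"
      unfolding sum_distrib_left by (rule sum.swap)
    also have "\<dots> = (\<Sum>k\<in>UNIV. hom_eval d (dcoef k P) x * h $ k)"
    proof (rule sum.cong[OF refl])
      fix k :: 'n
      have "(\<Prod>j\<in>UNIV. (x $ j) ^ \<beta> j) = (x $ k) ^ \<beta> k * (\<Prod>j\<in>UNIV - {k}. (x $ j) ^ \<beta> j)" for \<beta>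
        by (rule prod.remove) auto
      then have *: "(x $ k) ^ \<beta> k * (\<Prod>j\<in>UNIV - {k}. (x $ j) ^ (\<beta>(k := Suc (\<beta> k))) j)
          = (\<Prod>j\<in>UNIV. (x $ j) ^ \<beta> j)" for \<beta>
        by simp
      show "(\<Sum>\<alpha>\<in>?A. P \<alpha> * ((of_nat (\<alpha> k) * h $ k * (x $ k) ^ (\<alpha> k - 1)) *
        (\<Prod>j\<in>UNIV - {k}. (x $ j) ^ \<alpha> j))) = hom_eval d (dcoef k P) x * h $ k"
        unfolding hom_eval_def sum_distrib_right dcoef_def
        by (subst sum_reindex_exponents[where k = k]) (auto simp: *[symmetric] intro!: sum.cong)
    qed
    finally show ?thesis .
  qed
  ultimately show ?thesis
    unfolding hom_eval_def[abs_def] by (simp only:)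
qed

lemma hom_eval_scaleR: "hom_eval d P (c *\<^sub>R x) = c ^ d * hom_eval d P x"
proof -
  have "(\<Prod>i\<in>UNIV. ((c *\<^sub>R x) $ i) ^ \<alpha> i) = c ^ (\<Sum>i\<in>UNIV. \<alpha> i) * (\<Prod>i\<in>UNIV. (x $ i) ^ \<alpha> i)" for \<alpha>
    by (simp add: power_mult_distrib prod.distrib power_sum)
  then show ?thesis
    unfolding hom_eval_def sum_distrib_left by (intro sum.cong) auto
qed

text \<open>The function t -> P(t x) is differentiated at t = 1 in two ways, by the chain rule and
  through homogeneity.\<close>

lemma hom_eval_euler: "(\<Sum>k\<in>UNIV. hom_eval d (dcoef k P) x * x $ k) = real (Suc d) * hom_eval (Suc d) P x"
proof -
  have "((\<lambda>t. hom_eval (Suc d) P (t *\<^sub>R x)) has_derivative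
      (\<lambda>h. \<Sum>k\<in>UNIV. hom_eval d (dcoef k P) (1 *\<^sub>R x) * (h *\<^sub>R x) $ k)) (at (1::real))"
    by (rule has_derivative_compose[OF has_derivative_scaleR_left[OF has_derivative_ident] hom_eval_has_derivative])
  then have "((\<lambda>t. hom_eval (Suc d) P (t *\<^sub>R x)) has_real_derivative
      (\<Sum>k\<in>UNIV. hom_eval d (dcoef k P) x * x $ k)) (at 1)"
    by (rule has_derivative_imp_has_field_derivative) (simp add: sum_distrib_left mult_ac)
  moreover have "((\<lambda>t. hom_eval (Suc d) P (t *\<^sub>R x)) has_real_derivative real (Suc d) * hom_eval (Suc d) P x) (at 1)"
    unfolding hom_eval_scaleR by (auto intro!: derivative_eq_intros)
  ultimately show ?thesis by (rule DERIV_unique)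
qed

lemma abs_hom_eval_le:
  "\<bar>hom_eval d P x\<bar> \<le> (\<Sum>\<alpha> | (\<Sum>i\<in>UNIV. \<alpha> i) = d. \<bar>P \<alpha>\<bar>) * norm x ^ d"
proof -
  have "\<bar>\<Prod>i\<in>UNIV. (x $ i) ^ \<alpha> i\<bar> \<le> norm x ^ (\<Sum>i\<in>UNIV. \<alpha> i)" for \<alpha>
    unfolding abs_prod power_sum power_abs
    by (intro prod_mono conjI power_mono component_le_norm_cart) auto
  then show ?thesis
    unfolding hom_eval_def sum_distrib_right
    by (intro order_trans[OF sum_abs] sum_mono) (auto simp: abs_mult intro!: mult_left_mono)
qed

lemma continuous_on_hom_eval [continuous_intros]:
  fixes f :: "'a::topological_space \<Rightarrow> ('n::finite \<Rightarrow> nat) \<Rightarrow> real"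
  assumes "continuous_on S f" "continuous_on S g"
  shows "continuous_on S (\<lambda>y. hom_eval d (f y) (g y))"
  unfolding hom_eval_def
  by (intro continuous_intros assms continuous_on_product_then_coordinatewise[OF assms(1)])

lemma continuous_on_dcoef [continuous_intros]:
  fixes f :: "'a::topological_space \<Rightarrow> ('n::finite \<Rightarrow> nat) \<Rightarrow> real"
  assumes "continuous_on S f"
  shows "continuous_on S (\<lambda>y. dcoef k (f y))"
  unfolding dcoef_def
  by (intro continuous_on_coordinatewise_then_product continuous_intros
      continuous_on_product_then_coordinatewise[OF assms])

lemma hom_eval_add: "hom_eval d (\<lambda>\<alpha>. P \<alpha> + Q \<alpha>) x = hom_eval d P x + hom_eval d Q x"
  by (simp add: hom_eval_def sum.distrib algebra_simps)

lemma hom_eval_cmult: "hom_eval d (\<lambda>\<alpha>. c * P \<alpha>) x = c * hom_eval d P x"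
  by (simp add: hom_eval_def sum_distrib_left algebra_simps)

lemma dcoef_add: "dcoef k (\<lambda>\<alpha>. P \<alpha> + Q \<alpha>) = (\<lambda>\<alpha>. dcoef k P \<alpha> + dcoef k Q \<alpha>)"
  by (simp add: dcoef_def fun_eq_iff algebra_simps)

lemma dcoef_cmult: "dcoef k (\<lambda>\<alpha>. c * P \<alpha>) = (\<lambda>\<alpha>. c * dcoef k P \<alpha>)"
  by (simp add: dcoef_def fun_eq_iff algebra_simps)

subsection \<open>Polynomial functions\<close>

text \<open>Lets forms be assembled as functions, from sums and products with linear forms; a
  coefficient family is extracted only at the end.\<close>

definition hom_poly_fun :: "nat \<Rightarrow> (real^'n::finite \<Rightarrow> real) \<Rightarrow> bool" where
  "hom_poly_fun d f \<longleftrightarrow> (\<exists>P\<in>hom_polys d. \<forall>x. f x = hom_eval d P x)"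

lemma hom_poly_fun_add: "hom_poly_fun d f \<Longrightarrow> hom_poly_fun d g \<Longrightarrow> hom_poly_fun d (\<lambda>x. f x + g x)"
  unfolding hom_poly_fun_def
proof clarify
  fix P Q assume "P \<in> hom_polys d" "\<forall>x. f x = hom_eval d P x" "Q \<in> hom_polys d" "\<forall>x. g x = hom_eval d Q x"
  then show "\<exists>P\<in>hom_polys d. \<forall>x. f x + g x = hom_eval d P x"
    by (intro bexI[of _ "\<lambda>\<alpha>. P \<alpha> + Q \<alpha>"]) (auto simp: hom_eval_add hom_polys_def)
qed

lemma hom_poly_fun_cmult: "hom_poly_fun d f \<Longrightarrow> hom_poly_fun d (\<lambda>x. c * f x)"
  unfolding hom_poly_fun_def
proof clarify
  fix P assume "P \<in> hom_polys d" "\<forall>x. f x = hom_eval d P x"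
  then show "\<exists>P\<in>hom_polys d. \<forall>x. c * f x = hom_eval d P x"
    by (intro bexI[of _ "\<lambda>\<alpha>. c * P \<alpha>"]) (auto simp: hom_eval_cmult hom_polys_def)
qed

lemma hom_poly_fun_sum:
  assumes "finite K" "\<And>k. k \<in> K \<Longrightarrow> hom_poly_fun d (f k)"
  shows "hom_poly_fun d (\<lambda>x. \<Sum>k\<in>K. f k x)"
  using assms
proof (induction K rule: finite_induct)
  case empty
  show ?case
    unfolding hom_poly_fun_def
    by (intro bexI[of _ "\<lambda>_. 0"]) (auto simp: hom_eval_def hom_polys_def)
qed (auto intro: hom_poly_fun_add)

lemma hom_poly_fun_one: "hom_poly_fun 0 (\<lambda>x. 1)"
proof -
  have "{\<alpha> :: 'a \<Rightarrow> nat. (\<Sum>i\<in>UNIV. \<alpha> i) = 0} = {\<lambda>_. 0}" by auto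
  then show ?thesis
    unfolding hom_poly_fun_def
    by (intro bexI[of _ "\<lambda>\<alpha>. if \<alpha> = (\<lambda>_. 0) then 1 else 0"]) (auto simp: hom_eval_def hom_polys_def)
qed

lemma hom_poly_fun_times_coordinate:
  fixes f :: "real^'n::finite \<Rightarrow> real"
  assumes "hom_poly_fun d f"
  shows "hom_poly_fun (Suc d) (\<lambda>x. x $ k * f x)"
proof -
  obtain P where P: "P \<in> hom_polys d" "\<And>x. f x = hom_eval d P x"
    using assms unfolding hom_poly_fun_def by auto
  \<comment> \<open>Multiplication by \<open>x $ k\<close> shifts exponents. The case
    \<open>\<alpha> k = 0\<close> is separate because truncated subtraction would return \<alpha>
    itself there.\<close>
  define Q where "Q \<alpha> = (if \<alpha> k = 0 then 0 else P (\<alpha>(k := \<alpha> k - 1)))" for \<alpha> :: "'n \<Rightarrow> nat"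
  have "Q \<in> hom_polys (Suc d)"
    unfolding hom_polys_def
  proof clarify
    fix \<alpha> :: "'n \<Rightarrow> nat" assume d: "(\<Sum>i\<in>UNIV. \<alpha> i) \<noteq> Suc d"
    show "Q \<alpha> = 0"
    proof (cases "\<alpha> k = 0")
      case False
      then have "(\<Sum>i\<in>UNIV. (\<alpha>(k := \<alpha> k - 1)) i) \<noteq> d"
        using sum_fun_upd_Suc[of "\<alpha>(k := \<alpha> k - 1)" k] d by auto
      then show ?thesis using P(1) by (simp add: Q_def hom_polys_def)
    qed (simp add: Q_def)
  qed
  moreover have "x $ k * f x = hom_eval (Suc d) Q x" for x
  proof -
    have R: "(\<Prod>j\<in>UNIV. (x $ j) ^ \<beta> j) = (x $ k) ^ \<beta> k * (\<Prod>j\<in>UNIV - {k}. (x $ j) ^ \<beta> j)" for \<beta>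
      by (rule prod.remove) auto
    have *: "(\<Prod>j\<in>UNIV. (x $ j) ^ (\<beta>(k := Suc (\<beta> k))) j) = x $ k * (\<Prod>j\<in>UNIV. (x $ j) ^ \<beta> j)" for \<beta>
      unfolding R by simp
    show ?thesis
      unfolding P hom_eval_def sum_distrib_left
      by (subst sum_reindex_exponents[where k = k]) (simp_all only: *, auto simp: Q_def intro!: sum.cong)
  qed
  ultimately show ?thesis unfolding hom_poly_fun_def by auto
qed

lemma hom_poly_fun_times_linear:
  assumes "hom_poly_fun d f"
  shows "hom_poly_fun (Suc d) (\<lambda>x. (a \<bullet> x) * f x)"
proof -
  have "hom_poly_fun (Suc d) (\<lambda>x. \<Sum>k\<in>UNIV. a $ k * (x $ k * f x))"
    by (intro hom_poly_fun_sum hom_poly_fun_cmult hom_poly_fun_times_coordinate assms) auto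
  then show ?thesis by (simp add: inner_vec_def sum_distrib_right mult.assoc)
qed

lemma hom_poly_fun_linear_power:
  "hom_poly_fun d f \<Longrightarrow> hom_poly_fun (e + d) (\<lambda>x. (a \<bullet> x) ^ e * f x)"
  by (induction e) (auto simp: mult.assoc intro: hom_poly_fun_times_linear)

lemma hom_poly_fun_norm_power: "hom_poly_fun (2 * m) (\<lambda>x :: real^'n::finite. norm x ^ (2 * m))"
proof (induction m)
  case (Suc m)
  have "hom_poly_fun (Suc (Suc (2 * m))) (\<lambda>x :: real^'n. \<Sum>k\<in>UNIV. x $ k * (x $ k * norm x ^ (2 * m)))"
    by (intro hom_poly_fun_sum hom_poly_fun_times_coordinate Suc) auto
  moreover have "(\<Sum>k\<in>UNIV. x $ k * (x $ k * norm x ^ (2 * m))) = norm x ^ (2 * Suc m)" for x :: "real^'n"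
  proof -
    have "(\<Sum>k\<in>UNIV. x $ k * x $ k) = norm x ^ 2"
      by (simp add: power2_norm_eq_inner inner_vec_def)
    then show ?thesis
      by (simp add: mult.assoc[symmetric] sum_distrib_right[symmetric] power2_eq_square)
  qed
  ultimately show ?case by simp
qed (simp add: hom_poly_fun_one)

section \<open>Polar matrices\<close>

definition pd :: "nat \<Rightarrow> (('n::finite \<Rightarrow> nat) \<Rightarrow> real) \<Rightarrow> 'n \<Rightarrow> real^'n \<Rightarrow> real" where
  "pd m P k x = hom_eval (2 * m - 1) (dcoef k P) x"

definition pdd :: "nat \<Rightarrow> (('n::finite \<Rightarrow> nat) \<Rightarrow> real) \<Rightarrow> 'n \<Rightarrow> 'n \<Rightarrow> real^'n \<Rightarrow> real" where
  "pdd m P k l x = hom_eval (2 * m - 2) (dcoef l (dcoef k P)) x"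

lemma hom_eval_derivative_pd:
  "m > 0 \<Longrightarrow> (hom_eval (2 * m) P has_derivative (\<lambda>h. \<Sum>k\<in>UNIV. pd m P k x * h $ k)) (at x)"
  using hom_eval_has_derivative[of "2 * m - 1" P x] by (simp add: pd_def[abs_def])

lemma pd_has_derivative:
  assumes "m > 0"
  shows "(pd m P k has_derivative (\<lambda>h. \<Sum>l\<in>UNIV. pdd m P k l x * h $ l)) (at x)"
proof -
  have "Suc (2 * m - 2) = 2 * m - 1" using assms by simp
  then show ?thesis
    using hom_eval_has_derivative[of "2 * m - 2" "dcoef k P" x] by (simp add: pdd_def[abs_def] pd_def[abs_def])
qed

lemma pd_scaleR: "pd m P k (c *\<^sub>R x) = c ^ (2 * m - 1) * pd m P k x"
  by (simp add: pd_def hom_eval_scaleR)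

lemma pdd_scaleR: "pdd m P k l (c *\<^sub>R x) = c ^ (2 * m - 2) * pdd m P k l x"
  by (simp add: pdd_def hom_eval_scaleR)

lemma pd_euler: "m > 0 \<Longrightarrow> (\<Sum>k\<in>UNIV. pd m P k x * x $ k) = 2 * real m * hom_eval (2 * m) P x"
  using hom_eval_euler[of "2 * m - 1" P x] by (simp add: pd_def)

lemma pdd_euler:
  assumes "m > 0"
  shows "(\<Sum>l\<in>UNIV. pdd m P k l x * x $ l) = (2 * real m - 1) * pd m P k x"
proof -
  have "Suc (2 * m - 2) = 2 * m - 1" using assms by simp
  then show ?thesis
    using hom_eval_euler[of "2 * m - 2" "dcoef k P" x] assms by (simp add: pdd_def pd_def of_nat_diff)
qed

text \<open>The matrix M_P(w) of the overview.\<close>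

definition polar :: "nat \<Rightarrow> (('n::finite \<Rightarrow> nat) \<Rightarrow> real) \<Rightarrow> real^'n^'n \<Rightarrow> 'n \<Rightarrow> 'n \<Rightarrow> real" where
  "polar m P w i j = (\<Sum>k\<in>UNIV. pd m P k (w $ i) * w $ j $ k)"

text \<open>The differential of \<open>polar\<close> at \<open>w\<close> in direction
  \<open>Z\<close>: the second-order term comes from moving the base point \<open>w $ i\<close>, the
  gradient term from moving the vector \<open>w $ j\<close>.\<close>

definition dpolar :: "nat \<Rightarrow> (('n::finite \<Rightarrow> nat) \<Rightarrow> real) \<Rightarrow> real^'n^'n \<Rightarrow> real^'n^'n \<Rightarrow> 'n \<Rightarrow> 'n \<Rightarrow> real" where
  "dpolar m P w Z i j =
     (\<Sum>k\<in>UNIV. (\<Sum>l\<in>UNIV. pdd m P k l (w $ i) * Z $ i $ l) * w $ j $ k + pd m P k (w $ i) * Z $ j $ k)"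

lemma polar_diagonal: "m > 0 \<Longrightarrow> polar m P w i i = 2 * real m * hom_eval (2 * m) P (w $ i)"
  by (simp add: polar_def pd_euler)

lemma bounded_linear_nth_nth: "bounded_linear (\<lambda>w :: real^'n^'m. w $ i $ k)"
  by (intro bounded_linear_compose[OF bounded_linear_vec_nth bounded_linear_vec_nth])

lemma polar_has_derivative:
  assumes "m > 0"
  shows "((\<lambda>w. polar m P w i j) has_derivative (\<lambda>Z. dpolar m P w Z i j)) (at w)"
proof -
  have 1: "((\<lambda>w. pd m P k (w $ i)) has_derivative (\<lambda>Z. \<Sum>l\<in>UNIV. pdd m P k l (w $ i) * Z $ i $ l)) (at w)" for k
    by (rule has_derivative_compose[OF bounded_linear.has_derivative[OF bounded_linear_vec_nth has_derivative_ident]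
        pd_has_derivative[OF assms]])
  have 2: "((\<lambda>w. w $ j $ k) has_derivative (\<lambda>Z. Z $ j $ k)) (at w)" for k
    by (rule bounded_linear_imp_has_derivative[OF bounded_linear_nth_nth])
  show ?thesis
    unfolding polar_def dpolar_def
    by (rule has_derivative_eq_rhs[OF has_derivative_sum[OF has_derivative_mult[OF 1 2]]])
      (simp add: add.commute)
qed

lemma dpolar_diff: "dpolar m P w (Y - Z) i j = dpolar m P w Y i j - dpolar m P w Z i j"
  by (simp add: dpolar_def algebra_simps sum.distrib sum_subtractf)

lemma dpolar_scaleR: "dpolar m P w (c *\<^sub>R Z) i j = c * dpolar m P w Z i j"
  by (simp add: dpolar_def sum_distrib_left algebra_simps)

section \<open>Row scalings and nondegenerate frames\<close>

abbreviation scale_rows :: "('n \<Rightarrow> real) \<Rightarrow> real^'k^'n \<Rightarrow> real^'k^'n" where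
  "scale_rows c w \<equiv> (\<chi> i. c i *\<^sub>R w $ i)"

lemma polar_scale_rows: "polar m P (scale_rows c w) i j = c i ^ (2 * m - 1) * c j * polar m P w i j"
  by (simp add: polar_def pd_scaleR sum_distrib_left mult_ac)

lemma dpolar_scale_rows:
  assumes "m > 0"
  shows "dpolar m P (scale_rows c w) (scale_rows c Z) i j = c i ^ (2 * m - 1) * c j * dpolar m P w Z i j"
proof -
  have "2 * m - 1 = Suc (2 * m - 2)" using assms by simp
  then have p: "c i ^ (2 * m - 1) = c i ^ (2 * m - 2) * c i" by simp
  show ?thesis
    unfolding dpolar_def
    by (simp only: vec_lambda_beta pd_scaleR pdd_scaleR p inner_simps vector_scaleR_component)
      (simp add: sum_distrib_left sum_distrib_right algebra_simps sum.distrib)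
qed

text \<open>Infinitesimal form of the row scaling rule, with weight 2m - 1 for the base point by
  Euler's identity. Where the off-diagonal entries vanish, row scalings therefore lie in the kernel
  of all off-diagonal derivatives.\<close>

lemma dpolar_scaling_direction:
  assumes "m > 0"
  shows "dpolar m P w (scale_rows \<nu> w) i j = ((2 * real m - 1) * \<nu> i + \<nu> j) * polar m P w i j"
proof -
  have "dpolar m P w (scale_rows \<nu> w) i j =
      (\<Sum>k\<in>UNIV. \<nu> i * (\<Sum>l\<in>UNIV. pdd m P k l (w $ i) * w $ i $ l) * w $ j $ k
         + \<nu> j * (pd m P k (w $ i) * w $ j $ k))"
    unfolding dpolar_def by (simp add: sum_distrib_left sum_distrib_right mult_ac)
  also have "\<dots> = ((2 * real m - 1) * \<nu> i + \<nu> j) * polar m P w i j"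
    unfolding pdd_euler[OF assms] polar_def
    by (simp add: sum_distrib_left sum.distrib algebra_simps)
  finally show ?thesis .
qed

lemma continuous_on_polar [continuous_intros]:
  fixes f :: "'a::topological_space \<Rightarrow> ('n::finite \<Rightarrow> nat) \<Rightarrow> real"
  assumes "continuous_on S f" "continuous_on S g"
  shows "continuous_on S (\<lambda>y. polar m (f y) (g y) i j)"
  unfolding polar_def pd_def by (intro continuous_intros assms)

lemma continuous_on_dpolar [continuous_intros]:
  fixes f :: "'a::topological_space \<Rightarrow> ('n::finite \<Rightarrow> nat) \<Rightarrow> real"
  assumes "continuous_on S f" "continuous_on S g" "continuous_on S h"
  shows "continuous_on S (\<lambda>y. dpolar m (f y) (g y) (h y) i j)"
  unfolding dpolar_def pd_def pdd_def by (intro continuous_intros assms)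

lemma polar_add: "polar m (\<lambda>\<alpha>. P \<alpha> + Q \<alpha>) w i j = polar m P w i j + polar m Q w i j"
  by (simp add: polar_def pd_def dcoef_add hom_eval_add sum.distrib algebra_simps)

lemma polar_cmult: "polar m (\<lambda>\<alpha>. c * P \<alpha>) w i j = c * polar m P w i j"
  by (simp add: polar_def pd_def dcoef_cmult hom_eval_cmult sum_distrib_left algebra_simps)

lemma polar_sum: "finite K \<Longrightarrow> polar m (\<lambda>\<alpha>. \<Sum>k\<in>K. P k \<alpha>) w i j = (\<Sum>k\<in>K. polar m (P k) w i j)"
  by (induction K rule: finite_induct) (simp_all add: polar_add, simp add: polar_def pd_def dcoef_def hom_eval_def)

text \<open>At a critical frame the row scalings always belong to this kernel, so nondegeneracy asks
  that it contain nothing else. Formulated with all \<open>Z\<close> instead of tangent ones, the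
  condition makes sense for rows of any length.\<close>

definition frame_nondegenerate :: "nat \<Rightarrow> (('n::finite \<Rightarrow> nat) \<Rightarrow> real) \<Rightarrow> real^'n^'n \<Rightarrow> bool" where
  "frame_nondegenerate m P w \<longleftrightarrow>
     (\<forall>Z. (\<forall>i j. i \<noteq> j \<longrightarrow> dpolar m P w Z i j = 0) \<longrightarrow> (\<exists>\<nu>. Z = scale_rows \<nu> w))"

lemma frame_nondegenerateD:
  assumes "frame_nondegenerate m P w" "\<And>i j. i \<noteq> j \<Longrightarrow> dpolar m P w Z i j = 0"
  shows "\<exists>\<nu>. Z = scale_rows \<nu> w"
  using assms(1) unfolding frame_nondegenerate_def by (rule allE[of _ Z]) (erule mp, use assms(2) in \<open>intro allI impI\<close>)

lemma frame_nondegenerate_scale_rows_imp: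
  assumes m: "m > 0" and c: "\<And>i. c i \<noteq> 0" and nd: "frame_nondegenerate m P (scale_rows c w)"
  shows "frame_nondegenerate m P w"
  unfolding frame_nondegenerate_def
proof (intro allI impI)
  fix Z assume "\<forall>i j. i \<noteq> j \<longrightarrow> dpolar m P w Z i j = 0"
  then have "\<forall>i j. i \<noteq> j \<longrightarrow> dpolar m P (scale_rows c w) (scale_rows c Z) i j = 0"
    by (simp add: dpolar_scale_rows[OF m])
  then have "\<exists>\<nu>. scale_rows c Z = scale_rows \<nu> (scale_rows c w)"
    by (intro frame_nondegenerateD[OF nd]) simp
  then obtain \<nu> where "scale_rows c Z = scale_rows \<nu> (scale_rows c w)"
    by (elim exE)
  then have eq: "scale_rows c Z $ i = scale_rows \<nu> (scale_rows c w) $ i" for i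
    by (simp only:)
  have "c i *\<^sub>R (Z $ i) = c i *\<^sub>R (\<nu> i *\<^sub>R w $ i)" for i
    using eq[of i] by (simp only: vec_lambda_beta scaleR_scaleR mult.commute)
  then have "Z $ i = \<nu> i *\<^sub>R w $ i" for i
    by (rule scaleR_left_imp_eq[OF c])
  then have "Z = scale_rows \<nu> w"
    by (simp add: vec_eq_iff)
  then show "\<exists>\<nu>. Z = scale_rows \<nu> w" by (intro exI[of _ \<nu>])
qed

lemma frame_nondegenerate_scale_rows:
  assumes "m > 0" "\<And>i. c i \<noteq> 0"
  shows "frame_nondegenerate m P (scale_rows c w) \<longleftrightarrow> frame_nondegenerate m P w"
proof
  assume nd: "frame_nondegenerate m P w"
  have "scale_rows (\<lambda>i. inverse (c i)) (scale_rows c w) = w"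
    using assms(2) by (simp add: vec_eq_iff)
  then show "frame_nondegenerate m P (scale_rows c w)"
    by (intro frame_nondegenerate_scale_rows_imp[where c = "\<lambda>i. inverse (c i)" and w = "scale_rows c w"] assms)
      (use assms(2) nd in \<open>simp_all only: nonzero_imp_inverse_nonzero not_False_eq_True\<close>)
qed (use assms frame_nondegenerate_scale_rows_imp in blast)

text \<open>Critical frames in the normalisation P(w_i) = 1: for \<open>m > 0\<close>, Euler's
  identity turns the diagonal equations into exactly this.\<close>

definition polar_frame :: "nat \<Rightarrow> (('n::finite \<Rightarrow> nat) \<Rightarrow> real) \<Rightarrow> real^'n^'n \<Rightarrow> bool" where
  "polar_frame m P w \<longleftrightarrow> (\<forall>i j. polar m P w i j = (if i = j then 2 * real m else 0))"

text \<open>The diagonal derivatives detect precisely the row scalings. Adding the n diagonal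
  equations removes these from the kernel, which leaves injectivity of a square linear
  system.\<close>

lemma frame_nondegenerate_iff_polar_frame:
  assumes m: "m > 0" and fr: "polar_frame m P w"
  shows "frame_nondegenerate m P w \<longleftrightarrow> (\<forall>Z. (\<forall>i j. dpolar m P w Z i j = 0) \<longrightarrow> Z = 0)"
proof safe
  fix Z assume nd: "frame_nondegenerate m P w" and Z: "\<forall>i j. dpolar m P w Z i j = 0"
  then have "\<exists>\<nu>. Z = scale_rows \<nu> w"
    by (intro frame_nondegenerateD[OF nd]) simp
  then obtain \<nu> where \<nu>: "Z = scale_rows \<nu> w" by (elim exE)
  have "2 * real m * \<nu> i * (2 * real m) = 0" for i
    using Z[rule_format, of i i] fr unfolding \<nu> dpolar_scaling_direction[OF m] polar_frame_def
    by (simp add: algebra_simps)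
  then show "Z = 0" using m by (simp add: \<nu> vec_eq_iff)
next
  assume inj: "\<forall>Z. (\<forall>i j. dpolar m P w Z i j = 0) \<longrightarrow> Z = 0"
  show "frame_nondegenerate m P w" unfolding frame_nondegenerate_def
  proof (intro allI impI)
    fix Z assume Z: "\<forall>i j. i \<noteq> j \<longrightarrow> dpolar m P w Z i j = 0"
    \<comment> \<open>The scaling direction \<open>\<nu>\<close> changes diagonal entry i at the
      rate ((2m - 1) + 1) \<open>\<nu> i\<close> times 2m, so this choice matches the diagonal
      derivatives of \<open>Z\<close>.\<close>
    define \<nu> where "\<nu> i = dpolar m P w Z i i / (2 * real m * (2 * real m))" for i
    have "dpolar m P w (Z - scale_rows \<nu> w) i j = 0" for i j
    proof (cases "i = j")
      case True
      have "((2 * real m - 1) * \<nu> i + \<nu> i) * (2 * real m) = dpolar m P w Z i i"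
        using m by (simp add: \<nu>_def field_simps)
      then show ?thesis
        using fr True unfolding dpolar_diff dpolar_scaling_direction[OF m] polar_frame_def by simp
    next
      case False
      then show ?thesis
        using Z fr unfolding dpolar_diff dpolar_scaling_direction[OF m] polar_frame_def by simp
    qed
    then have "Z - scale_rows \<nu> w = 0" using inj by blast
    then show "\<exists>\<nu>. Z = scale_rows \<nu> w" by auto
  qed
qed

text \<open>Here tangency removes the scalings: a row scaling tangent to the unit spheres is zero,
  and subtracting the radial part of \<open>Z\<close> does not affect its off-diagonal
  derivatives.\<close>

lemma frame_nondegenerate_iff_tangent:
  assumes m: "m > 0" and unit: "\<And>i. norm (v $ i) = 1" and off: "\<And>i j. i \<noteq> j \<Longrightarrow> polar m P v i j = 0"
  shows "frame_nondegenerate m P v \<longleftrightarrow>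
    (\<forall>Z. (\<forall>i. Z $ i \<bullet> v $ i = 0) \<and> (\<forall>i j. i \<noteq> j \<longrightarrow> dpolar m P v Z i j = 0) \<longrightarrow> Z = 0)"
proof safe
  have vv: "v $ i \<bullet> v $ i = 1" for i using unit[of i] by (simp add: norm_eq_1)
  {
    fix Z assume nd: "frame_nondegenerate m P v" and T: "\<forall>i. Z $ i \<bullet> v $ i = 0"
      and Z: "\<forall>i j. i \<noteq> j \<longrightarrow> dpolar m P v Z i j = 0"
    then have "\<exists>\<nu>. Z = scale_rows \<nu> v"
      by (intro frame_nondegenerateD[OF nd]) simp
    then obtain \<nu> where \<nu>: "Z = scale_rows \<nu> v" by (elim exE)
    have "\<nu> i = 0" for i
      using T[rule_format, of i] vv[of i] unfolding \<nu> by simp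
    then show "Z = 0" unfolding \<nu> by (simp add: vec_eq_iff)
  next
    assume inj: "\<forall>Z. (\<forall>i. Z $ i \<bullet> v $ i = 0) \<and> (\<forall>i j. i \<noteq> j \<longrightarrow> dpolar m P v Z i j = 0) \<longrightarrow> Z = 0"
    show "frame_nondegenerate m P v" unfolding frame_nondegenerate_def
    proof (intro allI impI)
      fix Z assume Z: "\<forall>i j. i \<noteq> j \<longrightarrow> dpolar m P v Z i j = 0"
      define \<nu> where "\<nu> i = Z $ i \<bullet> v $ i" for i
      have "i \<noteq> j \<longrightarrow> dpolar m P v (Z - scale_rows \<nu> v) i j = 0" for i j
        using Z off unfolding dpolar_diff dpolar_scaling_direction[OF m] by auto
      moreover have "(Z - scale_rows \<nu> v) $ i \<bullet> v $ i = 0" for i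
        by (simp add: inner_diff_left vv \<nu>_def)
      ultimately have "Z - scale_rows \<nu> v = 0" using inj by blast
      then show "\<exists>\<nu>. Z = scale_rows \<nu> v" by auto
    qed
  }
qed

text \<open>The sign of \<open>det\<close> is imposed separately because \<open>polar_frame\<close>
  admits both orientations: negating one row preserves it.\<close>

definition good_polynomial :: "nat \<Rightarrow> (('n::finite \<Rightarrow> nat) \<Rightarrow> real) \<Rightarrow> bool" where
  "good_polynomial m P \<longleftrightarrow>
     (\<forall>w. det w > 0 \<and> polar_frame m P w \<longrightarrow> (\<forall>Z. (\<forall>i j. dpolar m P w Z i j = 0) \<longrightarrow> Z = 0))"

lemma det_scale_rows: "det (scale_rows c w) = (\<Prod>i\<in>UNIV. c i) * det (w :: real^'n^'n::finite)"
  using det_rows_mul[of c "\<lambda>i. w $ i"] by (simp add: scalar_mult_eq_scaleR)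

text \<open>Unit frames and polar frames correspond by positive row factors, and these preserve the
  sign of \<open>det\<close> as well as nondegeneracy.\<close>

lemma good_polynomial_iff:
  fixes P :: "('n::finite \<Rightarrow> nat) \<Rightarrow> real"
  assumes m: "m > 0" and pos: "\<And>x. x \<noteq> 0 \<Longrightarrow> hom_eval (2 * m) P x > 0"
  shows "good_polynomial m P \<longleftrightarrow>
    (\<forall>v\<in>W_pos. (\<forall>i j. i \<noteq> j \<longrightarrow> polar m P v i j = 0) \<longrightarrow> frame_nondegenerate m P v)"
proof
  assume good: "good_polynomial m P"
  show "\<forall>v\<in>W_pos. (\<forall>i j. i \<noteq> j \<longrightarrow> polar m P v i j = 0) \<longrightarrow> frame_nondegenerate m P v"
  proof (intro ballI impI)
    fix v :: "real^'n^'n" assume v: "v \<in> W_pos" and off: "\<forall>i j. i \<noteq> j \<longrightarrow> polar m P v i j = 0"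
    have "v $ i \<noteq> 0" for i using v by (auto simp: W_pos_def dest!: spec[of _ i])
    then have p: "hom_eval (2 * m) P (v $ i) > 0" for i by (simp add: pos)
    \<comment> \<open>By homogeneity of degree 2m, this factor brings row i to the level set P =
      1.\<close>
    define c where "c i = hom_eval (2 * m) P (v $ i) powr (- (1 / (2 * real m)))" for i
    have c: "c i > 0" for i using p[of i] by (simp add: c_def)
    have cp: "c i ^ (2 * m) * hom_eval (2 * m) P (v $ i) = 1" for i
    proof -
      have "c i ^ (2 * m) = hom_eval (2 * m) P (v $ i) powr (- 1)"
        using p[of i] m c[of i] by (simp add: c_def powr_powr flip: powr_realpow)
      then show ?thesis using p[of i] by (simp add: powr_minus)
    qed
    have "polar_frame m P (scale_rows c v)"
      unfolding polar_frame_def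
    proof (intro allI)
      fix i j
      have "2 * m = Suc (2 * m - 1)" using m by simp
      then have "c i ^ (2 * m - 1) * c i = c i ^ (2 * m)" by (metis power_Suc2)
      then have "c i ^ (2 * m - 1) * c i * polar m P v i i = 2 * real m"
        using cp[of i] polar_diagonal[OF m, of P v i] by (simp add: algebra_simps)
      then show "polar m P (scale_rows c v) i j = (if i = j then 2 * real m else 0)"
        using off unfolding polar_scale_rows by auto
    qed
    moreover have "det (scale_rows c v) > 0"
      unfolding det_scale_rows using v c by (intro mult_pos_pos prod_pos) (auto simp: W_pos_def)
    ultimately have "frame_nondegenerate m P (scale_rows c v)"
      using good frame_nondegenerate_iff_polar_frame[OF m] unfolding good_polynomial_def by blast
    then show "frame_nondegenerate m P v"
      using frame_nondegenerate_scale_rows[OF m, of c] c by (metis less_irrefl)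
  qed
next
  assume A: "\<forall>v\<in>W_pos. (\<forall>i j. i \<noteq> j \<longrightarrow> polar m P v i j = 0) \<longrightarrow> frame_nondegenerate m P v"
  show "good_polynomial m P"
    unfolding good_polynomial_def
  proof (intro allI impI; elim conjE)
    fix w Z :: "real^'n^'n" assume det: "det w > 0" and fr: "polar_frame m P w" and Z: "\<forall>i j. dpolar m P w Z i j = 0"
    have nz: "w $ i \<noteq> 0" for i
      using det det_zero_row(1)[of i w] by (auto simp: row_def vec_eq_iff)
    define c where "c i = inverse (norm (w $ i))" for i
    have c: "c i > 0" for i using nz by (simp add: c_def)
    have "scale_rows c w \<in> W_pos"
      unfolding W_pos_def mem_Collect_eq det_scale_rows
      using det c nz by (auto simp: c_def intro!: mult_pos_pos prod_pos)
    moreover have "\<forall>i j. i \<noteq> j \<longrightarrow> polar m P (scale_rows c w) i j = 0"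
      using fr unfolding polar_scale_rows polar_frame_def by auto
    ultimately have "frame_nondegenerate m P (scale_rows c w)" using A by blast
    then have "frame_nondegenerate m P w"
      using frame_nondegenerate_scale_rows[OF m, of c] c by (metis less_irrefl)
    then show "Z = 0"
      using frame_nondegenerate_iff_polar_frame[OF m fr] Z by blast
  qed
qed

section \<open>The differential and the Hessian of the function\<close>

lemma det_has_derivative:
  fixes w :: "real^'n^'n::finite"
  shows "(det has_derivative (\<lambda>Z. \<Sum>i\<in>UNIV. det (\<chi> k. if k = i then Z $ i else w $ k))) (at w)"
proof -
  let ?S = "{p. p permutes (UNIV :: 'n set)}"
  have "((\<lambda>w :: real^'n^'n. \<Sum>p\<in>?S. of_int (sign p) * (\<Prod>i\<in>UNIV. w $ i $ p i)) has_derivative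
     (\<lambda>Z. \<Sum>p\<in>?S. of_int (sign p) * (\<Sum>i\<in>UNIV. Z $ i $ p i * (\<Prod>j\<in>UNIV - {i}. w $ j $ p j)))) (at w)"
    by (intro has_derivative_sum has_derivative_mult_right has_derivative_prod
        bounded_linear_imp_has_derivative bounded_linear_nth_nth)
  moreover have "(\<Sum>p\<in>?S. of_int (sign p) * (\<Sum>i\<in>UNIV. Z $ i $ p i * (\<Prod>j\<in>UNIV - {i}. w $ j $ p j)))
    = (\<Sum>i\<in>UNIV. det (\<chi> k. if k = i then Z $ i else w $ k))" for Z
  proof -
    have "(\<Sum>p\<in>?S. of_int (sign p) * (\<Sum>i\<in>UNIV. Z $ i $ p i * (\<Prod>j\<in>UNIV - {i}. w $ j $ p j)))
       = (\<Sum>i\<in>UNIV. \<Sum>p\<in>?S. of_int (sign p) * (Z $ i $ p i * (\<Prod>j\<in>UNIV - {i}. w $ j $ p j)))"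
      unfolding sum_distrib_left by (rule sum.swap)
    also have "\<dots> = (\<Sum>i\<in>UNIV. det (\<chi> k. if k = i then Z $ i else w $ k))"
      unfolding det_def
    proof (intro sum.cong refl arg_cong2[where f = "(*)"])
      fix i :: 'n and p :: "'n \<Rightarrow> 'n"
      have "(\<Prod>k\<in>UNIV. (\<chi> k. if k = i then Z $ i else w $ k) $ k $ p k)
        = (\<chi> k. if k = i then Z $ i else w $ k) $ i $ p i *
          (\<Prod>k\<in>UNIV - {i}. (\<chi> k. if k = i then Z $ i else w $ k) $ k $ p k)"
        by (rule prod.remove) auto
      then show "Z $ i $ p i * (\<Prod>j\<in>UNIV - {i}. w $ j $ p j)
        = (\<Prod>k\<in>UNIV. (\<chi> k. if k = i then Z $ i else w $ k) $ k $ p k)"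
        by simp
    qed
    finally show ?thesis .
  qed
  ultimately show ?thesis
    unfolding det_def[abs_def] by (simp only:)
qed

lemma isCont_det: "isCont det (w :: real^'n^'n::finite)"
  by (rule has_derivative_continuous[OF det_has_derivative])

lemma tendsto_det [tendsto_intros]:
  fixes f :: "'a \<Rightarrow> real^'n^'n::finite"
  shows "(f \<longlongrightarrow> a) F \<Longrightarrow> ((\<lambda>x. det (f x)) \<longlongrightarrow> det a) F"
  by (rule isCont_tendsto_compose[OF isCont_det])

lemma continuous_on_det [continuous_intros]:
  fixes f :: "'a::topological_space \<Rightarrow> real^'n^'n::finite"
  shows "continuous_on S f \<Longrightarrow> continuous_on S (\<lambda>x. det (f x))"
  unfolding continuous_on_def by (auto intro: tendsto_det)

text \<open>Cramer's rule: if \<open>det w\<close> is nonzero, this is the coordinate of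
  \<open>Z $ i\<close> along \<open>w $ j\<close> in the basis of the rows of \<open>w\<close>. As a
  quotient of determinants it depends continuously on both matrices.\<close>

definition row_coeff :: "real^'n^'n::finite \<Rightarrow> real^'n^'n \<Rightarrow> 'n \<Rightarrow> 'n \<Rightarrow> real" where
  "row_coeff w Z i j = det (\<chi> k. if k = j then Z $ i else w $ k) / det w"

lemma row_coeff_eqI:
  assumes "det w \<noteq> 0" "Z $ i = (\<Sum>j\<in>UNIV. x $ j *\<^sub>R w $ j)"
  shows "row_coeff w Z i j = x $ j"
proof -
  have "(\<chi> k. if k = j then Z $ i else w $ k) =
      (\<chi> k. if k = j then \<Sum>l\<in>UNIV. x $ l *s row l w else row k w)"
    unfolding assms(2) by (simp add: row_def scalar_mult_eq_scaleR vec_lambda_eta cong: if_cong)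
  then show ?thesis
    using cramer_lemma_transpose[of j x w] assms(1) by (simp only: row_coeff_def) simp
qed

lemma row_coeff_expansion:
  assumes "det w \<noteq> 0"
  shows "Z $ i = (\<Sum>j\<in>UNIV. row_coeff w Z i j *\<^sub>R w $ j)"
proof -
  obtain B where B: "B ** w = mat 1"
    using assms unfolding invertible_det_nz[symmetric] invertible_def by auto
  define x where "x = Z $ i v* B"
  have "x v* w = Z $ i"
    unfolding x_def vector_matrix_mul_assoc B by simp
  moreover have "x v* w = (\<Sum>j\<in>UNIV. x $ j *\<^sub>R w $ j)"
    by (simp add: vec_eq_iff vector_matrix_mult_def mult.commute)
  ultimately have "Z $ i = (\<Sum>j\<in>UNIV. x $ j *\<^sub>R w $ j)" by simp
  then show ?thesis using row_coeff_eqI[OF assms, of Z i x] by simp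
qed

lemma det_nonzero_rows: "det (w :: real^'n^'n::finite) \<noteq> 0 \<Longrightarrow> w $ i \<noteq> 0"
  using det_zero_row(1)[of i w] by (auto simp: row_def vec_eq_iff)

definition positive_form :: "nat \<Rightarrow> (('n::finite \<Rightarrow> nat) \<Rightarrow> real) \<Rightarrow> bool" where
  "positive_form m P \<longleftrightarrow> (\<forall>x. x \<noteq> 0 \<longrightarrow> hom_eval (2 * m) P x > 0)"

text \<open>The cofactor of \<open>polar m P w i j\<close> in the differential of
  \<open>g_fun\<close>. It is 0 on the diagonal because moving a row along itself leaves
  \<open>g_fun\<close> unchanged to first order.\<close>

definition off_weight :: "nat \<Rightarrow> (('n::finite \<Rightarrow> nat) \<Rightarrow> real) \<Rightarrow> real^'n^'n \<Rightarrow> real^'n^'n \<Rightarrow> 'n \<Rightarrow> 'n \<Rightarrow> real" where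
  "off_weight m P w Z i j =
     (if i = j then 0 else - (row_coeff w Z i j * g_fun m P w / (2 * real m * hom_eval (2 * m) P (w $ i))))"

definition g_derivative :: "nat \<Rightarrow> (('n::finite \<Rightarrow> nat) \<Rightarrow> real) \<Rightarrow> real^'n^'n \<Rightarrow> real^'n^'n \<Rightarrow> real" where
  "g_derivative m P w Z = (\<Sum>i\<in>UNIV. \<Sum>j\<in>UNIV. polar m P w i j * off_weight m P w Z i j)"

lemma open_det_pos: "open {w :: real^'n^'n::finite. det w > 0}"
  by (intro open_Collect_less continuous_intros)

text \<open>A product whose first factor vanishes at the point can be differentiated although the
  second is merely continuous. This keeps derivatives of the weights, and second derivatives of
  parametrizations, out of the Hessian.\<close>

lemma DERIV_zero_mult:
  fixes f e :: "real \<Rightarrow> real"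
  assumes f: "(f has_real_derivative f') (at 0)" and "f 0 = 0" and e: "(e \<longlongrightarrow> e 0) (at 0)"
  shows "((\<lambda>s. f s * e s) has_real_derivative f' * e 0) (at 0)"
  using tendsto_mult[OF f[unfolded DERIV_def] e] assms(2) by (simp add: DERIV_def)

context
  fixes m :: nat and P :: "('n::finite \<Rightarrow> nat) \<Rightarrow> real"
  assumes m: "m > 0" and pos: "positive_form m P"
begin

lemma row_value_pos: "det w \<noteq> 0 \<Longrightarrow> hom_eval (2 * m) P (w $ i) > 0"
  using pos det_nonzero_rows unfolding positive_form_def by blast

text \<open>Reduces the differential of the quotient to a logarithmic derivative, a sum over the
  rows.\<close>

lemma g_fun_eq_exp:
  assumes "det w > 0"
  shows "g_fun m P w = exp (ln (det w) - (\<Sum>i\<in>UNIV. 1 / (2 * real m) * ln (hom_eval (2 * m) P (w $ i))))"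
proof -
  have "hom_eval (2 * m) P (w $ i) \<noteq> 0" for i using row_value_pos[of w i] assms by simp
  then show ?thesis
    using assms by (simp add: g_fun_def exp_diff exp_sum powr_def)
qed

lemma g_fun_pos: "det w > 0 \<Longrightarrow> g_fun m P w > 0"
  by (simp add: g_fun_eq_exp)

lemma g_has_derivative:
  assumes det: "det w > 0"
  shows "(g_fun m P has_derivative g_derivative m P w) (at w)"
proof -
  have p: "hom_eval (2 * m) P (w $ i) > 0" for i using row_value_pos[of w i] det by simp
  have dw: "det w \<noteq> 0" using det by simp
  let ?D = "\<lambda>Z. \<Sum>i\<in>UNIV. det (\<chi> k. if k = i then Z $ i else w $ k)"
  let ?L = "\<lambda>Z i. \<Sum>k\<in>UNIV. pd m P k (w $ i) * Z $ i $ k"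
  have h: "((\<lambda>w. hom_eval (2 * m) P (w $ i)) has_derivative (\<lambda>Z. ?L Z i)) (at w)" for i
    by (rule has_derivative_compose[OF bounded_linear.has_derivative[OF bounded_linear_vec_nth has_derivative_ident]
        hom_eval_derivative_pd[OF m]])
  have "((\<lambda>w. exp (ln (det w) - (\<Sum>i\<in>UNIV. 1 / (2 * real m) * ln (hom_eval (2 * m) P (w $ i))))) has_derivative
     (\<lambda>Z. (?D Z * inverse (det w) - (\<Sum>i\<in>UNIV. 1 / (2 * real m) * (?L Z i * inverse (hom_eval (2 * m) P (w $ i)))))
        * exp (ln (det w) - (\<Sum>i\<in>UNIV. 1 / (2 * real m) * ln (hom_eval (2 * m) P (w $ i)))))) (at w)"
    by (intro has_derivative_exp has_derivative_diff has_derivative_sum has_derivative_mult_right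
        has_derivative_ln det_has_derivative h p det)
  then have "((\<lambda>w. exp (ln (det w) - (\<Sum>i\<in>UNIV. 1 / (2 * real m) * ln (hom_eval (2 * m) P (w $ i))))) has_derivative
     g_derivative m P w) (at w)"
  proof (rule has_derivative_eq_rhs, intro ext)
    fix Z :: "real^'n^'n"
    define p where "p i = hom_eval (2 * m) P (w $ i)" for i
    have p0: "p i > 0" for i using row_value_pos[of w i] det by (simp add: p_def)
    have D: "?D Z * inverse (det w) = (\<Sum>i\<in>UNIV. row_coeff w Z i i)"
      by (simp add: row_coeff_def divide_inverse sum_distrib_right)
    have L: "?L Z i = (\<Sum>j\<in>UNIV. row_coeff w Z i j * polar m P w i j)" for i
    proof -
      have "?L Z i = (\<Sum>k\<in>UNIV. \<Sum>j\<in>UNIV. pd m P k (w $ i) * (row_coeff w Z i j * w $ j $ k))"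
        by (subst row_coeff_expansion[OF dw, of Z i]) (simp add: sum_distrib_left)
      also have "\<dots> = (\<Sum>j\<in>UNIV. \<Sum>k\<in>UNIV. pd m P k (w $ i) * (row_coeff w Z i j * w $ j $ k))"
        by (rule sum.swap)
      finally show ?thesis by (simp add: polar_def sum_distrib_left mult_ac)
    qed
    \<comment> \<open>In the expansion of dP(w_i)(Z_i) along the rows, the term \<open>j = i\<close>
      is 2m P(w_i) times the coefficient, by Euler's identity. After division by 2m P(w_i) it
      cancels the contribution of row i to the derivative of \<open>det\<close>.\<close>
    have row: "(\<Sum>j\<in>UNIV. polar m P w i j * off_weight m P w Z i j)
        = g_fun m P w * (row_coeff w Z i i - 1 / (2 * real m) * (?L Z i * inverse (p i)))" for i
    proof -
      let ?t = "\<lambda>j. - (g_fun m P w / (2 * real m * p i)) * (row_coeff w Z i j * polar m P w i j)"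
      have "(\<Sum>j\<in>UNIV. ?t j) = ?t i + (\<Sum>j\<in>UNIV - {i}. ?t j)"
        by (rule sum.remove) auto
      moreover have "(\<Sum>j\<in>UNIV. polar m P w i j * off_weight m P w Z i j) = (\<Sum>j\<in>UNIV - {i}. ?t j)"
        by (subst sum.mono_neutral_right[of UNIV "UNIV - {i}"]) (auto simp: off_weight_def p_def intro!: sum.cong)
      moreover have "?t i = - (g_fun m P w * row_coeff w Z i i)"
        using m p0[of i] by (simp add: polar_diagonal[OF m] flip: p_def)
      moreover have "(\<Sum>j\<in>UNIV. ?t j) = - (g_fun m P w / (2 * real m * p i)) * ?L Z i"
        unfolding L sum_distrib_left ..
      ultimately show ?thesis
        by (simp add: field_simps)
    qed
    show "(?D Z * inverse (det w) - (\<Sum>i\<in>UNIV. 1 / (2 * real m) * (?L Z i * inverse (hom_eval (2 * m) P (w $ i)))))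
        * exp (ln (det w) - (\<Sum>i\<in>UNIV. 1 / (2 * real m) * ln (hom_eval (2 * m) P (w $ i)))) = g_derivative m P w Z"
      unfolding g_fun_eq_exp[OF det, symmetric] D g_derivative_def row
      unfolding p_def[symmetric] sum_distrib_left[symmetric] sum_subtractf by (simp add: mult.commute)
  qed
  then show ?thesis
    by (rule has_derivative_transform_within_open[OF _ open_det_pos]) (use det in \<open>auto simp: g_fun_eq_exp\<close>)
qed

lemma tendsto_off_weight:
  assumes "(f \<longlongrightarrow> w) F" "(h \<longlongrightarrow> Z) F" "det w > 0"
  shows "((\<lambda>s. off_weight m P (f s) (h s) i j) \<longlongrightarrow> off_weight m P w Z i j) F"
proof (cases "i = j")
  case False
  have g: "isCont (g_fun m P) w" by (rule has_derivative_continuous[OF g_has_derivative[OF assms(3)]])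
  have e: "isCont (hom_eval (2 * m) P) x" for x by (rule has_derivative_continuous[OF hom_eval_derivative_pd[OF m]])
  have "((\<lambda>s. \<chi> k. if k = j then h s $ i else f s $ k) \<longlongrightarrow> (\<chi> k. if k = j then Z $ i else w $ k)) F"
    by (intro vec_tendstoI) (auto intro!: tendsto_vec_nth assms)
  then show ?thesis
    using False row_value_pos[of w i] assms(3) m
    by (auto simp: off_weight_def row_coeff_def intro!: tendsto_intros assms
        isCont_tendsto_compose[OF g] isCont_tendsto_compose[OF e])
qed (simp add: off_weight_def)

text \<open>The derivative in direction \<open>Y\<close> is a sum of off-diagonal polar entries
  times weights. The entries vanish at \<open>u\<close>, so differentiating along \<open>X\<close>
  hits only them, and continuity of the derivative of \<open>\<psi>\<close> in direction
  \<open>Y\<close> is enough.\<close>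

lemma second_partial_g:
  fixes \<psi> :: "'a::euclidean_space \<Rightarrow> real^'n^'n"
  assumes U: "open U" "u \<in> U" and d: "\<And>x. x \<in> U \<Longrightarrow> \<psi> differentiable (at x)"
    and c: "continuous_on U (\<lambda>x. frechet_derivative \<psi> (at x) Y)"
    and det: "det (\<psi> u) > 0" and off: "\<And>i j. i \<noteq> j \<Longrightarrow> polar m P (\<psi> u) i j = 0"
  shows "second_partial (g_fun m P \<circ> \<psi>) u X Y =
    (\<Sum>i\<in>UNIV. \<Sum>j\<in>UNIV. dpolar m P (\<psi> u) (frechet_derivative \<psi> (at u) X) i j *
       off_weight m P (\<psi> u) (frechet_derivative \<psi> (at u) Y) i j)"
proof -
  have D: "(\<psi> has_derivative frechet_derivative \<psi> (at x)) (at x)" if "x \<in> U" for x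
    using d[OF that] by (simp add: frechet_derivative_works)
  define x where "x s = u + s *\<^sub>R X" for s :: real
  have x0: "x 0 = u" by (simp add: x_def)
  have xc: "(x \<longlongrightarrow> u) (at 0)"
    unfolding x_def by (auto intro!: tendsto_eq_intros)
  have xd: "(x has_derivative (\<lambda>s. s *\<^sub>R X)) (at 0)"
    unfolding x_def by (auto intro!: derivative_eq_intros)
  have \<psi>c: "isCont \<psi> u" using D[OF U(2)] by (rule has_derivative_continuous)
  have \<psi>x: "((\<lambda>s. \<psi> (x s)) \<longlongrightarrow> \<psi> u) (at 0)" by (rule isCont_tendsto_compose[OF \<psi>c xc])
  let ?G = "\<lambda>s. g_derivative m P (\<psi> (x s)) (frechet_derivative \<psi> (at (x s)) Y)"
  have inner: "deriv (\<lambda>t. (g_fun m P \<circ> \<psi>) (y + t *\<^sub>R Y)) 0 = g_derivative m P (\<psi> y) (frechet_derivative \<psi> (at y) Y)"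
    if "y \<in> U" "det (\<psi> y) > 0" for y
  proof (rule DERIV_imp_deriv)
    have l: "((\<lambda>t. y + t *\<^sub>R Y) has_derivative (\<lambda>t. t *\<^sub>R Y)) (at (0::real))"
      by (auto intro!: derivative_eq_intros)
    have gd: "((\<lambda>t. g_fun m P (\<psi> (y + t *\<^sub>R Y))) has_derivative
        (\<lambda>t. g_derivative m P (\<psi> y) (frechet_derivative \<psi> (at y) (t *\<^sub>R Y)))) (at 0)"
      using has_derivative_compose[OF has_derivative_compose[OF l, of \<psi> "frechet_derivative \<psi> (at y)"], of "g_fun m P" "g_derivative m P (\<psi> y)"]
        D[OF that(1)] g_has_derivative[OF that(2)] by simp
    then have "((\<lambda>t. g_fun m P (\<psi> (y + t *\<^sub>R Y))) has_real_derivative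
        g_derivative m P (\<psi> y) (frechet_derivative \<psi> (at y) (1 *\<^sub>R Y))) (at 0)"
    proof (rule has_derivative_imp_has_field_derivative)
      fix t
      have "linear (\<lambda>t. g_derivative m P (\<psi> y) (frechet_derivative \<psi> (at y) (t *\<^sub>R Y)))"
        using gd by (rule has_derivative_linear)
      from linear_scale[OF this, of t 1]
      show "t * g_derivative m P (\<psi> y) (frechet_derivative \<psi> (at y) (1 *\<^sub>R Y)) =
        g_derivative m P (\<psi> y) (frechet_derivative \<psi> (at y) (t *\<^sub>R Y))" by simp
    qed
    then show "((\<lambda>t. (g_fun m P \<circ> \<psi>) (y + t *\<^sub>R Y)) has_real_derivative
        g_derivative m P (\<psi> y) (frechet_derivative \<psi> (at y) Y)) (at 0)" by simp
  qed
  have "eventually (\<lambda>s. x s \<in> U) (nhds 0)" "eventually (\<lambda>s. det (\<psi> (x s)) > 0) (nhds 0)"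
    using topological_tendstoD[OF xc U] order_tendstoD(1)[OF tendsto_det[OF \<psi>x] det] U det
    by (auto simp: eventually_nhds_conv_at x0)
  \<comment> \<open>The formula for the inner derivative is required on a neighbourhood of s = 0,
    since it is differentiated again; openness of \<open>U\<close> and of the condition
    \<open>det > 0\<close> provides one.\<close>
  then have ev: "eventually (\<lambda>s. deriv (\<lambda>t. (g_fun m P \<circ> \<psi>) (x s + t *\<^sub>R Y)) 0 = ?G s) (nhds 0)"
    by eventually_elim (rule inner)
  have Yc: "((\<lambda>s. frechet_derivative \<psi> (at (x s)) Y) \<longlongrightarrow> frechet_derivative \<psi> (at u) Y) (at 0)"
    using isCont_tendsto_compose[OF _ xc, of "\<lambda>x. frechet_derivative \<psi> (at x) Y"] c U
    by (simp add: continuous_on_eq_continuous_at)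
  have prod: "((\<lambda>s. polar m P (\<psi> (x s)) i j * off_weight m P (\<psi> (x s)) (frechet_derivative \<psi> (at (x s)) Y) i j)
     has_real_derivative dpolar m P (\<psi> u) (frechet_derivative \<psi> (at u) X) i j *
       off_weight m P (\<psi> u) (frechet_derivative \<psi> (at u) Y) i j) (at 0)" for i j
  proof (cases "i = j")
    case True
    then show ?thesis by (simp add: off_weight_def)
  next
    case False
    have "((\<lambda>s. polar m P (\<psi> (x s)) i j) has_derivative (\<lambda>s. dpolar m P (\<psi> u) (frechet_derivative \<psi> (at u) (s *\<^sub>R X)) i j)) (at 0)"
      using has_derivative_compose[OF has_derivative_compose[OF xd, of \<psi> "frechet_derivative \<psi> (at u)"], of "\<lambda>w. polar m P w i j" "\<lambda>Z. dpolar m P (\<psi> u) Z i j"]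
        D[OF U(2)] polar_has_derivative[OF m, of P i j "\<psi> u"] by (simp add: x0)
    then have "((\<lambda>s. polar m P (\<psi> (x s)) i j) has_real_derivative dpolar m P (\<psi> u) (frechet_derivative \<psi> (at u) X) i j) (at 0)"
      by (rule has_derivative_imp_has_field_derivative)
        (simp add: linear_scale[OF has_derivative_linear[OF D[OF U(2)]]] dpolar_scaleR)
    from DERIV_zero_mult[OF this, where e = "\<lambda>s. off_weight m P (\<psi> (x s)) (frechet_derivative \<psi> (at (x s)) Y) i j"] show ?thesis
      using off[OF False] tendsto_off_weight[OF \<psi>x Yc det] by (simp add: x0)
  qed
  have "second_partial (g_fun m P \<circ> \<psi>) u X Y = deriv ?G 0"
    unfolding second_partial_def x_def[symmetric] by (rule deriv_cong_ev[OF ev refl])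
  also have "\<dots> = (\<Sum>i\<in>UNIV. \<Sum>j\<in>UNIV. dpolar m P (\<psi> u) (frechet_derivative \<psi> (at u) X) i j *
       off_weight m P (\<psi> u) (frechet_derivative \<psi> (at u) Y) i j)"
    unfolding g_derivative_def by (rule DERIV_imp_deriv) (intro DERIV_sum prod)
  finally show ?thesis .
qed

text \<open>\<open>T\<close> moves row i alone, along \<open>v $ j\<close> made orthogonal to
  \<open>v $ i\<close>. Its coordinates are 1 along \<open>v $ j\<close> and something along
  \<open>v $ i\<close>, where the weight is 0, so a single entry survives. The array
  \<open>a\<close> is arbitrary because the lemma isolates entries of \<open>polar\<close> (critical
  points) and of \<open>dpolar\<close> (Hessian).\<close>

lemma off_weight_test_vector:
  fixes v :: "real^'n^'n"
  assumes det: "det v > 0" and ij: "i \<noteq> j"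
  defines "T \<equiv> (\<chi> k. if k = i then v $ j - (v $ j \<bullet> v $ i) *\<^sub>R v $ i else 0)"
  shows "(\<Sum>k\<in>UNIV. \<Sum>l\<in>UNIV. a k l * off_weight m P v T k l)
    = - a i j * (g_fun m P v / (2 * real m * hom_eval (2 * m) P (v $ i)))"
proof -
  have dv: "det v \<noteq> 0" using det by simp
  have T: "T $ i = (\<Sum>l\<in>UNIV. (\<chi> l. (if l = j then 1 else 0) - (if l = i then v $ j \<bullet> v $ i else 0)) $ l *\<^sub>R v $ l)"
    by (simp add: T_def scaleR_diff_left sum_subtractf if_distrib[of "\<lambda>c. c *\<^sub>R _"] cong: if_cong)
  have T0: "T $ k = (\<Sum>l\<in>UNIV. 0 $ l *\<^sub>R v $ l)" if "k \<noteq> i" for k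
    using that by (simp add: T_def)
  have "row_coeff v T k l = (if k = i \<and> l = j then 1 else 0)" if "k \<noteq> l" for k l
    using row_coeff_eqI[OF dv T, of l] row_coeff_eqI[OF dv T0, of k l] that by (cases "k = i") auto
  then have "a k l * off_weight m P v T k l =
     (if l = j then if k = i then - a i j * (g_fun m P v / (2 * real m * hom_eval (2 * m) P (v $ i))) else 0 else 0)" for k l
    using ij by (auto simp: off_weight_def)
  then show ?thesis by simp
qed

end

section \<open>Elementary functions are smooth\<close>

text \<open>A class closed under differentiation, so that smoothness of every order follows by one
  induction. \<open>powr\<close> supplies inverses and square roots of positive functions;
  \<open>cong\<close> is present because \<open>frechet_derivative\<close> is known only on
  \<open>U\<close>.\<close>

inductive elementary_on :: "'a::euclidean_space set \<Rightarrow> ('a \<Rightarrow> real) \<Rightarrow> bool" for U where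
  const: "elementary_on U (\<lambda>x. c)"
| linear: "bounded_linear f \<Longrightarrow> elementary_on U f"
| add: "elementary_on U f \<Longrightarrow> elementary_on U g \<Longrightarrow> elementary_on U (\<lambda>x. f x + g x)"
| mult: "elementary_on U f \<Longrightarrow> elementary_on U g \<Longrightarrow> elementary_on U (\<lambda>x. f x * g x)"
| powr: "elementary_on U f \<Longrightarrow> (\<And>x. x \<in> U \<Longrightarrow> f x > 0) \<Longrightarrow> elementary_on U (\<lambda>x. f x powr r)"
| cong: "elementary_on U f \<Longrightarrow> (\<And>x. x \<in> U \<Longrightarrow> f x = g x) \<Longrightarrow> elementary_on U g"

lemma elementary_on_sum:
  "finite I \<Longrightarrow> (\<And>i. i \<in> I \<Longrightarrow> elementary_on U (f i)) \<Longrightarrow> elementary_on U (\<lambda>x. \<Sum>i\<in>I. f i x)"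
  by (induction I rule: finite_induct) (auto intro: elementary_on.const elementary_on.add)

text \<open>Openness of \<open>U\<close> enters in the case \<open>cong\<close>: functions that
  agree on an open set have the same derivative there.\<close>

lemma elementary_on_derivative:
  assumes "open U" "elementary_on U f"
  shows "\<exists>f'. (\<forall>x\<in>U. (f has_derivative f' x) (at x)) \<and> (\<forall>v. elementary_on U (\<lambda>x. f' x v))"
  using assms(2)
proof (induction rule: elementary_on.induct)
  case (const c)
  show ?case by (intro exI[of _ "\<lambda>x v. 0"]) (auto intro: elementary_on.const)
next
  case (linear f)
  then show ?case
    by (intro exI[of _ "\<lambda>x. f"]) (auto intro: elementary_on.const bounded_linear_imp_has_derivative)
next
  case (add f g)
  then obtain f' g' where "\<forall>x\<in>U. (f has_derivative f' x) (at x)" "\<forall>v. elementary_on U (\<lambda>x. f' x v)"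
    "\<forall>x\<in>U. (g has_derivative g' x) (at x)" "\<forall>v. elementary_on U (\<lambda>x. g' x v)" by blast
  then show ?case
    by (intro exI[of _ "\<lambda>x v. f' x v + g' x v"]) (auto intro: elementary_on.add has_derivative_add)
next
  case (mult f g)
  then obtain f' g' where "\<forall>x\<in>U. (f has_derivative f' x) (at x)" "\<forall>v. elementary_on U (\<lambda>x. f' x v)"
    "\<forall>x\<in>U. (g has_derivative g' x) (at x)" "\<forall>v. elementary_on U (\<lambda>x. g' x v)" by blast
  then show ?case
    using mult.hyps
    by (intro exI[of _ "\<lambda>x v. f x * g' x v + f' x v * g x"])
      (auto intro!: elementary_on.add elementary_on.mult has_derivative_mult)
next
  case (powr f r)
  then obtain f' where f': "\<forall>x\<in>U. (f has_derivative f' x) (at x)" "\<forall>v. elementary_on U (\<lambda>x. f' x v)" by blast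
  have "((\<lambda>x. f x powr r) has_derivative (\<lambda>v. r * f x powr (r - 1) * f' x v)) (at x)" if "x \<in> U" for x
  proof -
    have "((\<lambda>y. y powr r) has_derivative (\<lambda>h. r * f x powr (r - 1) * h)) (at (f x))"
      using has_real_derivative_powr[OF powr.hyps(2)[OF that], of r] by (simp add: has_field_derivative_def)
    then show ?thesis
      using has_derivative_compose[of f "f' x" x UNIV] f'(1) that by auto
  qed
  then show ?case
    using f'(2) powr.hyps
    by (intro exI[of _ "\<lambda>x v. r * f x powr (r - 1) * f' x v"])
      (auto intro!: elementary_on.mult elementary_on.powr elementary_on.const)
next
  case (cong f g)
  then obtain f' where f': "\<forall>x\<in>U. (f has_derivative f' x) (at x)" "\<forall>v. elementary_on U (\<lambda>x. f' x v)" by blast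
  have "\<forall>x\<in>U. (g has_derivative f' x) (at x)"
    using f'(1) cong.hyps(2) has_derivative_transform_within_open[OF _ assms(1)] by blast
  then show ?case using f'(2) by blast
qed

text \<open>Induction on the order for all \<open>f\<close> at once: every directional derivative
  again has elementary components.\<close>

lemma smooth_on_elementary:
  fixes f :: "'a::euclidean_space \<Rightarrow> 'b::euclidean_space"
  assumes U: "open U" and "\<And>b. b \<in> Basis \<Longrightarrow> elementary_on U (\<lambda>x. f x \<bullet> b)"
  shows "smooth_on U f"
proof -
  have "C_k_on k U f" if "\<And>b. b \<in> Basis \<Longrightarrow> elementary_on U (\<lambda>x. f x \<bullet> b)" for k and f :: "'a \<Rightarrow> 'b"
    using that
  proof (induction k arbitrary: f)
    case (0 f)
    show ?case unfolding C_k_on.simps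
    proof (subst continuous_on_componentwise, intro ballI)
      fix b :: 'b assume "b \<in> Basis"
      from elementary_on_derivative[OF U 0[OF this]] show "continuous_on U (\<lambda>x. f x \<bullet> b)"
        by (metis has_derivative_continuous continuous_at_imp_continuous_on)
    qed
  next
    case (Suc k f)
    have "\<forall>b\<in>Basis. \<exists>f'. (\<forall>x\<in>U. ((\<lambda>x. f x \<bullet> b) has_derivative f' x) (at x)) \<and> (\<forall>v. elementary_on U (\<lambda>x. f' x v))"
      using elementary_on_derivative[OF U Suc.prems] by blast
    then obtain f' where f': "\<And>b x. b \<in> Basis \<Longrightarrow> x \<in> U \<Longrightarrow> ((\<lambda>x. f x \<bullet> b) has_derivative f' b x) (at x)"
        "\<And>b v. b \<in> Basis \<Longrightarrow> elementary_on U (\<lambda>x. f' b x v)" by metis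
    define F where "F x v = (\<Sum>b\<in>Basis. f' b x v *\<^sub>R b)" for x v
    have Fb: "F x v \<bullet> b = f' b x v" if "b \<in> Basis" for x v b
      using that by (simp add: F_def inner_sum_left inner_Basis if_distrib cong: if_cong)
    have F: "(f has_derivative F x) (at x)" if "x \<in> U" for x
      by (subst has_derivative_componentwise_within) (auto simp: Fb f'(1) that)
    then have fd: "frechet_derivative f (at x) = F x" if "x \<in> U" for x
      using that by (metis frechet_derivative_at)
    show ?case unfolding C_k_on.simps
    proof (intro conjI ballI allI)
      fix x assume "x \<in> U" then show "f differentiable at x" using F unfolding differentiable_def by blast
    next
      fix v
      show "C_k_on k U (\<lambda>x. frechet_derivative f (at x) v)"
      proof (rule Suc.IH)
        fix b :: 'b assume b: "b \<in> Basis"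
        show "elementary_on U (\<lambda>x. frechet_derivative f (at x) v \<bullet> b)"
          by (rule elementary_on.cong[OF f'(2)[OF b, of v]]) (simp add: fd Fb b)
      qed
    qed
  qed
  then show ?thesis using assms(2) by (simp add: smooth_on_def)
qed

subsection \<open>Central projection charts\<close>

text \<open>The tangent space at \<open>v\<close> of the product of unit spheres.\<close>

definition tangent_frames :: "real^'n^'n \<Rightarrow> (real^'n^'n::finite) set" where
  "tangent_frames v = {X. \<forall>i. X $ i \<bullet> v $ i = 0}"

definition chart_domain :: "real^'n^'n \<Rightarrow> (real^'n^'n::finite) set" where
  "chart_domain v = {X. \<forall>i. (v + X) $ i \<noteq> 0} \<inter> {X. det (v + X) > 0}"

text \<open>Each affine tangent plane is projected from the origin onto the sphere. The norm is
  written as a \<open>powr\<close> of the inner product so that the entries fit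
  \<open>elementary_on\<close>.\<close>

definition chart :: "real^'n^'n \<Rightarrow> real^'n^'n \<Rightarrow> real^'n^'n::finite" where
  "chart v X = (\<chi> i. (((v + X) $ i) \<bullet> ((v + X) $ i)) powr (- 1 / 2) *\<^sub>R (v + X) $ i)"

text \<open>The ray through \<open>w $ i\<close> meets the affine tangent plane at
  \<open>v $ i\<close> where the inner product with \<open>v $ i\<close> equals 1; the difference to
  \<open>v $ i\<close> is the tangent vector sought.\<close>

definition chart_inverse :: "real^'n^'n \<Rightarrow> real^'n^'n \<Rightarrow> real^'n^'n::finite" where
  "chart_inverse v w = (\<chi> i. (w $ i \<bullet> v $ i) powr (- 1) *\<^sub>R w $ i - v $ i)"

lemma inner_self_powr: "x \<noteq> 0 \<Longrightarrow> (x \<bullet> x) powr (- 1 / 2) = inverse (norm x)"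
  using powr_minus[of "x \<bullet> x" "1 / 2"] powr_half_sqrt[of "x \<bullet> x"] by (simp add: norm_eq_sqrt_inner)

lemma subspace_tangent_frames: "subspace (tangent_frames v)"
  by (auto simp: subspace_def tangent_frames_def inner_add_left)

lemma open_chart_domain: "open (chart_domain v)"
proof -
  have "{X. \<forall>i. (v + X) $ i \<noteq> 0} = (\<Inter>i. {X. (v + X) $ i \<noteq> 0})" by auto
  then show ?thesis
    unfolding chart_domain_def
    by (auto intro!: open_Int open_INT open_Collect_neq open_Collect_less continuous_intros)
qed

lemma elementary_on_matrix_entry: "elementary_on U (\<lambda>w :: real^'n^'n::finite. w $ i $ k)"
  by (rule elementary_on.linear[OF bounded_linear_nth_nth])

lemma Basis_matrix: "b \<in> (Basis :: (real^'n^'n::finite) set) \<Longrightarrow> \<exists>i k. b = axis i (axis k 1)"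
  by (auto simp: Basis_vec_def)

lemma smooth_on_matrix:
  fixes f :: "real^'n^'n::finite \<Rightarrow> real^'n^'n"
  assumes "open U" "\<And>i k. elementary_on U (\<lambda>x. f x $ i $ k)"
  shows "smooth_on U f"
proof (rule smooth_on_elementary[OF assms(1)])
  fix b :: "real^'n^'n" assume "b \<in> Basis"
  then obtain i k where "b = axis i (axis k 1)" using Basis_matrix by blast
  then show "elementary_on U (\<lambda>x. f x \<bullet> b)" using assms(2) by (simp add: inner_axis)
qed

lemma smooth_on_chart: "smooth_on (chart_domain v) (chart (v :: real^'n^'n::finite))"
proof (rule smooth_on_matrix[OF open_chart_domain])
  fix i k
  have e: "elementary_on (chart_domain v) (\<lambda>X. v $ i $ l + X $ i $ l)" for l
    by (intro elementary_on.add elementary_on.const elementary_on_matrix_entry)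
  have "elementary_on (chart_domain v) (\<lambda>X. (\<Sum>l\<in>UNIV. (v $ i $ l + X $ i $ l) * (v $ i $ l + X $ i $ l)) powr (- 1 / 2) * (v $ i $ k + X $ i $ k))"
  proof (intro elementary_on.mult elementary_on.powr elementary_on_sum e)
    fix X assume "X \<in> chart_domain v"
    then have "(v + X) $ i \<bullet> (v + X) $ i > 0" by (auto simp: chart_domain_def)
    then show "(\<Sum>l\<in>UNIV. (v $ i $ l + X $ i $ l) * (v $ i $ l + X $ i $ l)) > 0"
      by (simp add: inner_vec_def)
  qed auto
  then show "elementary_on (chart_domain v) (\<lambda>X. chart v X $ i $ k)"
    by (simp add: chart_def inner_vec_def)
qed

lemma smooth_on_chart_inverse: "smooth_on {w. \<forall>i. w $ i \<bullet> v $ i > 0} (chart_inverse (v :: real^'n^'n::finite))"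
  (is "smooth_on ?V _")
proof (rule smooth_on_matrix)
  have "?V = (\<Inter>i. {w. w $ i \<bullet> v $ i > 0})" by auto
  then show "open ?V" by (auto intro!: open_INT open_Collect_less continuous_intros)
  fix i k
  have b: "bounded_linear (\<lambda>w :: real^'n^'n. w $ i \<bullet> v $ i)"
    by (intro bounded_linear_compose[OF bounded_linear_inner_left bounded_linear_vec_nth])
  have "elementary_on ?V (\<lambda>w. (w $ i \<bullet> v $ i) powr (- 1) * w $ i $ k + - v $ i $ k)"
    by (intro elementary_on.add elementary_on.mult elementary_on.powr elementary_on.const
        elementary_on_matrix_entry elementary_on.linear[OF b]) auto
  then show "elementary_on ?V (\<lambda>X. chart_inverse v X $ i $ k)"
    by (simp add: chart_inverse_def)
qed

lemma open_positive_rows: "open {w :: real^'n^'n::finite. \<forall>i. w $ i \<bullet> v $ i > 0}"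
proof -
  have "{w. \<forall>i. w $ i \<bullet> v $ i > 0} = (\<Inter>i. {w. w $ i \<bullet> v $ i > 0})" by auto
  then show ?thesis by (auto intro!: open_INT open_Collect_less continuous_intros)
qed

lemma chart_row:
  assumes "X \<in> chart_domain v"
  shows "chart v X $ i = inverse (norm (v $ i + X $ i)) *\<^sub>R (v $ i + X $ i)"
proof -
  have "v $ i + X $ i \<noteq> 0"
    using assms unfolding chart_domain_def Int_iff mem_Collect_eq vector_add_component by blast
  then show ?thesis
    unfolding chart_def vec_lambda_beta vector_add_component by (subst inner_self_powr) (assumption, rule refl)
qed

lemma chart_eq_scale_rows:
  assumes "X \<in> chart_domain v"
  shows "chart v X = scale_rows (\<lambda>i. inverse (norm ((v + X) $ i))) (v + X)"
  by (subst vec_eq_iff) (simp only: chart_row[OF assms] vec_lambda_beta vector_add_component simp_thms)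

lemma chart_in_W_pos:
  assumes "X \<in> chart_domain v"
  shows "chart v X \<in> W_pos"
proof -
  have "(v + X) $ i \<noteq> 0" for i
    using assms unfolding chart_domain_def Int_iff mem_Collect_eq by blast
  then show ?thesis
    using assms unfolding chart_eq_scale_rows[OF assms] W_pos_def mem_Collect_eq det_scale_rows
    by (auto simp: chart_domain_def simp del: vector_add_component intro!: mult_pos_pos prod_pos)
qed

lemma W_pos_inner_self: "v \<in> W_pos \<Longrightarrow> v $ i \<bullet> v $ i = 1"
  by (simp add: W_pos_def norm_eq_1)

lemma zero_in_chart_domain: "v \<in> W_pos \<Longrightarrow> 0 \<in> chart_domain v"
  by (auto simp: W_pos_def chart_domain_def det_nonzero_rows)

lemma chart_zero: "v \<in> W_pos \<Longrightarrow> chart v 0 = v"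
  by (simp add: chart_def W_pos_inner_self vec_eq_iff)

text \<open>The image is the part of \<open>W_pos\<close> whose rows have positive inner product
  with those of \<open>v\<close>. For tangent \<open>X\<close> this inner product is the inverse of
  the norm of \<open>v $ i + X $ i\<close>, which is why \<open>chart_inverse\<close> can undo the
  normalisation.\<close>

lemma local_parametrization_chart:
  assumes v: "v \<in> W_pos"
  shows "local_parametrization W_pos (tangent_frames v) (chart_domain v) (chart v)"
proof -
  let ?V = "{w. \<forall>i. w $ i \<bullet> v $ i > 0}"
  have vv: "v $ i \<bullet> v $ i = 1" for i using v by (rule W_pos_inner_self)
  have inner: "chart v X $ i \<bullet> v $ i = inverse (norm (v $ i + X $ i))"
    if "X \<in> chart_domain v" "X \<in> tangent_frames v" for X i
  proof -
    have "X $ i \<bullet> v $ i = 0" using that(2) by (simp add: tangent_frames_def)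
    then show ?thesis unfolding chart_row[OF that(1)] by (simp add: inner_add_left vv)
  qed
  have pos: "norm (v $ i + X $ i) > 0" if "X \<in> chart_domain v" for X i
    using that by (simp add: chart_domain_def)
  have "chart v ` (chart_domain v \<inter> tangent_frames v) = W_pos \<inter> ?V"
  proof safe
    fix X i assume X: "X \<in> chart_domain v" "X \<in> tangent_frames v"
    then show "chart v X \<in> W_pos" by (intro chart_in_W_pos)
    show "chart v X $ i \<bullet> v $ i > 0" using X inner[of X i] pos[of X i] by simp
  next
    fix w assume w: "w \<in> W_pos" "\<forall>i. w $ i \<bullet> v $ i > 0"
    define X where "X = scale_rows (\<lambda>i. inverse (w $ i \<bullet> v $ i)) w - v"
    have vX: "v + X = scale_rows (\<lambda>i. inverse (w $ i \<bullet> v $ i)) w" by (simp add: X_def)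
    have wn: "norm (w $ i) = 1" for i using w by (simp add: W_pos_def)
    have w0: "w $ i \<noteq> 0" for i using wn[of i] by auto
    have wv: "w $ i \<bullet> v $ i \<noteq> 0" for i using w(2)[rule_format, of i] by simp
    have D: "X \<in> chart_domain v"
      unfolding chart_domain_def mem_Collect_eq Int_iff vX det_scale_rows
      using w w0 wv by (auto simp: W_pos_def intro!: mult_pos_pos prod_pos)
    have "X \<in> tangent_frames v"
      using wv by (simp add: tangent_frames_def X_def inner_diff_left vv)
    moreover have "chart v X = w"
    proof (subst vec_eq_iff, intro allI)
      fix i
      have "v $ i + X $ i = inverse (w $ i \<bullet> v $ i) *\<^sub>R w $ i" by (simp add: X_def)
      then show "chart v X $ i = w $ i"
        using w(2)[rule_format, of i] wn[of i] unfolding chart_row[OF D] by simp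
    qed
    ultimately show "w \<in> chart v ` (chart_domain v \<inter> tangent_frames v)" using D by blast
  qed
  moreover have "chart_inverse v (chart v X) = X" if X: "X \<in> chart_domain v" "X \<in> tangent_frames v" for X
  proof (subst vec_eq_iff, intro allI)
    fix i
    define c where "c = norm (v $ i + X $ i)"
    have c: "c > 0" using pos[OF X(1)] by (simp add: c_def)
    have "chart_inverse v w $ i = (w $ i \<bullet> v $ i) powr (- 1) *\<^sub>R w $ i - v $ i" for w
      by (simp add: chart_inverse_def)
    then have "chart_inverse v (chart v X) $ i = inverse c powr (- 1) *\<^sub>R (inverse c *\<^sub>R (v $ i + X $ i)) - v $ i"
      unfolding c_def by (simp only: inner[OF X]) (simp only: chart_row[OF X(1)])
    also have "\<dots> = X $ i" using c by (simp add: powr_minus)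
    finally show "chart_inverse v (chart v X) $ i = X $ i" .
  qed
  ultimately show ?thesis
    unfolding local_parametrization_def
    by (intro conjI exI[of _ ?V] exI[of _ "chart_inverse v"] subspace_tangent_frames open_chart_domain smooth_on_chart
      smooth_on_chart_inverse open_positive_rows) blast+
qed

section \<open>Tangent vectors in the projection chart and in arbitrary parametrizations\<close>

lemma matrix_has_derivative:
  fixes f :: "'a::real_normed_vector \<Rightarrow> real^'n^'n::finite"
  assumes "\<And>i k. ((\<lambda>x. f x $ i $ k) has_derivative (\<lambda>h. f' h $ i $ k)) (at a within S)"
  shows "(f has_derivative f') (at a within S)"
proof (subst has_derivative_componentwise_within, intro ballI)
  fix b :: "real^'n^'n" assume "b \<in> Basis"
  then obtain i k where "b = axis i (axis k 1)" using Basis_matrix by blast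
  then show "((\<lambda>x. f x \<bullet> b) has_derivative (\<lambda>h. f' h \<bullet> b)) (at a within S)"
    using assms by (simp add: inner_axis)
qed

text \<open>As \<open>X $ i\<close> is orthogonal to \<open>v $ i\<close>, the moved row has squared
  length 1 + t^2 |X_i|^2, so the normalising factor is stationary at t = 0.\<close>

lemma chart_curve_derivative:
  assumes v: "v \<in> W_pos" and X: "X \<in> tangent_frames v"
  shows "((\<lambda>t. chart v (t *\<^sub>R X)) has_derivative (\<lambda>t. t *\<^sub>R X)) (at 0)"
proof (rule matrix_has_derivative)
  fix i k
  have o: "X $ i \<bullet> v $ i = 0" "v $ i \<bullet> X $ i = 0" using X by (simp_all add: tangent_frames_def inner_commute)
  let ?c = "X $ i \<bullet> X $ i"
  have e: "chart v (t *\<^sub>R X) $ i $ k = (1 + t\<^sup>2 * ?c) powr (- 1 / 2) * (v $ i $ k + t * X $ i $ k)" for t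
    unfolding chart_def
    by (simp add: inner_add_left inner_add_right o W_pos_inner_self[OF v] power2_eq_square mult_ac)
  have p: "((\<lambda>t. (1 + t\<^sup>2 * ?c) powr (- 1 / 2)) has_real_derivative 0) (at 0)"
    by (auto intro!: derivative_eq_intros)
  have "((\<lambda>t. (1 + t\<^sup>2 * ?c) powr (- 1 / 2) * (v $ i $ k + t * X $ i $ k)) has_real_derivative X $ i $ k) (at 0)"
    by (rule DERIV_cong[OF DERIV_mult[OF p]]) (auto intro!: derivative_eq_intros)
  then show "((\<lambda>t. chart v (t *\<^sub>R X) $ i $ k) has_derivative (\<lambda>t. (t *\<^sub>R X) $ i $ k)) (at 0)"
    unfolding e has_field_derivative_def
    by (rule has_derivative_eq_rhs) (simp add: fun_eq_iff)
qed

lemma smooth_on_differentiable: "smooth_on U f \<Longrightarrow> x \<in> U \<Longrightarrow> f differentiable (at x)"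
  unfolding smooth_on_def by (drule spec[of _ "Suc 0"]) simp

lemma smooth_on_continuous_derivative: "smooth_on U f \<Longrightarrow> continuous_on U (\<lambda>x. frechet_derivative f (at x) Y)"
  unfolding smooth_on_def by (drule spec[of _ "Suc 0"]) simp

lemma frechet_derivative_chart:
  assumes v: "v \<in> W_pos" and X: "X \<in> tangent_frames v"
  shows "frechet_derivative (chart v) (at 0) X = X"
proof -
  have D: "(chart v has_derivative frechet_derivative (chart v) (at 0)) (at 0)"
    using smooth_on_differentiable[OF smooth_on_chart zero_in_chart_domain[OF v]]
    by (simp add: frechet_derivative_works)
  have "((\<lambda>t. t *\<^sub>R X) has_derivative (\<lambda>t. t *\<^sub>R X)) (at (0::real))"
    by (auto intro!: derivative_eq_intros)
  from has_derivative_compose[OF this, of "chart v"] D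
  have "((\<lambda>t. chart v (t *\<^sub>R X)) has_derivative (\<lambda>t. frechet_derivative (chart v) (at 0) (t *\<^sub>R X))) (at 0)"
    by simp
  from fun_cong[OF has_derivative_unique[OF this chart_curve_derivative[OF v X]], of 1] show ?thesis
    by simp
qed

text \<open>\<open>nondegenerate_at\<close> supplies a parametrization about which nothing else is
  known, so its differential must be shown to reach every tangent vector. The chart curve with
  velocity \<open>Z\<close> is pulled back by the local inverse \<open>\<rho>\<close>, and the
  velocity of the pulled back curve is the preimage.\<close>

lemma tangent_in_parametrization_image:
  assumes par: "local_parametrization W_pos S U \<phi>" and u: "u \<in> U \<inter> S" and \<phi>u: "\<phi> u \<in> W_pos"
    and Z: "Z \<in> tangent_frames (\<phi> u)"
  shows "\<exists>X\<in>S. frechet_derivative \<phi> (at u) X = Z"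
proof -
  obtain V \<rho> where S: "subspace S" and U: "open U" and sm: "smooth_on U \<phi>" and V: "open V" "smooth_on V \<rho>"
    and im: "\<phi> ` (U \<inter> S) = W_pos \<inter> V" and inv: "\<And>u. u \<in> U \<inter> S \<Longrightarrow> \<rho> (\<phi> u) = u"
    using par unfolding local_parametrization_def by blast
  let ?\<gamma> = "\<lambda>t. chart (\<phi> u) (t *\<^sub>R Z)"
  define \<sigma> where "\<sigma> t = \<rho> (?\<gamma> t)" for t
  have \<gamma>0: "?\<gamma> 0 = \<phi> u" using chart_zero[OF \<phi>u] by simp
  have \<gamma>: "(?\<gamma> has_derivative (\<lambda>t. t *\<^sub>R Z)) (at 0)" by (rule chart_curve_derivative[OF \<phi>u Z])
  have "\<phi> u \<in> V" using u im by blast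
  then have \<rho>: "(\<rho> has_derivative frechet_derivative \<rho> (at (\<phi> u))) (at (\<phi> u))"
    using smooth_on_differentiable[OF V(2)] by (simp add: frechet_derivative_works)
  have \<phi>: "(\<phi> has_derivative frechet_derivative \<phi> (at u)) (at u)"
    using smooth_on_differentiable[OF sm] u by (simp add: frechet_derivative_works)
  define X where "X = frechet_derivative \<rho> (at (\<phi> u)) Z"
  have \<sigma>0: "\<sigma> 0 = u" using inv[OF u] unfolding \<sigma>_def \<gamma>0 .
  have \<sigma>: "(\<sigma> has_derivative (\<lambda>t. t *\<^sub>R X)) (at 0)"
    unfolding \<sigma>_def X_def
    by (rule has_derivative_eq_rhs[OF has_derivative_compose[OF \<gamma>, of \<rho>, unfolded \<gamma>0, OF \<rho>]])
      (simp only: linear_scale[OF has_derivative_linear[OF \<rho>]])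
  \<comment> \<open>Openness of \<open>V\<close> and of the chart domain keeps the curve in the
    image of \<open>\<phi>\<close> for small t; there \<open>\<rho>\<close> inverts
    \<open>\<phi>\<close> and has values in \<open>S\<close>.\<close>
  have ev: "eventually (\<lambda>t. \<sigma> t \<in> S \<and> \<phi> (\<sigma> t) = ?\<gamma> t) (nhds 0)"
  proof -
    have c: "(?\<gamma> \<longlongrightarrow> \<phi> u) (at 0)"
      using has_derivative_continuous[OF \<gamma>] \<gamma>0 by (simp add: isCont_def)
    have c2: "((\<lambda>t::real. t *\<^sub>R Z) \<longlongrightarrow> 0) (at 0)" by (auto intro!: tendsto_eq_intros)
    have "eventually (\<lambda>t. ?\<gamma> t \<in> V) (nhds 0)" "eventually (\<lambda>t. t *\<^sub>R Z \<in> chart_domain (\<phi> u)) (nhds 0)"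
      using topological_tendstoD[OF c V(1)] topological_tendstoD[OF c2 open_chart_domain] \<gamma>0 \<open>\<phi> u \<in> V\<close>
        zero_in_chart_domain[OF \<phi>u] by (auto simp: eventually_nhds_conv_at)
    then show ?thesis
    proof eventually_elim
      case (elim t)
      then have "?\<gamma> t \<in> W_pos \<inter> V" using chart_in_W_pos by blast
      then obtain y where "y \<in> U \<inter> S" "?\<gamma> t = \<phi> y" using im by (metis imageE)
      then show ?case unfolding \<sigma>_def using inv by auto
    qed
  qed
  have "frechet_derivative \<phi> (at u) X = Z"
  proof -
    have 1: "((\<lambda>t. \<phi> (\<sigma> t)) has_derivative (\<lambda>t. frechet_derivative \<phi> (at u) (t *\<^sub>R X))) (at 0)"
      using has_derivative_compose[OF \<sigma>, of \<phi>] \<phi> unfolding \<sigma>0 by simp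
    have 2: "((\<lambda>t. \<phi> (\<sigma> t)) has_derivative (\<lambda>t. t *\<^sub>R Z)) (at 0)"
    proof (rule has_derivative_transform_eventually[OF \<gamma>])
      show "eventually (\<lambda>t. ?\<gamma> t = \<phi> (\<sigma> t)) (at 0)"
        using ev[unfolded eventually_nhds_conv_at, THEN conjunct1] by eventually_elim (elim conjE, rule sym)
      show "?\<gamma> 0 = \<phi> (\<sigma> 0)" unfolding \<sigma>0 \<gamma>0 ..
    qed simp
    from fun_cong[OF has_derivative_unique[OF 1 2], of 1] show ?thesis by simp
  qed
  \<comment> \<open>The difference quotients of the curve lie in \<open>S\<close>, and a subspace of
    finite dimension is closed.\<close>
  moreover have "X \<in> S"
  proof (rule Lim_in_closed_set[OF closed_subspace[OF S]])
    have "((\<lambda>h. norm (\<sigma> h - u - h *\<^sub>R X) / norm h) \<longlongrightarrow> 0) (at 0)"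
      using \<sigma> unfolding has_derivative_at add_0 \<sigma>0 by (rule conjunct2)
    moreover have "eventually (\<lambda>h. norm (\<sigma> h - u - h *\<^sub>R X) / norm h = norm (inverse h *\<^sub>R (\<sigma> h - u) - X)) (at 0)"
      unfolding eventually_at_filter
    proof (intro always_eventually allI impI)
      fix h :: real assume "h \<noteq> 0"
      then have "inverse h *\<^sub>R (\<sigma> h - u) - X = inverse h *\<^sub>R (\<sigma> h - u - h *\<^sub>R X)"
        by (simp add: scaleR_diff_right)
      then show "norm (\<sigma> h - u - h *\<^sub>R X) / norm h = norm (inverse h *\<^sub>R (\<sigma> h - u) - X)"
        by (simp add: divide_inverse)
    qed
    ultimately have "((\<lambda>h. norm (inverse h *\<^sub>R (\<sigma> h - u) - X)) \<longlongrightarrow> 0) (at 0)"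
      by (rule Lim_transform_eventually)
    then show "((\<lambda>h. inverse h *\<^sub>R (\<sigma> h - u)) \<longlongrightarrow> X) (at 0)"
      by (rule LIM_zero_cancel[OF tendsto_norm_zero_cancel])
    have uS: "u \<in> S" using u by simp
    have "eventually (\<lambda>t. \<sigma> t \<in> S \<and> \<phi> (\<sigma> t) = ?\<gamma> t) (at 0)"
      using ev unfolding eventually_nhds_conv_at by (rule conjunct1)
    then show "eventually (\<lambda>t. inverse t *\<^sub>R (\<sigma> t - u) \<in> S) (at 0)"
      by eventually_elim (intro subspace_scale[OF S] subspace_diff[OF S] uS, elim conjE)
  qed simp
  ultimately show ?thesis by blast
qed

section \<open>Morse functions and nondegenerate frames\<close>

context
  fixes m :: nat and P :: "('n::finite \<Rightarrow> nat) \<Rightarrow> real"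
  assumes m: "m > 0" and pos: "positive_form m P"
begin

lemma test_vector_tangent:
  assumes "v \<in> W_pos"
  shows "(\<chi> k. if k = i then v $ j - (v $ j \<bullet> v $ i) *\<^sub>R v $ i else 0) \<in> tangent_frames v"
  using W_pos_inner_self[OF assms] by (auto simp: tangent_frames_def inner_diff_left)

lemma test_vector_weight_nonzero:
  assumes "v \<in> W_pos"
  shows "g_fun m P v / (2 * real m * hom_eval (2 * m) P (v $ i)) \<noteq> 0"
proof -
  have "det v > 0" using assms by (simp add: W_pos_def)
  then show ?thesis
    using g_fun_pos[OF m pos, of v] row_value_pos[OF m pos, of v i] m by simp
qed

lemma g_derivative_zero:
  assumes "\<And>i j. i \<noteq> j \<Longrightarrow> polar m P v i j = 0"
  shows "g_derivative m P v Z = 0"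
proof -
  have "polar m P v i j * off_weight m P v Z i j = 0" for i j
    using assms by (cases "i = j") (auto simp: off_weight_def)
  then show ?thesis by (simp only: g_derivative_def sum.neutral_const)
qed

text \<open>In the projection chart the test vectors isolate one off-diagonal entry at a time.
  Conversely, if these entries vanish, the ambient derivative of \<open>g_fun\<close> at
  \<open>v\<close> is zero, which settles all parametrizations at once.\<close>

lemma critical_point_iff:
  "critical_point W_pos (g_fun m P) v \<longleftrightarrow> v \<in> W_pos \<and> (\<forall>i j. i \<noteq> j \<longrightarrow> polar m P v i j = 0)"
proof safe
  assume crit: "critical_point W_pos (g_fun m P) v"
  then show v: "v \<in> W_pos" by (simp add: critical_point_def)
  then have det: "det v > 0" by (simp add: W_pos_def)
  have D: "(g_fun m P \<circ> chart v has_derivative (\<lambda>_. 0)) (at 0 within tangent_frames v)"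
  proof -
    have "0 \<in> chart_domain v \<inter> tangent_frames v"
      using zero_in_chart_domain[OF v] subspace_0[OF subspace_tangent_frames] by blast
    then show ?thesis
      using crit local_parametrization_chart[OF v] chart_zero[OF v] unfolding critical_point_def by blast
  qed
  have zero: "g_derivative m P v X = 0" if X: "X \<in> tangent_frames v" for X
  proof -
    have l: "((\<lambda>t. t *\<^sub>R X) has_derivative (\<lambda>t. t *\<^sub>R X)) (at (0::real))"
      by (auto intro!: derivative_eq_intros)
    have "range (\<lambda>t. t *\<^sub>R X) \<subseteq> tangent_frames v"
      using subspace_scale[OF subspace_tangent_frames X] by blast
    then have "(g_fun m P \<circ> chart v has_derivative (\<lambda>_. 0)) (at (0 *\<^sub>R X) within range (\<lambda>t. t *\<^sub>R X))"
      using has_derivative_subset[OF D] by simp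
    from has_derivative_in_compose[OF l this]
    have 1: "((\<lambda>t. g_fun m P (chart v (t *\<^sub>R X))) has_derivative (\<lambda>t. 0)) (at 0)"
      by simp
    have "(g_fun m P has_derivative g_derivative m P v) (at (chart v (0 *\<^sub>R X)))"
      using g_has_derivative[OF m pos det] chart_zero[OF v] by simp
    from has_derivative_compose[OF chart_curve_derivative[OF v X] this]
    have 2: "((\<lambda>t. g_fun m P (chart v (t *\<^sub>R X))) has_derivative (\<lambda>t. g_derivative m P v (t *\<^sub>R X))) (at 0)" .
    from fun_cong[OF has_derivative_unique[OF 1 2], of 1] show ?thesis by simp
  qed
  fix i j :: 'n assume ij: "i \<noteq> j"
  show "polar m P v i j = 0"
    using zero[OF test_vector_tangent[OF v, of i j]] off_weight_test_vector[OF m pos det ij, of "polar m P v"]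
      test_vector_weight_nonzero[OF v, of i] unfolding g_derivative_def by auto
next
  assume v: "v \<in> W_pos" and off: "\<forall>i j. i \<noteq> j \<longrightarrow> polar m P v i j = 0"
  then have det: "det v > 0" by (simp add: W_pos_def)
  have "g_derivative m P v = (\<lambda>_. 0)"
    using g_derivative_zero off by blast
  then have g: "(g_fun m P has_derivative (\<lambda>_. 0)) (at v)"
    using g_has_derivative[OF m pos det] by simp
  show "critical_point W_pos (g_fun m P) v"
    unfolding critical_point_def
  proof (intro conjI v allI impI; elim conjE)
    fix S U \<phi> u
    assume par: "local_parametrization W_pos S U \<phi>" and u: "u \<in> U \<inter> S" and \<phi>u: "\<phi> u = v"
    have "\<phi> differentiable (at u)"
      using par u smooth_on_differentiable unfolding local_parametrization_def by blast
    then have "(\<phi> has_derivative frechet_derivative \<phi> (at u)) (at u)"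
      by (simp add: frechet_derivative_works)
    from has_derivative_compose[OF this, of "g_fun m P"] g
    have "((\<lambda>x. g_fun m P (\<phi> x)) has_derivative (\<lambda>_. 0)) (at u)" by (simp add: \<phi>u)
    then show "(g_fun m P \<circ> \<phi> has_derivative (\<lambda>_. 0)) (at u within S)"
      unfolding comp_def by (rule has_derivative_at_withinI)
  qed
qed

text \<open>Given nondegeneracy in some unknown parametrization, a tangent \<open>Z\<close> in the
  kernel is lifted to \<open>S\<close>; all second partials of the lift vanish, so it is 0 and
  \<open>Z\<close> with it. For the converse the projection chart serves, where test vectors as
  \<open>Y\<close> recover every off-diagonal derivative.\<close>

lemma nondegenerate_at_iff:
  assumes v: "v \<in> W_pos" and off: "\<And>i j. i \<noteq> j \<Longrightarrow> polar m P v i j = 0"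
  shows "nondegenerate_at W_pos (g_fun m P) v \<longleftrightarrow> frame_nondegenerate m P v"
proof -
  have det: "det v > 0" and unit: "\<And>i. norm (v $ i) = 1" using v by (auto simp: W_pos_def)
  have sp: "second_partial (g_fun m P \<circ> \<phi>) u X Y =
    (\<Sum>i\<in>UNIV. \<Sum>j\<in>UNIV. dpolar m P v (frechet_derivative \<phi> (at u) X) i j *
       off_weight m P v (frechet_derivative \<phi> (at u) Y) i j)"
    if par: "local_parametrization W_pos S U \<phi>" "u \<in> U \<inter> S" "\<phi> u = v" for S U \<phi> u X Y
    using second_partial_g[OF m pos, of U u \<phi> Y X] par off det smooth_on_differentiable[of U \<phi>]
      smooth_on_continuous_derivative[of U \<phi>] unfolding local_parametrization_def by simp
  have "frame_nondegenerate m P v \<longleftrightarrow>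
      (\<forall>Z. (\<forall>i. Z $ i \<bullet> v $ i = 0) \<and> (\<forall>i j. i \<noteq> j \<longrightarrow> dpolar m P v Z i j = 0) \<longrightarrow> Z = 0)"
    by (rule frame_nondegenerate_iff_tangent[OF m unit off])
  then show ?thesis
  proof (elim ssubst, intro iffI)
    assume "nondegenerate_at W_pos (g_fun m P) v"
    then obtain S U \<phi> u where par: "local_parametrization W_pos S U \<phi>" "u \<in> U \<inter> S" "\<phi> u = v"
      and nd: "\<And>X. X \<in> S \<Longrightarrow> (\<forall>Y\<in>S. second_partial (g_fun m P \<circ> \<phi>) u X Y = 0) \<Longrightarrow> X = 0"
      unfolding nondegenerate_at_def by blast
    show "\<forall>Z. (\<forall>i. Z $ i \<bullet> v $ i = 0) \<and> (\<forall>i j. i \<noteq> j \<longrightarrow> dpolar m P v Z i j = 0) \<longrightarrow> Z = 0"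
    proof (intro allI impI; elim conjE)
      fix Z assume T: "\<forall>i. Z $ i \<bullet> v $ i = 0" and Z: "\<forall>i j. i \<noteq> j \<longrightarrow> dpolar m P v Z i j = 0"
      have "Z \<in> tangent_frames (\<phi> u)" using T by (simp add: tangent_frames_def par(3))
      then obtain X where X: "X \<in> S" "frechet_derivative \<phi> (at u) X = Z"
        using tangent_in_parametrization_image[OF par(1,2)] v par(3) by blast
      have "dpolar m P v Z i j * off_weight m P v Y i j = 0" for i j Y
        using Z by (cases "i = j") (auto simp: off_weight_def)
      then have "second_partial (g_fun m P \<circ> \<phi>) u X Y = 0" for Y
        by (simp only: sp[OF par] X(2) sum.neutral_const)
      then have "X = 0" using nd[OF X(1)] by blast
      moreover have "linear (frechet_derivative \<phi> (at u))"
        using par smooth_on_differentiable[of U \<phi> u] linear_frechet_derivative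
        unfolding local_parametrization_def by blast
      ultimately show "Z = 0" using X(2) linear_0 by blast
    qed
  next
    assume nd: "\<forall>Z. (\<forall>i. Z $ i \<bullet> v $ i = 0) \<and> (\<forall>i j. i \<noteq> j \<longrightarrow> dpolar m P v Z i j = 0) \<longrightarrow> Z = 0"
    have u: "0 \<in> chart_domain v \<inter> tangent_frames v"
      using zero_in_chart_domain[OF v] subspace_0[OF subspace_tangent_frames] by blast
    have "X = 0" if X: "X \<in> tangent_frames v"
      and 0: "\<forall>Y\<in>tangent_frames v. second_partial (g_fun m P \<circ> chart v) 0 X Y = 0" for X
    proof -
      have "dpolar m P v X i j = 0" if ij: "i \<noteq> j" for i j
      proof -
        let ?Y = "(\<chi> k. if k = i then v $ j - (v $ j \<bullet> v $ i) *\<^sub>R v $ i else 0)"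
        have Y: "?Y \<in> tangent_frames v" by (rule test_vector_tangent[OF v])
        have "(\<Sum>k\<in>UNIV. \<Sum>l\<in>UNIV. dpolar m P v X k l * off_weight m P v ?Y k l) = 0"
          using 0[rule_format, OF Y] sp[OF local_parametrization_chart[OF v] u chart_zero[OF v], of X ?Y]
          by (simp only: frechet_derivative_chart[OF v X] frechet_derivative_chart[OF v Y])
        then show ?thesis
          using off_weight_test_vector[OF m pos det ij, of "dpolar m P v X"]
            test_vector_weight_nonzero[OF v, of i] by auto
      qed
      then show ?thesis using nd X unfolding tangent_frames_def by blast
    qed
    then show "nondegenerate_at W_pos (g_fun m P) v"
      unfolding nondegenerate_at_def using local_parametrization_chart[OF v] u chart_zero[OF v] by blast
  qed
qed

theorem morse_iff_good_polynomial: "morse_on W_pos (g_fun m P) \<longleftrightarrow> good_polynomial m P"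
proof -
  have "morse_on W_pos (g_fun m P) \<longleftrightarrow>
    (\<forall>v\<in>W_pos. (\<forall>i j. i \<noteq> j \<longrightarrow> polar m P v i j = 0) \<longrightarrow> nondegenerate_at W_pos (g_fun m P) v)"
    unfolding morse_on_def critical_point_iff by (simp only: imp_conjL Ball_def)
  also have "\<dots> \<longleftrightarrow> (\<forall>v\<in>W_pos. (\<forall>i j. i \<noteq> j \<longrightarrow> polar m P v i j = 0) \<longrightarrow> frame_nondegenerate m P v)"
    by (intro ball_cong imp_cong refl nondegenerate_at_iff) auto
  also have "\<dots> \<longleftrightarrow> good_polynomial m P"
    by (rule good_polynomial_iff[OF m, symmetric]) (use pos in \<open>simp add: positive_form_def\<close>)
  finally show ?thesis .
qed

end

section \<open>Sard's theorem in matrix spaces\<close>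

lemma open_linear_bij_image:
  assumes "linear g" "\<And>x. g (f x) = x" "\<And>y. f (g y) = y" "open (B :: 'a::euclidean_space set)"
  shows "open (f ` B :: 'b::euclidean_space set)"
proof -
  have "f ` B = g -` B" by (auto simp: assms(2) image_iff) (metis assms(3))
  moreover have "continuous_on UNIV g" using assms(1) by (simp add: linear_continuous_on linear_conv_bounded_linear)
  ultimately show ?thesis using assms(4) continuous_on_open_vimage[of UNIV g] by auto
qed

text \<open>A linear isometry carries the problem to vectors indexed by \<open>'k\<close>. A kernel
  vector lowers the rank, so the image of \<open>S\<close> becomes negligible, whereas a nonempty
  open set is not.\<close>

lemma sard_equidimensional:
  fixes f :: "'a::euclidean_space \<Rightarrow> 'a"
  assumes card: "CARD('k::{finite,wellorder}) = DIM('a)"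
    and der: "\<And>x. x \<in> S \<Longrightarrow> (f has_derivative f' x) (at x within S)"
    and sing: "\<And>x. x \<in> S \<Longrightarrow> \<exists>h. h \<noteq> 0 \<and> f' x h = 0"
    and B: "open B" "B \<noteq> {}"
  shows "\<not> B \<subseteq> f ` S"
proof
  assume sub: "B \<subseteq> f ` S"
  have "DIM('a) = DIM((real, 'k) vec)" using card by simp
  then obtain e :: "'a \<Rightarrow> (real, 'k) vec" and d where "linear e" "linear d"
    "\<And>x. norm (e x) = norm x" "\<And>y. norm (d y) = norm y" "\<And>x. d (e x) = x" "\<And>y. e (d y) = y"
    by (rule isomorphisms_UNIV_UNIV) (rule that)
  then have ed: "linear e" "linear d" "\<And>x. d (e x) = x" "\<And>y. e (d y) = y" by simp_all
  let ?F = "\<lambda>y. e (f (d y))" and ?F' = "\<lambda>y h. e (f' (d y) (d h))"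
  have "negligible (?F ` e ` S)"
  proof (rule baby_Sard)
    fix y assume "y \<in> e ` S"
    then obtain x where x: "x \<in> S" "y = e x" by blast
    have dS: "d ` e ` S = S" using ed(3) by (simp add: image_image)
    have "(d has_derivative d) (at y within e ` S)"
      using ed(2) by (simp add: linear_imp_has_derivative)
    moreover have "(f has_derivative f' x) (at (d y) within d ` e ` S)"
      using der[OF x(1)] x(2) ed(3) dS by simp
    ultimately have "((\<lambda>y. f (d y)) has_derivative (\<lambda>h. f' x (d h))) (at y within e ` S)"
      by (rule has_derivative_in_compose)
    moreover have "(e has_derivative e) (at (f (d y)))"
      using ed(1) by (simp add: linear_imp_has_derivative)
    ultimately have "(?F has_derivative (\<lambda>h. e (f' x (d h)))) (at y within e ` S)"
      by (rule has_derivative_compose)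
    then show D: "(?F has_derivative ?F' y) (at y within e ` S)" using x ed(3) by simp
    obtain h where h: "h \<noteq> 0" "f' x h = 0" using sing[OF x(1)] by blast
    have "linear (?F' y)" using D by (rule has_derivative_linear)
    then have "matrix (?F' y) *v e h = 0"
      using h(2) x ed by (simp add: matrix_works linear_0)
    moreover have "e h \<noteq> 0" using h(1) ed by (metis linear_0)
    ultimately have "\<not> inj ((*v) (matrix (?F' y)))"
      by (metis injD matrix_vector_mult_0_right)
    then show "rank (matrix (?F' y)) < CARD('k)" by (simp add: less_rank_noninjective)
  qed simp
  moreover have "e ` B \<subseteq> ?F ` e ` S" using sub ed(3) by (simp add: image_image) blast
  ultimately have "negligible (e ` B)" by (rule negligible_subset)
  moreover have "open (e ` B)" using open_linear_bij_image[OF ed(2,3,4) B(1)] .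
  ultimately show False using open_not_negligible B(2) by blast
qed

lemma has_derivative_map_prod:
  assumes "(f has_derivative f') (at x within S)"
  shows "((\<lambda>(x, y). (f x, y)) has_derivative (\<lambda>(h, k). (f' h, k))) (at (x, y) within S \<times> T)"
proof -
  have "(fst has_derivative fst) (at (x, y) within S \<times> T)"
    by (intro bounded_linear_imp_has_derivative bounded_linear_fst)
  moreover have "(f has_derivative f') (at (fst (x, y)) within fst ` (S \<times> T))"
    by (rule has_derivative_subset[of _ _ _ S]) (use assms in auto)
  ultimately have "((\<lambda>z. f (fst z)) has_derivative (\<lambda>z. f' (fst z))) (at (x, y) within S \<times> T)"
    by (rule has_derivative_in_compose)
  moreover have "(snd has_derivative snd) (at (x, y) within S \<times> T)"
    by (intro bounded_linear_imp_has_derivative bounded_linear_snd)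
  ultimately show ?thesis
    unfolding case_prod_beta by (rule has_derivative_Pair)
qed

text \<open>The library states Sard's theorem for well-ordered index types only. As no order is
  available on \<open>'n\<close>, the identity on a second copy of the space is added: the resulting map lives
  in dimension \<open>CARD(('n \<times> 'n) bit0)\<close>, and \<open>bit0\<close> types are well-ordered.\<close>

theorem sard_matrix_space:
  fixes f :: "real^'n^'n::finite \<Rightarrow> real^'n^'n"
  assumes der: "\<And>x. x \<in> S \<Longrightarrow> (f has_derivative f' x) (at x within S)"
    and sing: "\<And>x. x \<in> S \<Longrightarrow> \<exists>h. h \<noteq> 0 \<and> f' x h = 0"
    and B: "open B" "B \<noteq> {}"
  shows "\<exists>b\<in>B. b \<notin> f ` S"
proof -
  let ?F = "\<lambda>(x :: real^'n^'n, y :: real^'n^'n). (f x, y)"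
  have "\<not> B \<times> UNIV \<subseteq> ?F ` (S \<times> UNIV)"
  proof (rule sard_equidimensional[where 'k = "('n \<times> 'n) bit0" and f' = "\<lambda>(x, y) (h, k). (f' x h, k)"])
    show "CARD(('n \<times> 'n) bit0) = DIM((real^'n^'n) \<times> (real^'n^'n))" by simp
    fix z :: "(real^'n^'n) \<times> (real^'n^'n)" assume "z \<in> S \<times> UNIV"
    then obtain x y where z: "z = (x, y)" "x \<in> S" by auto
    show "(?F has_derivative (\<lambda>(x, y) (h, k). (f' x h, k)) z) (at z within S \<times> UNIV)"
      using has_derivative_map_prod[OF der[OF z(2)]] by (simp add: z)
    obtain h where "h \<noteq> 0" "f' x h = 0" using sing[OF z(2)] by blast
    then show "\<exists>h. h \<noteq> 0 \<and> (\<lambda>(x, y) (h, k). (f' x h, k)) z h = 0"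
      by (intro exI[of _ "(h, 0)"]) (simp add: z zero_prod_def)
  qed (use B in \<open>auto intro: open_Times\<close>)
  moreover have "B \<times> UNIV \<subseteq> ?F ` (S \<times> UNIV)" if sub: "\<forall>b\<in>B. b \<in> f ` S"
  proof clarify
    fix b y assume "b \<in> B"
    then obtain x where "x \<in> S" "b = f x" using sub by blast
    then show "(b, y) \<in> ?F ` (S \<times> UNIV)" by (intro image_eqI[of _ _ "(x, y)"]) auto
  qed
  ultimately show ?thesis by blast
qed

subsection \<open>A tube lemma\<close>

text \<open>Finitely many product neighbourhoods cover {x} x C, and their first factors intersect in
  a neighbourhood of x. This makes open conditions on forms or frames uniform over compact sets of
  frames and directions.\<close>

lemma compact_tube:
  assumes C: "compact C"
    and loc: "\<And>y. y \<in> C \<Longrightarrow> \<exists>W. open W \<and> (x, y) \<in> W \<and> (\<forall>(a, b)\<in>W. R a b)"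
  shows "\<exists>A. open A \<and> x \<in> A \<and> (\<forall>a\<in>A. \<forall>b\<in>C. R a b)"
proof -
  have "\<forall>y\<in>C. \<exists>A B. open A \<and> open B \<and> x \<in> A \<and> y \<in> B \<and> (\<forall>a\<in>A. \<forall>b\<in>B. R a b)"
  proof
    fix y assume "y \<in> C"
    then obtain W where W: "open W" "(x, y) \<in> W" "\<forall>(a, b)\<in>W. R a b" using loc by blast
    obtain A B where "open A" "open B" "(x, y) \<in> A \<times> B" "A \<times> B \<subseteq> W"
      using open_prod_elim[OF W(1,2)] by blast
    then show "\<exists>A B. open A \<and> open B \<and> x \<in> A \<and> y \<in> B \<and> (\<forall>a\<in>A. \<forall>b\<in>B. R a b)"
      using W(3) by (intro exI[of _ A] exI[of _ B]) auto
  qed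
  from bchoice[OF this] obtain A where
    "\<forall>y\<in>C. \<exists>B. open (A y) \<and> open B \<and> x \<in> A y \<and> y \<in> B \<and> (\<forall>a\<in>A y. \<forall>b\<in>B. R a b)" by (elim exE)
  from bchoice[OF this] obtain B where
    "\<forall>y\<in>C. open (A y) \<and> open (B y) \<and> x \<in> A y \<and> y \<in> B y \<and> (\<forall>a\<in>A y. \<forall>b\<in>B y. R a b)" by (elim exE)
  then have AB: "\<And>y. y \<in> C \<Longrightarrow> open (A y)" "\<And>y. y \<in> C \<Longrightarrow> open (B y)" "\<And>y. y \<in> C \<Longrightarrow> x \<in> A y"
      "\<And>y. y \<in> C \<Longrightarrow> y \<in> B y" "\<And>y a b. y \<in> C \<Longrightarrow> a \<in> A y \<Longrightarrow> b \<in> B y \<Longrightarrow> R a b" by auto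
  obtain D where D: "D \<subseteq> C" "finite D" "C \<subseteq> (\<Union>y\<in>D. B y)"
    using compactE_image[OF C, of C B] AB(2,4) by blast
  show ?thesis
    by (intro exI[of _ "\<Inter>y\<in>D. A y"]) (use D AB in \<open>auto intro!: open_INT; blast\<close>)
qed

section \<open>Local transversality\<close>

text \<open>Gives the polar entries of a form that is known only as a function, without its
  coefficients.\<close>

lemma polar_eq_directional_derivative:
  assumes "m > 0" "((\<lambda>t. hom_eval (2 * m) P (w $ i + t *\<^sub>R w $ j)) has_real_derivative D) (at 0)"
  shows "polar m P w i j = D"
proof -
  have l: "((\<lambda>t. w $ i + t *\<^sub>R w $ j) has_derivative (\<lambda>t. t *\<^sub>R w $ j)) (at (0::real))"
    by (auto intro!: derivative_eq_intros)
  have "(hom_eval (2 * m) P has_derivative (\<lambda>h. \<Sum>k\<in>UNIV. pd m P k (w $ i) * h $ k)) (at (w $ i + 0 *\<^sub>R w $ j))"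
    using hom_eval_derivative_pd[OF assms(1), of P "w $ i"] by simp
  from has_derivative_compose[OF l this]
  have "((\<lambda>t. hom_eval (2 * m) P (w $ i + t *\<^sub>R w $ j)) has_real_derivative polar m P w i j) (at 0)"
    by (rule has_derivative_imp_has_field_derivative) (simp add: polar_def sum_distrib_left mult_ac)
  then show ?thesis using assms(2) by (rule DERIV_unique)
qed

text \<open>For the basis \<open>\<ell>\<^sub>k\<close> dual to the rows of \<open>w\<close>, the polynomials \<open>\<ell>\<^sub>k\<^sup>2\<^sup>m\<^sup>-\<^sup>1 \<ell>\<^sub>l\<close>
  move the entries of the polar matrix at \<open>w\<close> independently.\<close>

lemma exists_test_polynomials:
  fixes w :: "real^'n^'n::finite"
  assumes m: "m > 1" and det: "det w \<noteq> 0"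
  shows "\<exists>Q. \<forall>k l. Q k l \<in> hom_polys (2 * m) \<and>
    (\<forall>i j. polar m (Q k l) w i j = (if k = i \<and> l = j then if i = j then 2 * real m else 1 else 0))"
proof -
  obtain B where B: "w ** B = mat 1"
    using det unfolding invertible_det_nz[symmetric] invertible_def by auto
  \<comment> \<open>The columns of the inverse matrix, which form the basis dual to the rows of
    \<open>w\<close>.\<close>
  define a where "a k = (\<chi> l. B $ l $ k)" for k
  have dual: "a k \<bullet> w $ i = (if k = i then 1 else 0)" for i k
  proof -
    have "a k \<bullet> w $ i = (w ** B) $ i $ k"
      by (simp add: a_def inner_vec_def matrix_matrix_mult_def mult.commute)
    then show ?thesis unfolding B by (auto simp: mat_def)
  qed
  have "\<exists>Q. Q \<in> hom_polys (2 * m) \<and>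
    (\<forall>i j. polar m Q w i j = (if k = i \<and> l = j then if i = j then 2 * real m else 1 else 0))" for k l
  proof -
    have "hom_poly_fun (Suc 0) (\<lambda>x. (a l \<bullet> x) * 1)"
      by (rule hom_poly_fun_times_linear[OF hom_poly_fun_one])
    from hom_poly_fun_linear_power[OF this, of "2 * m - 1" "a k"]
    have "hom_poly_fun (2 * m) (\<lambda>x. (a k \<bullet> x) ^ (2 * m - 1) * (a l \<bullet> x))" using m by simp
    then obtain Q where Q: "Q \<in> hom_polys (2 * m)"
      "\<And>x. hom_eval (2 * m) Q x = (a k \<bullet> x) ^ (2 * m - 1) * (a l \<bullet> x)"
      unfolding hom_poly_fun_def by metis
    have "polar m Q w i j = (if k = i \<and> l = j then if i = j then 2 * real m else 1 else 0)" for i j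
    proof (rule polar_eq_directional_derivative)
      let ?d = "\<lambda>i j :: 'n. if i = j then 1 else (0 :: real)"
      \<comment> \<open>\<open>m > 1\<close> is essential here: for \<open>k = j\<close>,
        \<open>l = i\<close> and \<open>i \<noteq> j\<close> the value is t^(2m - 1), whose
        derivative at 0 vanishes only because 2m - 1 > 1. For m = 1 the entries (k,l) and (l,k)
        would be coupled.\<close>
      have e: "hom_eval (2 * m) Q (w $ i + t *\<^sub>R w $ j) = (?d k i + t * ?d k j) ^ (2 * m - 1) * (?d l i + t * ?d l j)" for t
        unfolding Q by (simp add: inner_add_right dual)
      show "((\<lambda>t. hom_eval (2 * m) Q (w $ i + t *\<^sub>R w $ j)) has_real_derivative
          (if k = i \<and> l = j then if i = j then 2 * real m else 1 else 0)) (at 0)"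
        unfolding e using m
        by (auto intro!: derivative_eq_intros simp: of_nat_diff)
    qed (use m in simp)
    then show ?thesis using Q(1) by blast
  qed
  then show ?thesis by metis
qed

section \<open>Families of perturbed forms and generic parameters\<close>

definition perturb :: "(('n \<Rightarrow> nat) \<Rightarrow> real) \<Rightarrow> ('n \<Rightarrow> 'n \<Rightarrow> ('n \<Rightarrow> nat) \<Rightarrow> real) \<Rightarrow>
    real^'n^'n \<Rightarrow> ('n::finite \<Rightarrow> nat) \<Rightarrow> real" where
  "perturb P Q a = (\<lambda>\<alpha>. P \<alpha> + (\<Sum>k\<in>UNIV. \<Sum>l\<in>UNIV. a $ k $ l * Q k l \<alpha>))"

lemma polar_perturb:
  "polar m (perturb P Q a) w i j = polar m P w i j + (\<Sum>k\<in>UNIV. \<Sum>l\<in>UNIV. a $ k $ l * polar m (Q k l) w i j)"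
  unfolding perturb_def by (simp add: polar_add polar_sum polar_cmult)

lemma dpolar_perturb:
  assumes "m > 0"
  shows "dpolar m (perturb P Q a) w Z i j =
    dpolar m P w Z i j + (\<Sum>k\<in>UNIV. \<Sum>l\<in>UNIV. a $ k $ l * dpolar m (Q k l) w Z i j)"
proof -
  have "((\<lambda>w. polar m (perturb P Q a) w i j) has_derivative (\<lambda>Z. dpolar m P w Z i j +
      (\<Sum>k\<in>UNIV. \<Sum>l\<in>UNIV. a $ k $ l * dpolar m (Q k l) w Z i j))) (at w)"
    unfolding polar_perturb
    by (intro has_derivative_add has_derivative_sum has_derivative_mult_right polar_has_derivative[OF assms])
  from fun_cong[OF has_derivative_unique[OF polar_has_derivative[OF assms] this]] show ?thesis .
qed

text \<open>\<open>w\<close> is a regular point of the map M_P if it solves the frame equation;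
  otherwise the condition is vacuous. With no sign condition on \<open>det\<close>, its failure is
  described by equations alone, which suits compactness arguments.\<close>

definition regular_at :: "nat \<Rightarrow> (('n::finite \<Rightarrow> nat) \<Rightarrow> real) \<Rightarrow> real^'n^'n \<Rightarrow> bool" where
  "regular_at m P w \<longleftrightarrow> (polar_frame m P w \<longrightarrow> (\<forall>Z. (\<forall>i j. dpolar m P w Z i j = 0) \<longrightarrow> Z = 0))"

lemma linear_in_parameter: "linear (\<lambda>a :: real^'n^'n::finite. (\<chi> i j. \<Sum>k\<in>UNIV. \<Sum>l\<in>UNIV. a $ k $ l * q k l i j) :: real^'n^'n)"
  by (rule linearI) (simp_all add: vec_eq_iff algebra_simps sum.distrib sum_distrib_left)

text \<open>A parameter \<open>a\<close> changes the polar matrix by a linear map \<open>A w\<close>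
  that does not involve P and is injective at \<open>w0\<close>, hence on a neighbourhood
  \<open>N\<close>. Therefore \<open>N\<close> and \<open>Q\<close> depend neither on P nor on
  \<epsilon>, and the same \<open>N\<close> serves while the form keeps changing.\<close>

lemma local_transversality:
  fixes w0 :: "real^'n^'n::finite"
  assumes m: "m > 1" and det: "det w0 \<noteq> 0"
  obtains N Q where "open N" "w0 \<in> N" "\<And>k l. Q k l \<in> hom_polys (2 * m)"
    "\<And>P \<epsilon>. \<epsilon> > 0 \<Longrightarrow> \<exists>a. norm a < \<epsilon> \<and> (\<forall>w\<in>N. regular_at m (perturb P Q a) w)"
proof -
  have m0: "m > 0" using m by simp
  obtain Q where Q: "\<And>k l. Q k l \<in> hom_polys (2 * m)"
    and pQ: "\<And>k l i j. polar m (Q k l) w0 i j = (if k = i \<and> l = j then if i = j then 2 * real m else 1 else 0)"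
    using exists_test_polynomials[OF m det] by metis
  define A where "A w a = ((\<chi> i j. \<Sum>k\<in>UNIV. \<Sum>l\<in>UNIV. a $ k $ l * polar m (Q k l) w i j) :: real^'n^'n)"
    for w a :: "real^'n^'n"
  have linA: "linear (A w)" for w unfolding A_def by (rule linear_in_parameter)
  \<comment> \<open>At \<open>w0\<close> the map is diagonal: it multiplies the entries of
    \<open>a\<close> by 2m on the diagonal and by 1 elsewhere.\<close>
  have A0: "A w0 a \<noteq> 0" if "a \<noteq> 0" for a
  proof
    assume "A w0 a = 0"
    then have "(\<Sum>k\<in>UNIV. \<Sum>l\<in>UNIV. a $ k $ l * polar m (Q k l) w0 i j) = 0" for i j
      by (simp add: A_def vec_eq_iff)
    moreover have "a $ k $ l * polar m (Q k l) w0 i j =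
       (if l = j then if k = i then a $ i $ j * (if i = j then 2 * real m else 1) else 0 else 0)" for k l i j
      by (simp add: pQ)
    ultimately have e: "a $ i $ j * (if i = j then 2 * real m else 1) = 0" for i j by simp
    have "a $ i $ j = 0" for i j
      using e[of i j] m0 by (cases "i = j") auto
    then have "a = 0" by (simp add: vec_eq_iff)
    then show False using that by simp
  qed
  have "\<exists>N. open N \<and> w0 \<in> N \<and> (\<forall>w\<in>N. \<forall>a\<in>sphere 0 1. A w a \<noteq> 0)"
  proof (rule compact_tube)
    fix a :: "real^'n^'n" assume "a \<in> sphere 0 1"
    then have "a \<noteq> 0" by auto
    have "continuous_on UNIV (\<lambda>z. A (fst z) (snd z))"
      unfolding A_def by (intro continuous_intros)
    then have "open {z. A (fst z) (snd z) \<noteq> 0}" by (intro open_Collect_neq continuous_intros)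
    then show "\<exists>W. open W \<and> (w0, a) \<in> W \<and> (\<forall>(w, a)\<in>W. A w a \<noteq> 0)"
      using A0[OF \<open>a \<noteq> 0\<close>] by (intro exI[of _ "{z. A (fst z) (snd z) \<noteq> 0}"]) auto
  qed simp
  then obtain N where N: "open N" "w0 \<in> N" "\<And>w a. w \<in> N \<Longrightarrow> norm a = 1 \<Longrightarrow> A w a \<noteq> 0" by auto
  have inj: "a = 0" if "w \<in> N" "A w a = 0" for w a
  proof (rule ccontr)
    assume "a \<noteq> 0"
    then have "norm (inverse (norm a) *\<^sub>R a) = 1" by simp
    from N(3)[OF that(1) this] show False using linear_scale[OF linA] that(2) by simp
  qed
  have "\<exists>a. norm a < \<epsilon> \<and> (\<forall>w\<in>N. regular_at m (perturb P Q a) w)" if "\<epsilon> > 0" for P \<epsilon>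
  proof -
    define I where "I = ((\<chi> i j. if i = j then 2 * real m else 0) :: real^'n^'n)"
    define \<Phi> where "\<Phi> w a = ((\<chi> i j. polar m (perturb P Q a) w i j) :: real^'n^'n)" for w a
    define D\<Phi> where "D\<Phi> w a h = ((\<chi> i j. dpolar m (perturb P Q a) w h i j) :: real^'n^'n)" for w a h
    have frame: "polar_frame m (perturb P Q a) w \<longleftrightarrow> \<Phi> w a = I" for w a
      by (simp add: polar_frame_def \<Phi>_def I_def vec_eq_iff)
    \<comment> \<open>Carrying \<open>w\<close> along as first component reduces the implicit
      function for the parameter to an inverse of \<open>F\<close>.\<close>
    define F where "F z = (fst z, \<Phi> (fst z) (snd z))" for z
    define F' where "F' z v = (fst v, D\<Phi> (fst z) (snd z) (fst v) + A (fst z) (snd v))" for z v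
    have \<Phi>A: "\<Phi> w a = \<Phi> w b + A w (a - b)" for w a b
      by (simp add: \<Phi>_def A_def vec_eq_iff polar_perturb algebra_simps sum_subtractf)
    have der: "(F has_derivative F' z) (at z)" for z
    proof -
      have "((\<lambda>z. \<Phi> (fst z) (snd z)) has_derivative (\<lambda>v. D\<Phi> (fst z) (snd z) (fst v) + A (fst z) (snd v))) (at z)"
      proof (rule matrix_has_derivative)
        fix i j
        have p: "((\<lambda>z. polar m R (fst z) i j) has_derivative (\<lambda>v. dpolar m R (fst z) (fst v) i j)) (at z)" for R
          by (rule has_derivative_compose[OF bounded_linear_imp_has_derivative[OF bounded_linear_fst] polar_has_derivative[OF m0]])
        have s: "((\<lambda>z. snd z $ k $ l) has_derivative (\<lambda>v. snd v $ k $ l)) (at z)" for k l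
          by (intro bounded_linear_imp_has_derivative bounded_linear_compose[OF bounded_linear_nth_nth bounded_linear_snd])
        have "((\<lambda>z. polar m P (fst z) i j + (\<Sum>k\<in>UNIV. \<Sum>l\<in>UNIV. snd z $ k $ l * polar m (Q k l) (fst z) i j))
          has_derivative (\<lambda>v. dpolar m P (fst z) (fst v) i j + (\<Sum>k\<in>UNIV. \<Sum>l\<in>UNIV.
             snd z $ k $ l * dpolar m (Q k l) (fst z) (fst v) i j + snd v $ k $ l * polar m (Q k l) (fst z) i j))) (at z)"
          by (intro has_derivative_add has_derivative_sum has_derivative_mult p s)
        then show "((\<lambda>z. \<Phi> (fst z) (snd z) $ i $ j) has_derivative
           (\<lambda>v. (D\<Phi> (fst z) (snd z) (fst v) + A (fst z) (snd v)) $ i $ j)) (at z)"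
          by (simp add: \<Phi>_def D\<Phi>_def A_def polar_perturb dpolar_perturb[OF m0] sum.distrib add.assoc)
      qed
      then show ?thesis
        unfolding F_def F'_def
        by (intro has_derivative_Pair bounded_linear_imp_has_derivative bounded_linear_fst)
    qed
    define g where "g = inv_into (N \<times> UNIV) F"
    have "inj_on F (N \<times> UNIV)"
    proof (rule inj_onI)
      fix x y assume xy: "x \<in> N \<times> UNIV" "y \<in> N \<times> UNIV" "F x = F y"
      then have f: "fst x = fst y" and "\<Phi> (fst x) (snd x) = \<Phi> (fst x) (snd y)" by (auto simp: F_def)
      then have A0: "A (fst x) (snd x - snd y) = 0" using \<Phi>A[of "fst x" "snd x" "snd y"] by simp
      have "fst x \<in> N" using xy(1) by (simp add: mem_Times_iff)
      from inj[OF this A0] have "snd x - snd y = 0" .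
      then show "x = y" using f by (simp add: prod_eq_iff)
    qed
    then have g: "g (F z) = z" if "z \<in> N \<times> UNIV" for z
      unfolding g_def using that by (rule inv_into_f_f)
    define bad where "bad = {w \<in> N. \<exists>a. \<Phi> w a = I \<and> (\<exists>h. h \<noteq> 0 \<and> D\<Phi> w a h = 0)}"
    \<comment> \<open>The parameter for which \<open>w\<close> becomes a polar frame; only the
      values identified by \<open>fa\<close> are interpreted.\<close>
    define f where "f w = snd (g (w, I))" for w
    have fa: "f w = a" if "w \<in> N" "\<Phi> w a = I" for w a
      using g[of "(w, a)"] that by (simp add: F_def f_def)
    have crit: "(f has_derivative frechet_derivative f (at w)) (at w) \<and> (\<exists>h. h \<noteq> 0 \<and> frechet_derivative f (at w) h = 0)"
      if wbad: "w \<in> bad" for w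
    proof -
      obtain a h where w: "w \<in> N" "\<Phi> w a = I" "h \<noteq> 0" "D\<Phi> w a h = 0" using wbad unfolding bad_def by blast
      have linF: "linear (F' (w, a))" by (rule has_derivative_linear[OF der])
      have DL0: "D\<Phi> w a 0 = 0" by (simp add: D\<Phi>_def dpolar_def vec_eq_iff)
      have "F' (w, a) v = 0 \<Longrightarrow> v = 0" for v
        using inj[OF w(1), of "snd v"] DL0 by (auto simp: F'_def prod_eq_iff zero_prod_def)
      then have "inj (F' (w, a))" using linear_injective_0[OF linF] by blast
      then obtain G where G: "linear G" "\<And>x. G (F' (w, a) x) = x" "\<And>x. F' (w, a) (G x) = x"
        using linear_injective_isomorphism[OF linF] by blast
      have "(g has_derivative G) (at (F (w, a)))"
      proof (rule has_derivative_inverse_on[where S = "N \<times> UNIV" and f' = F' and g' = "\<lambda>_. G", OF _ der g])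
        show "open (N \<times> (UNIV :: (real^'n^'n) set))" using N(1) by (intro open_Times) auto
        show "F' (w, a) \<circ> G = id" using G(3) by auto
        show "(w, a) \<in> N \<times> UNIV" using w(1) by simp
      qed
      then have "(g has_derivative G) (at (w, I))" by (simp add: F_def w(2))
      moreover have "((\<lambda>w. (w, I)) has_derivative (\<lambda>h. (h, 0))) (at w)"
        by (intro has_derivative_Pair has_derivative_ident has_derivative_const)
      ultimately have "((\<lambda>w. g (w, I)) has_derivative (\<lambda>h. G (h, 0))) (at w)"
        using has_derivative_compose by blast
      then have fd: "(f has_derivative (\<lambda>h. snd (G (h, 0)))) (at w)"
        unfolding f_def by (rule has_derivative_snd)
      \<comment> \<open>Along a degenerate direction \<open>h\<close> the polar matrix is stationary
        at fixed \<open>a\<close>, so the solving parameter is stationary too. Degenerate frames are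
        thus critical points of \<open>f\<close>.\<close>
      have "F' (w, a) (h, 0) = (h, 0)"
        using w(4) linear_0[OF linA] by (simp add: F'_def)
      then have "snd (G (h, 0)) = 0" using G(2)[of "(h, 0)"] by simp
      then show ?thesis using fd w(3) frechet_derivative_at[OF fd] by metis
    qed
    have "\<exists>a\<in>ball 0 \<epsilon>. a \<notin> f ` bad"
      by (rule sard_matrix_space[where f' = "\<lambda>w. frechet_derivative f (at w)"])
        (use crit that in \<open>auto intro: has_derivative_at_withinI\<close>)
    then obtain a where a: "norm a < \<epsilon>" "a \<notin> f ` bad" by auto
    have "regular_at m (perturb P Q a) w" if "w \<in> N" for w
      unfolding regular_at_def frame
    proof (intro impI allI; rule ccontr)
      fix Z assume "\<Phi> w a = I" "\<forall>i j. dpolar m (perturb P Q a) w Z i j = 0" "Z \<noteq> 0"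
      then have "w \<in> bad" "f w = a" using that fa by (auto simp: bad_def D\<Phi>_def vec_eq_iff)
      then show False using a(2) by blast
    qed
    then show ?thesis using a(1) by blast
  qed
  then show thesis using that N(1,2) Q by blast
qed

section \<open>Positive forms and strictly convex bodies\<close>

lemma open_continuous_sublevel:
  fixes h :: "(('n::finite \<Rightarrow> nat) \<Rightarrow> real) \<Rightarrow> real"
  assumes "continuous_on UNIV h" "h P < c"
  shows "open {R. h R < c}" "P \<in> {R. h R < c}"
  using assms by (auto intro!: open_Collect_less continuous_intros)

text \<open>The minimum on the unit sphere is positive and controls all \<open>x\<close> by
  homogeneity. Having one constant for a whole neighbourhood confines the polar frames of all forms
  in it to a common bounded set.\<close>

lemma positive_form_lower_bound:
  fixes P :: "('n::finite \<Rightarrow> nat) \<Rightarrow> real"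
  assumes pos: "positive_form m P" and m: "m > 0"
  obtains A c where "open A" "P \<in> A" "c > 0" "\<And>R x. R \<in> A \<Longrightarrow> c * norm x ^ (2 * m) \<le> hom_eval (2 * m) R x"
proof -
  have cont: "continuous_on S (\<lambda>z. hom_eval (2 * m) (fst z) (snd z))"
    for S :: "((('n \<Rightarrow> nat) \<Rightarrow> real) \<times> (real^'n)) set"
    by (intro continuous_intros)
  have "continuous_on (sphere 0 1) (\<lambda>x. hom_eval (2 * m) P x)"
    by (intro continuous_intros)
  moreover have "sphere 0 1 \<noteq> ({} :: (real^'n) set)" by simp
  ultimately obtain x0 where x0: "x0 \<in> sphere 0 1" "\<And>y. y \<in> sphere 0 1 \<Longrightarrow> hom_eval (2 * m) P x0 \<le> hom_eval (2 * m) P y"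
    using continuous_attains_inf[OF compact_sphere, of 0 1 "\<lambda>x. hom_eval (2 * m) P x"] by metis
  \<comment> \<open>Half the minimum leaves a strict margin, an open condition that survives small
    changes of the form.\<close>
  define c where "c = hom_eval (2 * m) P x0 / 2"
  have "x0 \<noteq> 0" using x0(1) by auto
  then have "hom_eval (2 * m) P x0 > 0" using pos by (simp add: positive_form_def)
  then have c: "c > 0" "c < hom_eval (2 * m) P x0" by (simp_all add: c_def)
  have "\<exists>A. open A \<and> P \<in> A \<and> (\<forall>R\<in>A. \<forall>x\<in>sphere 0 1. c < hom_eval (2 * m) R x)"
  proof (rule compact_tube)
    fix y :: "real^'n" assume "y \<in> sphere 0 1"
    then show "\<exists>W. open W \<and> (P, y) \<in> W \<and> (\<forall>(a, b)\<in>W. c < hom_eval (2 * m) a b)"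
      using less_le_trans[OF c(2) x0(2)]
      by (intro exI[of _ "{z. c < hom_eval (2 * m) (fst z) (snd z)}"])
        (auto intro!: open_Collect_less cont continuous_intros)
  qed simp
  then obtain A where A: "open A" "P \<in> A" "\<And>R x. R \<in> A \<Longrightarrow> x \<in> sphere 0 1 \<Longrightarrow> c < hom_eval (2 * m) R x"
    by blast
  have "c * norm x ^ (2 * m) \<le> hom_eval (2 * m) R x" if "R \<in> A" for R x
  proof (cases "x = 0")
    case True
    then show ?thesis using hom_eval_scaleR[of "2 * m" R 0 0] m by (simp add: power_0_left)
  next
    case False
    define y where "y = inverse (norm x) *\<^sub>R x"
    have y: "y \<in> sphere 0 1" "x = norm x *\<^sub>R y" using False by (simp_all add: y_def)
    have "hom_eval (2 * m) R x = norm x ^ (2 * m) * hom_eval (2 * m) R y"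
      by (subst y(2)) (rule hom_eval_scaleR)
    moreover have "norm x ^ (2 * m) * c \<le> norm x ^ (2 * m) * hom_eval (2 * m) R y"
      using A(3)[OF that y(1)] by (intro mult_left_mono) auto
    ultimately show ?thesis by (simp add: mult.commute)
  qed
  then show thesis using that A(1,2) c(1) by blast
qed

text \<open>If P(x) <= 0 then P <= 0 on the whole line through x, since the degree is even; the
  sublevel set would be unbounded.\<close>

lemma U_set_positive_form:
  assumes P: "P \<in> U_set m" and m: "m > 0"
  shows "positive_form m P"
  unfolding positive_form_def
proof (intro allI impI, rule ccontr)
  fix x assume x: "x \<noteq> 0" and "\<not> hom_eval (2 * m) P x > 0"
  then have np: "hom_eval (2 * m) P x \<le> 0" by simp
  have "compact {v. hom_eval (2 * m) P v \<le> 1}"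
    using P by (simp add: U_set_def strictly_convex_body_def)
  then obtain K where "\<forall>v\<in>{v. hom_eval (2 * m) P v \<le> 1}. norm v \<le> K"
    using bounded_iff compact_imp_bounded by metis
  then have K: "hom_eval (2 * m) P v \<le> 1 \<Longrightarrow> norm v \<le> K" for v by simp
  define t where "t = (\<bar>K\<bar> + 1) / norm x"
  have "hom_eval (2 * m) P (t *\<^sub>R x) = (t ^ m)\<^sup>2 * hom_eval (2 * m) P x"
    by (simp only: hom_eval_scaleR power_even_eq)
  also have "\<dots> \<le> 0" by (rule mult_nonneg_nonpos[OF zero_le_power2 np])
  finally have "norm (t *\<^sub>R x) \<le> K" by (intro K) simp
  moreover have "norm (t *\<^sub>R x) = \<bar>K\<bar> + 1" using x by (simp add: t_def)
  ultimately show False by linarith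
qed

subsection \<open>Convexity\<close>

lemma convex_on_power_nonneg: "convex_on {0::real..} (\<lambda>x. x ^ n)"
proof (cases "even n")
  case True
  show ?thesis by (rule convex_on_subset[OF convex_power_even[OF True]]) auto
qed (rule convex_power_odd)

text \<open>The 2m-th root \<open>p\<close> of P is the Minkowski gauge of the body. Convexity of
  the body makes \<open>p\<close> subadditive, and P = p^(2m) is convex because the power is convex
  on nonnegative reals.\<close>

lemma convex_on_hom_eval_U_set:
  fixes P :: "('n::finite \<Rightarrow> nat) \<Rightarrow> real"
  assumes P: "P \<in> U_set m" and m: "m > 0"
  shows "convex_on UNIV (hom_eval (2 * m) P)"
proof (rule convex_onI)
  have pos: "positive_form m P" by (rule U_set_positive_form[OF assms])
  have cD: "convex {v. hom_eval (2 * m) P v \<le> 1}"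
    using P by (simp add: U_set_def strictly_convex_body_def)
  let ?f = "hom_eval (2 * m) P"
  have f0: "?f 0 = 0" using hom_eval_scaleR[of "2 * m" P 0 0] m by (simp add: power_0_left)
  have fnn: "?f x \<ge> 0" for x
    using pos f0 unfolding positive_form_def by (metis less_imp_le order_refl)
  define p where "p x = root (2 * m) (?f x)" for x
  have pnn: "p x \<ge> 0" for x using fnn[of x] by (simp add: p_def real_root_ge_zero)
  have pp: "p x ^ (2 * m) = ?f x" for x using fnn[of x] m by (simp add: p_def real_root_pow_pos2)
  have psc: "p (c *\<^sub>R x) = c * p x" if "c \<ge> 0" for c x
  proof (rule power_eq_imp_eq_base)
    show "p (c *\<^sub>R x) ^ (2 * m) = (c * p x) ^ (2 * m)"
      by (simp add: pp power_mult_distrib hom_eval_scaleR)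
  qed (use pnn that m in auto)
  have p0: "p x > 0" if "x \<noteq> 0" for x
    using pos that m by (simp add: p_def positive_form_def)
  have sub: "?f (x + y) \<le> (p x + p y) ^ (2 * m)" for x y
  proof (cases "x = 0 \<or> y = 0")
    case True
    then show ?thesis using pp[of x] pp[of y] f0 m by (auto simp: p_def)
  next
    case False
    then have pos: "p x > 0" "p y > 0" using p0 by auto
    have one: "inverse (p z) *\<^sub>R z \<in> {v. ?f v \<le> 1}" if "p z > 0" for z
    proof -
      have "?f (inverse (p z) *\<^sub>R z) = 1"
        unfolding hom_eval_scaleR pp[of z, symmetric] power_inverse using that by simp
      then show ?thesis by simp
    qed
    let ?s = "p x + p y"
    \<comment> \<open>The weights are chosen so that the normalised points x / p(x) and y / p(y)
      combine to (x + y) / (p(x) + p(y)).\<close>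
    have "(p x / ?s) *\<^sub>R (inverse (p x) *\<^sub>R x) + (p y / ?s) *\<^sub>R (inverse (p y) *\<^sub>R y) \<in> {v. ?f v \<le> 1}"
      using pos by (intro convexD[OF cD] one) (auto simp: add_divide_distrib[symmetric])
    also have "(p x / ?s) *\<^sub>R (inverse (p x) *\<^sub>R x) + (p y / ?s) *\<^sub>R (inverse (p y) *\<^sub>R y) = inverse ?s *\<^sub>R (x + y)"
    proof -
      have "p z / ?s * inverse (p z) = inverse ?s" if "p z > 0" for z using that by (simp add: field_simps)
      then show ?thesis using pos by (simp only: scaleR_scaleR scaleR_add_right)
    qed
    finally have "inverse (?s ^ (2 * m)) * ?f (x + y) \<le> 1"
      by (simp add: hom_eval_scaleR power_inverse)
    then show ?thesis using pos by (simp add: field_simps)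
  qed
  fix t :: real and x y :: "real^'n" assume t: "t > 0" "t < 1"
  have "?f ((1 - t) *\<^sub>R x + t *\<^sub>R y) \<le> ((1 - t) * p x + t * p y) ^ (2 * m)"
    using sub[of "(1 - t) *\<^sub>R x" "t *\<^sub>R y"] t by (simp add: psc)
  also have "\<dots> \<le> (1 - t) * p x ^ (2 * m) + t * p y ^ (2 * m)"
    using convex_onD[OF convex_on_power_nonneg, of t "p x" "p y" "2 * m"] t pnn by simp
  finally show "?f ((1 - t) *\<^sub>R x + t *\<^sub>R y) \<le> (1 - t) * ?f x + t * ?f y" by (simp add: pp)
qed simp

text \<open>For the squared norm, convexity holds with the explicit defect t (1 - t) |x - y|^2. The
  m-th power is strictly increasing and convex on nonnegative reals, so strictness survives.\<close>

lemma norm_power_strictly_convex: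
  fixes x y :: "'a::real_inner"
  assumes xy: "x \<noteq> y" and t: "0 < t" "t < 1" and m: "m > 0"
  shows "norm ((1 - t) *\<^sub>R x + t *\<^sub>R y) ^ (2 * m) < (1 - t) * norm x ^ (2 * m) + t * norm y ^ (2 * m)"
proof -
  have "(norm ((1 - t) *\<^sub>R x + t *\<^sub>R y))\<^sup>2 = (1 - t) * (norm x)\<^sup>2 + t * (norm y)\<^sup>2 - t * (1 - t) * (norm (x - y))\<^sup>2"
    unfolding power2_norm_eq_inner
    by (simp add: inner_add_left inner_add_right inner_diff_left inner_diff_right inner_commute algebra_simps power2_eq_square)
  moreover have "t * (1 - t) * (norm (x - y))\<^sup>2 > 0" using xy t by simp
  ultimately have "(norm ((1 - t) *\<^sub>R x + t *\<^sub>R y))\<^sup>2 < (1 - t) * (norm x)\<^sup>2 + t * (norm y)\<^sup>2" by linarith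
  then have "((norm ((1 - t) *\<^sub>R x + t *\<^sub>R y))\<^sup>2) ^ m < ((1 - t) * (norm x)\<^sup>2 + t * (norm y)\<^sup>2) ^ m"
    using m by (intro power_strict_mono) auto
  also have "\<dots> \<le> (1 - t) * ((norm x)\<^sup>2) ^ m + t * ((norm y)\<^sup>2) ^ m"
    using convex_onD[OF convex_on_power_nonneg, of t "(norm x)\<^sup>2" "(norm y)\<^sup>2" m] t by simp
  finally show ?thesis by (simp add: power_mult)
qed

text \<open>A crude bound for the Hessian form of \<open>E\<close> on the unit sphere, chosen
  because it is visibly continuous in the coefficients.\<close>

definition hessian_size :: "nat \<Rightarrow> (('n::finite \<Rightarrow> nat) \<Rightarrow> real) \<Rightarrow> real" where
  "hessian_size m E = (\<Sum>k\<in>UNIV. \<Sum>l\<in>UNIV. \<Sum>\<beta> | (\<Sum>i\<in>UNIV. \<beta> i) = 2 * m - 2. \<bar>dcoef l (dcoef k E) \<beta>\<bar>)"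

lemma abs_hessian_le:
  "\<bar>\<Sum>k\<in>UNIV. \<Sum>l\<in>UNIV. pdd m E k l y * d $ l * d $ k\<bar> \<le> hessian_size m E * norm y ^ (2 * m - 2) * (norm d)\<^sup>2"
proof -
  have b: "\<bar>pdd m E k l y * d $ l * d $ k\<bar> \<le>
     (\<Sum>\<beta> | (\<Sum>i\<in>UNIV. \<beta> i) = 2 * m - 2. \<bar>dcoef l (dcoef k E) \<beta>\<bar>) * norm y ^ (2 * m - 2) * (norm d)\<^sup>2" for k l
    unfolding abs_mult power2_eq_square mult.assoc[symmetric] pdd_def
    by (intro mult_mono abs_hom_eval_le component_le_norm_cart mult_nonneg_nonneg sum_nonneg) auto
  have "\<bar>\<Sum>k\<in>UNIV. \<Sum>l\<in>UNIV. pdd m E k l y * d $ l * d $ k\<bar> \<le> (\<Sum>k\<in>UNIV. \<Sum>l\<in>UNIV. \<bar>pdd m E k l y * d $ l * d $ k\<bar>)"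
    by (intro order_trans[OF sum_abs] sum_mono) auto
  also have "\<dots> \<le> hessian_size m E * norm y ^ (2 * m - 2) * (norm d)\<^sup>2"
    unfolding hessian_size_def sum_distrib_right by (intro sum_mono b[unfolded sum_distrib_right])
  finally show ?thesis .
qed

text \<open>On each line the second derivative of \<epsilon> |x|^(2m) is at least \<epsilon> |z|^(2m
  - 2) |d|^2, and the Hessian of \<open>E\<close> is at most that in absolute value.\<close>

lemma hessian_dominated_convex:
  fixes E :: "('n::finite \<Rightarrow> nat) \<Rightarrow> real"
  assumes m: "m > 0" and e: "\<epsilon> \<ge> 0" and h: "hessian_size m E \<le> \<epsilon>"
  shows "convex_on UNIV (\<lambda>x. \<epsilon> * norm x ^ (2 * m) + hom_eval (2 * m) E x)"
proof (rule convex_onI)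
  fix t :: real and x y :: "real^'n" assume t: "0 < t" "t < 1"
  define d where "d = y - x"
  define z where "z s = x + s *\<^sub>R d" for s
  \<comment> \<open>The squared norm along the line as a polynomial in s, so that no exception
    arises if the line passes through 0.\<close>
  define q where "q s = x \<bullet> x + 2 * s * (x \<bullet> d) + s\<^sup>2 * (d \<bullet> d)" for s
  have q: "q s = (norm (z s))\<^sup>2" for s
    unfolding power2_norm_eq_inner z_def q_def
    by (simp add: inner_add_left inner_add_right inner_commute algebra_simps power2_eq_square)
  have qnn: "q s \<ge> 0" for s by (simp add: q)
  have dq: "(q has_real_derivative 2 * (x \<bullet> d) + 2 * s * (d \<bullet> d)) (at s)" for s
    unfolding q_def by (auto intro!: derivative_eq_intros)
  have ddq: "((\<lambda>s. 2 * (x \<bullet> d) + 2 * s * (d \<bullet> d)) has_real_derivative 2 * (d \<bullet> d)) (at s)" for s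
    by (auto intro!: derivative_eq_intros)
  have dz: "(z has_derivative (\<lambda>s. s *\<^sub>R d)) (at s)" for s
    unfolding z_def by (auto intro!: derivative_eq_intros)
  have dE: "((\<lambda>s. hom_eval (2 * m) E (z s)) has_real_derivative (\<Sum>k\<in>UNIV. pd m E k (z s) * d $ k)) (at s)" for s
    by (rule has_derivative_imp_has_field_derivative[OF has_derivative_compose[OF dz hom_eval_derivative_pd[OF m]]])
      (simp add: sum_distrib_left mult_ac)
  have dp: "((\<lambda>s. pd m E k (z s)) has_real_derivative (\<Sum>l\<in>UNIV. pdd m E k l (z s) * d $ l)) (at s)" for k s
    by (rule has_derivative_imp_has_field_derivative[OF has_derivative_compose[OF dz pd_has_derivative[OF m]]])
      (simp add: sum_distrib_left mult_ac)
  let ?H = "\<lambda>s. \<Sum>k\<in>UNIV. \<Sum>l\<in>UNIV. pdd m E k l (z s) * d $ l * d $ k"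
  have ddE: "((\<lambda>s. \<Sum>k\<in>UNIV. pd m E k (z s) * d $ k) has_real_derivative ?H s) (at s)" for s
    unfolding sum_distrib_right[symmetric] by (intro DERIV_sum DERIV_cmult_right dp)
  have "convex_on UNIV (\<lambda>s. \<epsilon> * q s ^ m + hom_eval (2 * m) E (z s))"
  proof (rule f''_ge0_imp_convex)
    fix s :: real
    let ?q1 = "\<lambda>s. 2 * (x \<bullet> d) + 2 * s * (d \<bullet> d)"
    show "((\<lambda>s. \<epsilon> * q s ^ m + hom_eval (2 * m) E (z s)) has_real_derivative
        \<epsilon> * (real m * (q s ^ (m - 1) * ?q1 s)) + (\<Sum>k\<in>UNIV. pd m E k (z s) * d $ k)) (at s)"
      using DERIV_power[OF dq, of m s]
      by (intro DERIV_add DERIV_cmult dE) (simp add: mult_ac)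
    \<comment> \<open>For m = 1 the exponent \<open>m - 2\<close> is truncated, but then the factor
      \<open>real (m - 1)\<close> is 0.\<close>
    have "((\<lambda>s. q s ^ (m - 1)) has_real_derivative real (m - 1) * (q s ^ (m - 2) * ?q1 s)) (at s)"
      using DERIV_power[OF dq, of "m - 1" s] by (simp add: mult_ac numeral_2_eq_2)
    from DERIV_mult[OF this ddq]
    show "((\<lambda>s. \<epsilon> * (real m * (q s ^ (m - 1) * ?q1 s)) + (\<Sum>k\<in>UNIV. pd m E k (z s) * d $ k)) has_real_derivative
        \<epsilon> * (real m * (real (m - 1) * (q s ^ (m - 2) * ?q1 s) * ?q1 s + 2 * (d \<bullet> d) * q s ^ (m - 1))) + ?H s) (at s)"
      by (intro DERIV_add DERIV_cmult ddE) 
    have "hessian_size m E * norm (z s) ^ (2 * m - 2) * (norm d)\<^sup>2 \<le> \<epsilon> * norm (z s) ^ (2 * m - 2) * (norm d)\<^sup>2"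
      using h by (intro mult_right_mono) auto
    then have "- (\<epsilon> * norm (z s) ^ (2 * m - 2) * (norm d)\<^sup>2) \<le> ?H s"
      using abs_hessian_le[of m E "z s" d] by linarith
    \<comment> \<open>The summand containing the square of \<open>?q1\<close> is nonnegative, and 2
      m |d|^2 q^(m - 1) alone exceeds what is required.\<close>
    moreover have "\<epsilon> * norm (z s) ^ (2 * m - 2) * (norm d)\<^sup>2 \<le>
      \<epsilon> * (real m * (real (m - 1) * (q s ^ (m - 2) * ?q1 s) * ?q1 s + 2 * (d \<bullet> d) * q s ^ (m - 1)))"
    proof -
      have n: "norm (z s) ^ (2 * m - 2) = q s ^ (m - 1)"
        unfolding q power_mult[symmetric] by (simp add: diff_mult_distrib2)
      have "real (m - 1) * (q s ^ (m - 2) * ?q1 s) * ?q1 s = real (m - 1) * q s ^ (m - 2) * (?q1 s)\<^sup>2"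
        by (simp add: power2_eq_square)
      also have "\<dots> \<ge> 0" using qnn by simp
      finally have a: "0 \<le> real (m - 1) * (q s ^ (m - 2) * ?q1 s) * ?q1 s" .
      have b: "0 \<le> (d \<bullet> d) * q s ^ (m - 1)" using qnn by simp
      have "q s ^ (m - 1) * (norm d)\<^sup>2 = 1 * ((d \<bullet> d) * q s ^ (m - 1))"
        by (simp add: power2_norm_eq_inner)
      also have "\<dots> \<le> real m * (real (m - 1) * (q s ^ (m - 2) * ?q1 s) * ?q1 s + 2 * (d \<bullet> d) * q s ^ (m - 1))"
        using a b m by (intro mult_mono) auto
      finally show ?thesis
        using e unfolding n mult.assoc by (intro mult_left_mono) auto
    qed
    ultimately show "0 \<le> \<epsilon> * (real m * (real (m - 1) * (q s ^ (m - 2) * ?q1 s) * ?q1 s + 2 * (d \<bullet> d) * q s ^ (m - 1))) + ?H s"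
      by linarith
  qed simp
  from convex_onD[OF this, of t 0 1] t
  have "\<epsilon> * q t ^ m + hom_eval (2 * m) E (z t) \<le>
     (1 - t) * (\<epsilon> * q 0 ^ m + hom_eval (2 * m) E (z 0)) + t * (\<epsilon> * q 1 ^ m + hom_eval (2 * m) E (z 1))"
    by simp
  moreover have "z t = (1 - t) *\<^sub>R x + t *\<^sub>R y" "z 0 = x" "z 1 = y"
    by (simp_all add: z_def d_def algebra_simps)
  moreover have "q s ^ m = norm (z s) ^ (2 * m)" for s by (simp add: q power_mult)
  ultimately show "\<epsilon> * norm ((1 - t) *\<^sub>R x + t *\<^sub>R y) ^ (2 * m) + hom_eval (2 * m) E ((1 - t) *\<^sub>R x + t *\<^sub>R y) \<le>
     (1 - t) * (\<epsilon> * norm x ^ (2 * m) + hom_eval (2 * m) E x) + t * (\<epsilon> * norm y ^ (2 * m) + hom_eval (2 * m) E y)"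
    by simp
qed simp

text \<open>The growth bound gives compactness. Strict convexity sends open segments into the set
  where the form is below 1, which is open and so interior to the body.\<close>

lemma U_set_if_strictly_convex:
  fixes R :: "('n::finite \<Rightarrow> nat) \<Rightarrow> real"
  assumes R: "R \<in> hom_polys (2 * m)" and m: "m > 0"
    and c: "c > 0" "\<And>x. c * norm x ^ (2 * m) \<le> hom_eval (2 * m) R x"
    and sc: "\<And>x y t. x \<noteq> y \<Longrightarrow> 0 < t \<Longrightarrow> t < 1 \<Longrightarrow> hom_eval (2 * m) R ((1 - t) *\<^sub>R x + t *\<^sub>R y) <
      (1 - t) * hom_eval (2 * m) R x + t * hom_eval (2 * m) R y"
  shows "R \<in> U_set m"
proof -
  let ?f = "hom_eval (2 * m) R" and ?D = "{v. hom_eval (2 * m) R v \<le> 1}"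
  have cont: "continuous_on UNIV ?f" by (intro continuous_intros)
  have "open {v. ?f v < 1}" by (intro open_Collect_less cont continuous_intros)
  then have int: "{v. ?f v < 1} \<subseteq> interior ?D" by (intro interior_maximal) auto
  have "closed ?D" by (intro closed_Collect_le cont continuous_intros)
  \<comment> \<open>If the norm exceeds 1, it is at most its 2m-th power, so c times the norm is at
    most 1.\<close>
  moreover have "norm v \<le> max 1 (1 / c)" if "v \<in> ?D" for v
  proof (cases "norm v \<le> 1")
    case False
    have "c * norm v \<le> c * norm v ^ (2 * m)"
      using False c(1) m self_le_power[of "norm v" "2 * m"] by simp
    also have "\<dots> \<le> 1" using c(2)[of v] that by simp
    finally have "norm v \<le> 1 / c" using c(1) by (simp add: field_simps)
    then show ?thesis by simp
  qed simp
  then have "bounded ?D" unfolding bounded_iff by blast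
  ultimately have "compact ?D" by (simp add: compact_eq_bounded_closed)
  moreover have seg: "?f ((1 - t) *\<^sub>R x + t *\<^sub>R y) < 1" if "x \<in> ?D" "y \<in> ?D" "x \<noteq> y" "0 < t" "t < 1" for x y t
  proof -
    have "(1 - t) * ?f x + t * ?f y \<le> (1 - t) * 1 + t * 1"
      using that by (intro add_mono mult_left_mono) auto
    then show ?thesis using sc[OF that(3-5)] by simp
  qed
  have "convex ?D"
    unfolding convex_alt
  proof (intro ballI allI impI; elim conjE)
    fix x y and u :: real assume xy: "x \<in> ?D" "y \<in> ?D" "0 \<le> u" "u \<le> 1"
    show "(1 - u) *\<^sub>R x + u *\<^sub>R y \<in> ?D"
    proof (cases "x = y \<or> u = 0 \<or> u = 1")
      case True
      then show ?thesis using xy by (auto simp: algebra_simps)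
    next
      case False
      then show ?thesis using seg[OF xy(1,2), of u] xy(3,4) by simp
    qed
  qed
  moreover have "interior ?D \<noteq> {}"
  proof -
    have "?f 0 = 0" using hom_eval_scaleR[of "2 * m" R 0 0] m by (simp add: power_0_left)
    then have "0 \<in> {v. ?f v < 1}" by simp
    then show ?thesis using int by blast
  qed
  moreover have "open_segment x y \<subseteq> interior ?D" if "x \<in> ?D" "y \<in> ?D" "x \<noteq> y" for x y
    using seg[OF that] by (auto simp: in_segment intro!: subsetD[OF int])
  ultimately show ?thesis using R unfolding U_set_def strictly_convex_body_def by blast
qed

text \<open>A form near \<open>P1\<close> is split into the convex \<open>P\<close>, the deviation
  from \<open>P1\<close> plus one half of the norm term (convex by domination of the Hessian), and
  the other half of the norm term, which provides strictness and growth.\<close>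

lemma U_set_perturbation:
  fixes P N0 :: "('n::finite \<Rightarrow> nat) \<Rightarrow> real"
  assumes P: "P \<in> U_set m" and m: "m > 0" and e: "\<epsilon> > 0"
    and N0: "\<And>x. hom_eval (2 * m) N0 x = norm x ^ (2 * m)"
  defines "P1 \<equiv> (\<lambda>\<alpha>. P \<alpha> + \<epsilon> * N0 \<alpha>)"
  shows "\<exists>A. open A \<and> P1 \<in> A \<and> A \<inter> hom_polys (2 * m) \<subseteq> U_set m"
proof -
  let ?diff = "\<lambda>R \<alpha>. R \<alpha> + - P1 \<alpha>"
  let ?h1 = "\<lambda>R. hessian_size m (?diff R)"
  let ?h2 = "\<lambda>R. \<Sum>\<alpha> | (\<Sum>i\<in>UNIV. \<alpha> i) = 2 * m. \<bar>?diff R \<alpha>\<bar>"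
  have cd: "continuous_on UNIV ?diff"
    by (intro continuous_on_coordinatewise_then_product continuous_intros
        continuous_on_product_then_coordinatewise[OF continuous_on_id])
  have ch1: "continuous_on UNIV ?h1"
    unfolding hessian_size_def
    by (intro continuous_intros continuous_on_product_then_coordinatewise[OF continuous_on_dcoef[OF continuous_on_dcoef[OF cd]]])
  have ch2: "continuous_on UNIV ?h2"
    by (intro continuous_intros continuous_on_product_then_coordinatewise[OF continuous_on_id])
  \<comment> \<open>The first condition bounds the Hessian of the deviation, for convexity; the
    second bounds its values, for the lower bound.\<close>
  let ?A = "{R. ?h1 R < \<epsilon> / 2} \<inter> {R. ?h2 R < \<epsilon> / 4}"
  have "?h1 P1 < \<epsilon> / 2" "?h2 P1 < \<epsilon> / 4" using e by (simp_all add: hessian_size_def dcoef_def)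
  then have "open ?A" "P1 \<in> ?A"
    using open_continuous_sublevel[OF ch1] open_continuous_sublevel[OF ch2] by blast+
  moreover have "R \<in> U_set m" if R: "R \<in> ?A" "R \<in> hom_polys (2 * m)" for R
  proof (rule U_set_if_strictly_convex[OF R(2) m, of "\<epsilon> / 2"])
    have eq: "hom_eval (2 * m) R x = hom_eval (2 * m) P x
       + (\<epsilon> / 2 * norm x ^ (2 * m) + hom_eval (2 * m) (?diff R) x) + \<epsilon> / 2 * norm x ^ (2 * m)" for x
    proof -
      have "R = (\<lambda>\<alpha>. P \<alpha> + (\<epsilon> * N0 \<alpha> + ?diff R \<alpha>))" by (simp add: P1_def)
      then have "hom_eval (2 * m) R x = hom_eval (2 * m) (\<lambda>\<alpha>. P \<alpha> + (\<epsilon> * N0 \<alpha> + ?diff R \<alpha>)) x" by simp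
      also have "\<dots> = hom_eval (2 * m) P x + (\<epsilon> * norm x ^ (2 * m) + hom_eval (2 * m) (?diff R) x)"
        by (simp only: hom_eval_add[of _ P] hom_eval_add[of _ "\<lambda>\<alpha>. \<epsilon> * N0 \<alpha>"] hom_eval_cmult N0)
      finally show ?thesis by simp
    qed
    show "\<epsilon> / 2 > 0" using e by simp
    show "\<epsilon> / 2 * norm x ^ (2 * m) \<le> hom_eval (2 * m) R x" for x
    proof -
      have "\<bar>hom_eval (2 * m) (?diff R) x\<bar> \<le> ?h2 R * norm x ^ (2 * m)" by (rule abs_hom_eval_le)
      also have "\<dots> \<le> \<epsilon> / 2 * norm x ^ (2 * m)" using R(1) e by (intro mult_right_mono) auto
      finally have "0 \<le> \<epsilon> / 2 * norm x ^ (2 * m) + hom_eval (2 * m) (?diff R) x" by linarith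
      moreover have "hom_eval (2 * m) P x \<ge> 0"
        using U_set_positive_form[OF P m] hom_eval_scaleR[of "2 * m" P 0 0] m unfolding positive_form_def
        by (cases "x = 0") (auto simp: power_0_left intro: less_imp_le)
      ultimately show ?thesis unfolding eq by linarith
    qed
    fix x y :: "real^'n" and t :: real assume xy: "x \<noteq> y" and t: "0 < t" "t < 1"
    let ?z = "(1 - t) *\<^sub>R x + t *\<^sub>R y"
    have 1: "hom_eval (2 * m) P ?z \<le> (1 - t) * hom_eval (2 * m) P x + t * hom_eval (2 * m) P y"
      using convex_onD[OF convex_on_hom_eval_U_set[OF P m]] t by simp
    have "convex_on UNIV (\<lambda>x. \<epsilon> / 2 * norm x ^ (2 * m) + hom_eval (2 * m) (?diff R) x)"
      using R(1) e by (intro hessian_dominated_convex[OF m]) auto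
    from convex_onD[OF this, of t x y] t
    have 2: "\<epsilon> / 2 * norm ?z ^ (2 * m) + hom_eval (2 * m) (?diff R) ?z \<le>
       (1 - t) * (\<epsilon> / 2 * norm x ^ (2 * m) + hom_eval (2 * m) (?diff R) x) + t * (\<epsilon> / 2 * norm y ^ (2 * m) + hom_eval (2 * m) (?diff R) y)"
      by simp
    have "\<epsilon> / 2 * norm ?z ^ (2 * m) < \<epsilon> / 2 * ((1 - t) * norm x ^ (2 * m) + t * norm y ^ (2 * m))"
      using norm_power_strictly_convex[OF xy t m] e by (intro mult_strict_left_mono) auto
    then have 3: "\<epsilon> / 2 * norm ?z ^ (2 * m) < (1 - t) * (\<epsilon> / 2 * norm x ^ (2 * m)) + t * (\<epsilon> / 2 * norm y ^ (2 * m))"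
      by (simp only: distrib_left mult.left_commute)
    have comb: "(1 - t) * (a + b + c) + t * (a' + b' + c') =
      ((1 - t) * a + t * a') + ((1 - t) * b + t * b') + ((1 - t) * c + t * c')" for a b c a' b' c' :: real
      by (simp add: algebra_simps)
    show "hom_eval (2 * m) R ?z < (1 - t) * hom_eval (2 * m) R x + t * hom_eval (2 * m) R y"
      unfolding eq comb by (rule add_le_less_mono[OF add_mono[OF 1 2] 3])
  qed
  ultimately show ?thesis by blast
qed

section \<open>Openness and density\<close>

text \<open>The gradients at the rows, divided by 2m, form the basis dual to the rows, so the rows
  are linearly independent.\<close>

lemma polar_frame_det_nonzero:
  assumes m: "m > 0" and fr: "polar_frame m P w"
  shows "det w \<noteq> 0"
proof -
  let ?G = "(\<chi> i k. pd m P k (w $ i) / (2 * real m)) :: real^'a^'a"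
  have "?G ** transpose w = mat 1"
  proof (simp only: vec_eq_iff, intro allI)
    fix i j
    have "(?G ** transpose w) $ i $ j = polar m P w i j / (2 * real m)"
      by (simp add: matrix_matrix_mult_def transpose_def polar_def sum_divide_distrib)
    then show "(?G ** transpose w) $ i $ j = mat 1 $ i $ j"
      using fr m by (simp add: polar_frame_def mat_def)
  qed
  then have "det ?G * det w = 1" by (metis det_I det_mul det_transpose)
  then show ?thesis by auto
qed

text \<open>Failure of regularity with a unit witness \<open>Z\<close> is a closed condition on
  form, frame and \<open>Z\<close> together, and the pairs of frame and witness range over a compact
  set. Witnesses can be normalised since \<open>dpolar\<close> is homogeneous in
  \<open>Z\<close>.\<close>

lemma regular_on_compact_stable:
  fixes P :: "('n::finite \<Rightarrow> nat) \<Rightarrow> real"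
  assumes C: "compact C" and reg: "\<And>w. w \<in> C \<Longrightarrow> regular_at m P w"
  shows "\<exists>A. open A \<and> P \<in> A \<and> (\<forall>R\<in>A. \<forall>w\<in>C. regular_at m R w)"
proof -
  let ?R = "\<lambda>R (w, Z). \<not> (polar_frame m R w \<and> (\<forall>i j. dpolar m R w Z i j = 0))"
  have "\<exists>A. open A \<and> P \<in> A \<and> (\<forall>R\<in>A. \<forall>wZ\<in>C \<times> sphere 0 1. ?R R wZ)"
  proof (rule compact_tube)
    show "compact (C \<times> sphere (0 :: real^'n^'n) 1)" by (intro compact_Times C compact_sphere)
    fix y :: "(real^'n^'n) \<times> (real^'n^'n)" assume y: "y \<in> C \<times> sphere 0 1"
    let ?K = "{z :: (('n \<Rightarrow> nat) \<Rightarrow> real) \<times> (real^'n^'n) \<times> (real^'n^'n).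
      (\<forall>i j. polar m (fst z) (fst (snd z)) i j = (if i = j then 2 * real m else 0)) \<and>
      (\<forall>i j. dpolar m (fst z) (fst (snd z)) (snd (snd z)) i j = 0)}"
    have K: "z \<in> ?K \<longleftrightarrow> polar_frame m (fst z) (fst (snd z)) \<and>
        (\<forall>i j. dpolar m (fst z) (fst (snd z)) (snd (snd z)) i j = 0)" for z
      by (simp only: polar_frame_def mem_Collect_eq)
    have "closed ?K"
      by (intro closed_Collect_conj closed_Collect_all closed_Collect_eq continuous_intros)
    moreover have "(P, y) \<notin> ?K"
    proof
      assume "(P, y) \<in> ?K"
      then have "polar_frame m P (fst y)" "\<forall>i j. dpolar m P (fst y) (snd y) i j = 0"
        unfolding K by simp_all
      then have "snd y = 0" using reg[of "fst y"] y unfolding regular_at_def by auto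
      then show False using y by auto
    qed
    moreover have "?R (fst z) (snd z)" if "z \<in> - ?K" for z
      using that unfolding Compl_iff K case_prod_beta .
    then have "\<forall>(a, b)\<in>- ?K. ?R a b" by (intro ballI) (simp only: case_prod_beta not_False_eq_True)
    ultimately show "\<exists>W. open W \<and> (P, y) \<in> W \<and> (\<forall>(a, b)\<in>W. ?R a b)"
      by (intro exI[of _ "- ?K"] conjI open_Compl) simp_all
  qed
  then obtain A where A: "open A" "P \<in> A" and all: "\<forall>R\<in>A. \<forall>wZ\<in>C \<times> sphere 0 1. ?R R wZ"
    by (elim exE conjE)
  have ns: "R \<in> A \<Longrightarrow> w \<in> C \<Longrightarrow> norm Z = 1 \<Longrightarrow> polar_frame m R w \<Longrightarrow> \<forall>i j. dpolar m R w Z i j = 0 \<Longrightarrow> False" for R w Z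
    using all[rule_format, of R "(w, Z)"] by simp
  have "regular_at m R w" if Rw: "R \<in> A" "w \<in> C" for R w
    unfolding regular_at_def
  proof (intro impI allI; rule ccontr)
    fix Z assume fr: "polar_frame m R w" and Z: "\<forall>i j. dpolar m R w Z i j = 0" "Z \<noteq> 0"
    show False
      by (rule ns[OF Rw _ fr, of "inverse (norm Z) *\<^sub>R Z"]) (use Z in \<open>simp_all add: dpolar_scaleR\<close>)
  qed
  then show ?thesis using A by blast
qed

text \<open>The weak inequality for \<open>det\<close> makes the set closed; polar frames never lie
  on the added boundary, by \<open>polar_frame_det_nonzero\<close> (for
  \<open>m > 0\<close>).\<close>

definition bounded_frames :: "real \<Rightarrow> (real^'n^'n::finite) set" where
  "bounded_frames \<rho> = {w. (\<forall>i. norm (w $ i) \<le> \<rho>) \<and> det w \<ge> 0}"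

lemma compact_bounded_frames: "compact (bounded_frames \<rho> :: (real^'n^'n::finite) set)"
proof -
  have "norm w \<le> real CARD('n) * \<rho>" if "w \<in> bounded_frames \<rho>" for w :: "real^'n^'n"
  proof -
    have "norm w \<le> (\<Sum>i\<in>UNIV. norm (w $ i))" unfolding norm_vec_def by (rule L2_set_le_sum) simp
    also have "\<dots> \<le> (\<Sum>i\<in>(UNIV :: 'n set). \<rho>)" using that by (intro sum_mono) (simp add: bounded_frames_def)
    finally show ?thesis by simp
  qed
  then have "bounded (bounded_frames \<rho> :: (real^'n^'n) set)" unfolding bounded_iff by blast
  moreover have "closed (bounded_frames \<rho> :: (real^'n^'n) set)"
    unfolding bounded_frames_def
    by (intro closed_Collect_conj closed_Collect_all closed_Collect_le continuous_intros)
  ultimately show ?thesis by (simp add: compact_eq_bounded_closed)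
qed

text \<open>The diagonal equations place each row on the level set P = 1, which the growth bound
  confines.\<close>

lemma polar_frame_bounded:
  assumes m: "m > 0" and c: "c > 0" "\<And>x. c * norm x ^ (2 * m) \<le> hom_eval (2 * m) R x"
    and fr: "polar_frame m R w" and det: "det w \<ge> 0"
  shows "w \<in> bounded_frames (max 1 (1 / c))"
proof -
  have "norm (w $ i) \<le> max 1 (1 / c)" for i
  proof (cases "norm (w $ i) \<le> 1")
    case False
    have "2 * real m * hom_eval (2 * m) R (w $ i) = 2 * real m"
      using fr polar_diagonal[OF m, of R w i] by (simp add: polar_frame_def)
    then have one: "hom_eval (2 * m) R (w $ i) = 1" using m by simp
    have "c * norm (w $ i) \<le> c * norm (w $ i) ^ (2 * m)"
      using False c(1) m self_le_power[of "norm (w $ i)" "2 * m"] by simp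
    also have "\<dots> \<le> 1" using c(2)[of "w $ i"] one by simp
    finally have "norm (w $ i) \<le> 1 / c" using c(1) by (simp add: field_simps)
    then show ?thesis by simp
  qed simp
  then show ?thesis using det by (simp add: bounded_frames_def)
qed

lemma good_polynomial_if_regular:
  assumes "m > 0" "c > 0" "\<And>x. c * norm x ^ (2 * m) \<le> hom_eval (2 * m) R x"
    and "\<And>w. w \<in> bounded_frames (max 1 (1 / c)) \<Longrightarrow> regular_at m R w"
  shows "good_polynomial m R"
  unfolding good_polynomial_def
proof (intro allI impI; elim conjE)
  fix w Z assume "det w > 0" "polar_frame m R w" "\<forall>i j. dpolar m R w Z i j = 0"
  then show "Z = 0"
    using assms(4)[OF polar_frame_bounded[OF assms(1-3)], of w] unfolding regular_at_def by simp
qed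

text \<open>For \<open>P\<close> itself frames with zero determinant are excluded, so goodness
  amounts to regularity on a whole compact set and is stable there. Nearby forms have no positively
  oriented polar frames elsewhere, thanks to the common constant \<open>c\<close>.\<close>

lemma good_polynomial_stable:
  assumes m: "m > 0" and pos: "positive_form m P" and good: "good_polynomial m P"
  shows "\<exists>A. open A \<and> P \<in> A \<and> (\<forall>R\<in>A. good_polynomial m R)"
proof -
  obtain A c where A: "open A" "P \<in> A" "c > 0" "\<And>R x. R \<in> A \<Longrightarrow> c * norm x ^ (2 * m) \<le> hom_eval (2 * m) R x"
    using positive_form_lower_bound[OF pos m] by blast
  have "regular_at m P w" if "w \<in> bounded_frames (max 1 (1 / c))" for w
    unfolding regular_at_def
  proof (intro impI)
    assume fr: "polar_frame m P w"
    then have "det w > 0" using polar_frame_det_nonzero[OF m fr] that by (simp add: bounded_frames_def)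
    then show "\<forall>Z. (\<forall>i j. dpolar m P w Z i j = 0) \<longrightarrow> Z = 0"
      using good fr unfolding good_polynomial_def by blast
  qed
  then have "\<exists>A'. open A' \<and> P \<in> A' \<and> (\<forall>R\<in>A'. \<forall>w\<in>bounded_frames (max 1 (1 / c)). regular_at m R w)"
    by (intro regular_on_compact_stable compact_bounded_frames)
  then obtain A' where A': "open A'" "P \<in> A'" "\<forall>R\<in>A'. \<forall>w\<in>bounded_frames (max 1 (1 / c)). regular_at m R w"
    by (elim exE conjE)
  have "good_polynomial m R" if "R \<in> A \<inter> A'" for R
  proof (rule good_polynomial_if_regular[OF m A(3)])
    show "c * norm x ^ (2 * m) \<le> hom_eval (2 * m) R x" for x using A(4) that by simp
    show "regular_at m R w" if "w \<in> bounded_frames (max 1 (1 / c))" for w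
      using A'(3) \<open>R \<in> A \<inter> A'\<close> that by simp
  qed
  moreover have "open (A \<inter> A')" "P \<in> A \<inter> A'" using A(1,2) A'(1,2) by auto
  ultimately show ?thesis by (intro exI[of _ "A \<inter> A'"]) simp
qed

text \<open>The form may vary in \<open>A\<close> while the frames in question stay fixed, and
  \<open>O'\<close> prescribes in advance how small the move must be. This is what permits
  improvements on several sets to be chained.\<close>

definition locally_improvable :: "nat \<Rightarrow> (('n::finite \<Rightarrow> nat) \<Rightarrow> real) set \<Rightarrow> (real^'n^'n) set \<Rightarrow> bool" where
  "locally_improvable m A N \<longleftrightarrow> (\<forall>P O'. P \<in> A \<inter> hom_polys (2 * m) \<longrightarrow> open O' \<longrightarrow> P \<in> O' \<longrightarrow>
     (\<exists>R\<in>O' \<inter> hom_polys (2 * m). \<forall>w\<in>N. regular_at m R w))"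

text \<open>Either \<open>w\<close> is a polar frame of \<open>P1\<close>, and local transversality
  applies to every form, or no form near \<open>P1\<close> has a polar frame near \<open>w\<close>,
  and regularity is vacuous.\<close>

lemma exists_locally_improvable:
  fixes P1 :: "('n::finite \<Rightarrow> nat) \<Rightarrow> real"
  assumes m: "m > 1"
  shows "\<exists>A N. open A \<and> P1 \<in> A \<and> open N \<and> w \<in> N \<and> locally_improvable m A N"
proof (cases "polar_frame m P1 w")
  case True
  then have dw: "det w \<noteq> 0" using polar_frame_det_nonzero[of m P1 w] m by simp
  obtain N Q where N: "open N" "w \<in> N"
    and Q: "\<And>k l. Q k l \<in> hom_polys (2 * m)"
    and small: "\<And>P \<epsilon>. \<epsilon> > 0 \<Longrightarrow> \<exists>a. norm a < \<epsilon> \<and> (\<forall>w\<in>N. regular_at m (perturb P Q a) w)"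
    by (rule local_transversality[OF m dw]) (rule that)
  have "locally_improvable m UNIV N"
    unfolding locally_improvable_def
  proof (intro allI impI)
    fix P :: "('n \<Rightarrow> nat) \<Rightarrow> real" and O' assume P: "P \<in> UNIV \<inter> hom_polys (2 * m)" and O': "open O'" "P \<in> O'"
    have "continuous_on UNIV (perturb P Q)"
      unfolding perturb_def[abs_def] by (intro continuous_on_coordinatewise_then_product continuous_intros)
    then have "open (perturb P Q -` O')" using O'(1) continuous_on_open_vimage[of UNIV "perturb P Q"] by auto
    moreover have "perturb P Q 0 = P" by (simp add: perturb_def)
    then have "0 \<in> perturb P Q -` O'" using O'(2) by simp
    ultimately obtain \<epsilon> where \<epsilon>: "\<epsilon> > 0" "ball 0 \<epsilon> \<subseteq> perturb P Q -` O'"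
      using openE by blast
    obtain a where a: "norm a < \<epsilon>" "\<forall>w\<in>N. regular_at m (perturb P Q a) w" using small[OF \<epsilon>(1)] by blast
    have "perturb P Q a \<in> O'" using a(1) \<epsilon>(2) by auto
    moreover have "perturb P Q a \<in> hom_polys (2 * m)"
      using P Q unfolding hom_polys_def perturb_def by simp
    ultimately show "\<exists>R\<in>O' \<inter> hom_polys (2 * m). \<forall>w\<in>N. regular_at m R w" using a(2) by blast
  qed
  then show ?thesis using N by (intro exI[of _ UNIV] exI[of _ N]) auto
next
  case False
  let ?K = "{z :: (('n \<Rightarrow> nat) \<Rightarrow> real) \<times> (real^'n^'n).
      \<forall>i j. polar m (fst z) (snd z) i j = (if i = j then 2 * real m else 0)}"
  have "open (- ?K)"
    by (intro open_Compl closed_Collect_all closed_Collect_eq continuous_intros)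
  moreover have "(P1, w) \<in> - ?K" using False by (simp add: polar_frame_def)
  ultimately obtain A N where AN: "open A" "open N" "(P1, w) \<in> A \<times> N" "A \<times> N \<subseteq> - ?K"
    by (rule open_prod_elim)
  have "regular_at m R w'" if "R \<in> A" "w' \<in> N" for R w'
  proof -
    have "(R, w') \<in> - ?K" using AN(4) that by blast
    then have "\<not> polar_frame m R w'" by (simp only: polar_frame_def Compl_iff mem_Collect_eq fst_conv snd_conv not_False_eq_True)
    then show ?thesis by (simp add: regular_at_def)
  qed
  then have "locally_improvable m A N"
    unfolding locally_improvable_def
  proof (intro allI impI)
    fix P O' assume "P \<in> A \<inter> hom_polys (2 * m)" "P \<in> O'" and reg: "\<And>R w'. R \<in> A \<Longrightarrow> w' \<in> N \<Longrightarrow> regular_at m R w'"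
    then show "\<exists>R\<in>O' \<inter> hom_polys (2 * m). \<forall>w\<in>N. regular_at m R w" by (intro bexI[of _ P]) auto
  qed
  moreover have "P1 \<in> A" "w \<in> N" using AN(3) by simp_all
  ultimately show ?thesis using AN(1,2) by blast
qed

text \<open>All relevant frames of forms near \<open>P1\<close> lie in one compact set, covered by
  finitely many balls. Induction over the balls improves the form on one more ball without losing
  those already done.\<close>

lemma good_polynomials_dense:
  fixes P1 :: "('n::finite \<Rightarrow> nat) \<Rightarrow> real"
  assumes m: "m > 1" and pos: "positive_form m P1" and P1: "P1 \<in> hom_polys (2 * m)"
    and O': "open O'" "P1 \<in> O'"
  shows "\<exists>R\<in>O' \<inter> hom_polys (2 * m). good_polynomial m R"
proof -
  have m0: "m > 0" using m by simp
  obtain A1 c where A1: "open A1" "P1 \<in> A1" "c > 0"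
    "\<And>R x. R \<in> A1 \<Longrightarrow> c * norm x ^ (2 * m) \<le> hom_eval (2 * m) R x"
    using positive_form_lower_bound[OF pos m0] by blast
  define K where "K = (bounded_frames (max 1 (1 / c)) :: (real^'n^'n) set)"
  have "\<forall>w. \<exists>A e. open A \<and> P1 \<in> A \<and> e > 0 \<and> locally_improvable m A (cball w e)"
  proof
    fix w :: "real^'n^'n"
    obtain A N where AN: "open A" "P1 \<in> A" "open N" "w \<in> N" "locally_improvable m A N"
      using exists_locally_improvable[OF m] by blast
    obtain e where e: "e > 0" "cball w e \<subseteq> N" using AN(3,4) open_contains_cball by blast
    have "locally_improvable m A (cball w e)"
      using AN(5) e(2) unfolding locally_improvable_def by (meson subsetD)
    then show "\<exists>A e. open A \<and> P1 \<in> A \<and> e > 0 \<and> locally_improvable m A (cball w e)"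
      using AN e by blast
  qed
  then obtain A e where Ae: "\<And>w. open (A w)" "\<And>w. P1 \<in> A w" "\<And>w. e w > 0"
    "\<And>w. locally_improvable m (A w) (cball w (e w))" by metis
  have "compact K" unfolding K_def by (rule compact_bounded_frames)
  moreover have "K \<subseteq> (\<Union>w\<in>K. ball w (e w))" using Ae(3) by auto
  ultimately obtain D where D: "finite D" "K \<subseteq> (\<Union>w\<in>D. ball w (e w))"
    using compactE_image[of K K "\<lambda>w. ball w (e w)"] open_ball by metis
  \<comment> \<open>Staying in \<open>V\<close> keeps the form close to \<open>P1\<close>, its
    frames confined, and every remaining ball improvable.\<close>
  define V where "V = O' \<inter> A1 \<inter> (\<Inter>w\<in>D. A w)"
  have V: "open V" "P1 \<in> V"
    unfolding V_def using O' A1 Ae D(1) by (auto intro!: open_Int open_INT)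
  have "\<exists>R\<in>V \<inter> hom_polys (2 * m). \<forall>w\<in>D'. \<forall>w'\<in>cball w (e w). regular_at m R w'" if "D' \<subseteq> D" for D'
    using finite_subset[OF that D(1)] that
  proof (induction D' rule: finite_induct)
    case empty
    then show ?case using V P1 by blast
  next
    case (insert w0 D')
    then obtain R where R: "R \<in> V \<inter> hom_polys (2 * m)" "\<And>w w'. w \<in> D' \<Longrightarrow> w' \<in> cball w (e w) \<Longrightarrow> regular_at m R w'"
      by blast
    \<comment> \<open>Closed balls make the region already treated compact, so regularity there
      persists on a neighbourhood \<open>B\<close> of \<open>R\<close>; the next move is taken
      inside \<open>V \<inter> B\<close>.\<close>
    have "compact (\<Union>w\<in>D'. cball w (e w))" using insert.hyps(1) by (intro compact_UN) auto
    moreover have "regular_at m R w'" if "w' \<in> (\<Union>w\<in>D'. cball w (e w))" for w'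
      using that R(2) by blast
    ultimately obtain B where B: "open B" "R \<in> B" "\<And>R' w'. R' \<in> B \<Longrightarrow> w' \<in> (\<Union>w\<in>D'. cball w (e w)) \<Longrightarrow> regular_at m R' w'"
      using regular_on_compact_stable[of "\<Union>w\<in>D'. cball w (e w)" m R] by blast
    have "R \<in> A w0 \<inter> hom_polys (2 * m)" using R(1) insert.prems by (auto simp: V_def)
    moreover have "open (V \<inter> B)" "R \<in> V \<inter> B" using V B R by auto
    ultimately obtain R' where R': "R' \<in> V \<inter> B \<inter> hom_polys (2 * m)" "\<forall>w\<in>cball w0 (e w0). regular_at m R' w"
      using Ae(4)[of w0] unfolding locally_improvable_def by blast
    then show ?case using B(3) by blast
  qed
  from this[OF subset_refl] obtain R where R: "R \<in> V \<inter> hom_polys (2 * m)"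
    "\<forall>w\<in>D. \<forall>w'\<in>cball w (e w). regular_at m R w'"
    by (elim bexE)
  have "good_polynomial m R"
  proof (rule good_polynomial_if_regular[OF m0 A1(3)])
    show "c * norm x ^ (2 * m) \<le> hom_eval (2 * m) R x" for x using A1(4) R(1) by (simp add: V_def)
    fix w :: "real^'n^'n" assume "w \<in> bounded_frames (max 1 (1 / c))"
    then obtain w0 where "w0 \<in> D" "w \<in> ball w0 (e w0)" using D(2) unfolding K_def by blast
    then show "regular_at m R w" using R(2) by simp
  qed
  then show ?thesis using R(1) unfolding V_def by blast
qed

theorem mainTheorem4:
  fixes m :: nat
  assumes "CARD('n::finite) > 1" and "m > 1"
  shows "openin (top_of_set (U_set m)) {P \<in> U_set m. morse_on W_pos (g_fun m (P :: ('n \<Rightarrow> nat) \<Rightarrow> real))}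
    \<and> U_set m \<subseteq> closure {P \<in> U_set m. morse_on W_pos (g_fun m (P :: ('n \<Rightarrow> nat) \<Rightarrow> real))}"
proof
  have m: "m > 0" using assms(2) by simp
  have morse: "morse_on W_pos (g_fun m P) \<longleftrightarrow> good_polynomial m P" if "P \<in> U_set m" for P :: "('n \<Rightarrow> nat) \<Rightarrow> real"
    by (rule morse_iff_good_polynomial[OF m U_set_positive_form[OF that m]])
  let ?M = "{P \<in> U_set m. morse_on W_pos (g_fun m (P :: ('n \<Rightarrow> nat) \<Rightarrow> real))}"
  show "openin (top_of_set (U_set m)) ?M"
  proof (subst openin_subopen, intro ballI)
    fix P assume P: "P \<in> ?M"
    then obtain A where A: "open A" "P \<in> A" "\<And>R. R \<in> A \<Longrightarrow> good_polynomial m R"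
      using good_polynomial_stable[OF m U_set_positive_form[OF _ m], of P] morse by blast
    have "openin (top_of_set (U_set m)) (U_set m \<inter> A)" using A(1) by (rule openin_open_Int)
    moreover have "U_set m \<inter> A \<subseteq> ?M" using A(3) morse by blast
    ultimately show "\<exists>T. openin (top_of_set (U_set m)) T \<and> P \<in> T \<and> T \<subseteq> ?M" using A(2) P by blast
  qed
  show "U_set m \<subseteq> closure ?M"
  proof
    fix P :: "('n \<Rightarrow> nat) \<Rightarrow> real" assume P: "P \<in> U_set m"
    have "\<exists>R\<in>?M. R \<in> T" if T: "open T" "P \<in> T" for T
    proof -
      obtain N0 :: "('n \<Rightarrow> nat) \<Rightarrow> real" where N0: "N0 \<in> hom_polys (2 * m)" "\<And>x. hom_eval (2 * m) N0 x = norm x ^ (2 * m)"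
        using hom_poly_fun_norm_power[of m] unfolding hom_poly_fun_def by metis
      define p where "p \<epsilon> = (\<lambda>\<alpha>. P \<alpha> + \<epsilon> * N0 \<alpha>)" for \<epsilon> :: real
      have "continuous_on UNIV p"
        unfolding p_def by (intro continuous_on_coordinatewise_then_product continuous_intros)
      then have "open (p -` T)" using T(1) continuous_on_open_vimage[of UNIV p] by auto
      moreover have "0 \<in> p -` T" using T(2) by (simp add: p_def)
      ultimately obtain r where r: "r > 0" "ball 0 r \<subseteq> p -` T" using openE by blast
      define \<epsilon> where "\<epsilon> = r / 2"
      have "\<epsilon> \<in> ball 0 r" using r(1) by (simp add: \<epsilon>_def dist_norm)
      then have "\<epsilon> \<in> p -` T" using r(2) by (rule rev_subsetD)
      then have \<epsilon>: "\<epsilon> > 0" "p \<epsilon> \<in> T" using r(1) by (simp_all add: \<epsilon>_def)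
      obtain A where A: "open A" "p \<epsilon> \<in> A" "A \<inter> hom_polys (2 * m) \<subseteq> U_set m"
        using U_set_perturbation[OF P m \<epsilon>(1) N0(2)] unfolding p_def by blast
      have hp: "p \<epsilon> \<in> hom_polys (2 * m)"
        using P N0(1) by (simp add: U_set_def hom_polys_def p_def)
      then have "positive_form m (p \<epsilon>)" using A U_set_positive_form[OF _ m] by blast
      \<comment> \<open>\<open>T\<close> keeps the perturbed form close to \<open>P\<close>, and
        \<open>A\<close> keeps it in \<open>U_set m\<close>.\<close>
      then obtain R where "R \<in> T \<inter> A \<inter> hom_polys (2 * m)" "good_polynomial m R"
        using good_polynomials_dense[OF assms(2) _ hp, of "T \<inter> A"] T A \<epsilon>(2) by blast
      then show ?thesis using A(3) morse by blast
    qed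
    then show "P \<in> closure ?M"
      unfolding closure_iff_nhds_not_empty by blast
  qed
qed

end
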